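(* Let $\alpha>0$ and $0\le\varepsilon\le4$. If $\mathscr H_\varepsilon(v)<\pi(4+\varepsilon)$ for some $v\in N_\alpha$, then $\mathscr H_\varepsilon$ attains a minimum on $N_\alpha$ at some $u\in N_\alpha$, and $u\in C^\infty([-1,1])$.
   Context: $N_\alpha:=\{u\in H^2(-1,1): u \text{ even},\ u>0 \text{ on }[-1,1],\ u(\pm1)=\alpha,\ u'(\pm1)=0\}$; $\mathscr A(u)=2\pi\int_{-1}^1u\sqrt{1+u'^2}\,dx$, $\mathscr W(u)=\frac\pi2\int_{-1}^1(\frac{1}{u\sqrt{1+u'^2}}-\frac{u''}{(1+u'^2)^{3/2}})^2u\sqrt{1+u'^2}\,dx$, $\mathscr H_\varepsilon=\mathscr W+\varepsilon\mathscr A$. *)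

theory Defs
  imports "HOL-Analysis.Analysis"
begin

abbreviation I01 :: "real set" where "I01 \<equiv> {-1<..<1}"

definition smooth_on :: "real set \<Rightarrow> (real \<Rightarrow> real) \<Rightarrow> bool" where
  "smooth_on S u \<longleftrightarrow> (\<exists>f :: nat \<Rightarrow> real \<Rightarrow> real.
      (\<forall>x\<in>S. f 0 x = u x) \<and>
      (\<forall>n. \<forall>x\<in>S. (f n has_real_derivative f (Suc n) x) (at x within S)))"

definition test_fn :: "(real \<Rightarrow> real) \<Rightarrow> bool" where
  "test_fn \<phi> \<longleftrightarrow> smooth_on UNIV \<phi> \<and> compact (closure {x. \<phi> x \<noteq> 0})
      \<and> closure {x. \<phi> x \<noteq> 0} \<subseteq> I01"

definition L2_on :: "(real \<Rightarrow> real) \<Rightarrow> bool" where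
  "L2_on f \<longleftrightarrow> set_borel_measurable lborel I01 f \<and>
     set_integrable lborel I01 (\<lambda>x. (f x)\<^sup>2)"

definition weak_deriv :: "(real \<Rightarrow> real) \<Rightarrow> (real \<Rightarrow> real) \<Rightarrow> bool" where
  "weak_deriv u g \<longleftrightarrow> set_integrable lborel I01 u \<and> set_integrable lborel I01 g \<and>
     (\<forall>\<phi>. test_fn \<phi> \<longrightarrow>
        (LINT x:I01|lborel. u x * deriv \<phi> x) = - (LINT x:I01|lborel. g x * \<phi> x))"

definition H2 :: "(real \<Rightarrow> real) \<Rightarrow> bool" where
  "H2 u \<longleftrightarrow> (\<exists>g1 g2. L2_on u \<and> L2_on g1 \<and> L2_on g2 \<and> weak_deriv u g1 \<and> weak_deriv g1 g2)"

text \<open>In one dimension each H^2 class has a unique C^1([-1,1]) representative; the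
  pointwise conditions in N_alpha refer to this representative.  We therefore
  require u itself to be this representative.\<close>
definition C1_rep :: "(real \<Rightarrow> real) \<Rightarrow> bool" where
  "C1_rep u \<longleftrightarrow> (\<exists>u1. continuous_on {-1..1} u1 \<and>
      (\<forall>x\<in>{-1..1}. (u has_real_derivative u1 x) (at x within {-1..1})))"

definition d1 :: "(real \<Rightarrow> real) \<Rightarrow> real \<Rightarrow> real" where
  "d1 u x = (SOME d. (u has_real_derivative d) (at x within {-1..1}))"

text \<open>Weak second derivative (unique a.e.; integrals do not depend on the choice).\<close>
definition d2 :: "(real \<Rightarrow> real) \<Rightarrow> real \<Rightarrow> real" where
  "d2 u = (SOME g. weak_deriv (d1 u) g)"

definition N_set :: "real \<Rightarrow> (real \<Rightarrow> real) set" where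
  "N_set \<alpha> = {u. H2 u \<and> C1_rep u \<and> (\<forall>x\<in>{-1..1}. u (-x) = u x) \<and>
      (\<forall>x\<in>{-1..1}. u x > 0) \<and> u (-1) = \<alpha> \<and> u 1 = \<alpha> \<and>
      (u has_real_derivative 0) (at (-1) within {-1..1}) \<and>
      (u has_real_derivative 0) (at 1 within {-1..1})}"

definition Area :: "(real \<Rightarrow> real) \<Rightarrow> real" where
  "Area u = 2 * pi * (LINT x:I01|lborel. u x * sqrt (1 + (d1 u x)\<^sup>2))"

definition Willmore :: "(real \<Rightarrow> real) \<Rightarrow> real" where
  "Willmore u = pi / 2 * (LINT x:I01|lborel.
      (1 / (u x * sqrt (1 + (d1 u x)\<^sup>2)) - d2 u x / (1 + (d1 u x)\<^sup>2) powr (3/2))\<^sup>2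
      * u x * sqrt (1 + (d1 u x)\<^sup>2))"

definition Helfrich :: "real \<Rightarrow> (real \<Rightarrow> real) \<Rightarrow> real" where
  "Helfrich \<epsilon> u = Willmore u + \<epsilon> * Area u"

end

theory Submission
  imports Defs "HOL-Computational_Algebra.Polynomial" "HOL-Complex_Analysis.Great_Picard"
begin

text \<open>
  Write \<open>p = u'\<close>, \<open>g = u''\<close>, \<open>k = sqrt (1 + p\<^sup>2)\<close>. Since \<open>g / k\<^sup>3\<close> is the derivative of \<open>p / k\<close>, which vanishes
  at both ends, the Helfrich energy is \<open>pi / 2\<close> times the integral of
  \<open>u g\<^sup>2 / k\<^sup>5 + 1 / (u k) + 4 \<epsilon> u k\<close>.

  A priori bounds: a calibration argument, in which the exact derivatives of \<open>u arctan p\<close> and \<open>p / k\<close> are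
  added to the energy density so that it becomes a sum of squares, gives
  \<open>pi (2 \<epsilon> + (4 - \<epsilon>) \<bar>p x\<bar> / k x) \<le> Helfrich \<epsilon> u\<close> for every \<open>x\<close>. Below the level \<open>pi (4 + \<epsilon>)\<close> the slope is
  therefore bounded; then \<open>\<integral> 1 / u\<close> is bounded, which bounds \<open>ln u\<close>, and finally \<open>\<integral> g\<^sup>2\<close> is bounded.

  Existence: a minimising sequence converges in \<open>C\<^sup>1\<close> by the Arzela-Ascoli theorem. The energy is quadratic
  in \<open>g\<close> and midpoints of admissible functions are admissible, so the parallelogram identity makes
  the second derivatives a Cauchy sequence in \<open>L\<^sup>2\<close>.

  Regularity: integrating the first variation by parts turns it into \<open>\<integral> (2 u g / k\<^sup>5 - F\<^sub>1 + F) \<eta>\<close>, where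
  \<open>F\<^sub>1\<close> and \<open>F\<close> are a primitive and a second primitive of the lower order terms and \<open>\<eta> = \<phi>''\<close> is an arbitrary even
  function of mean zero. Taking for \<open>\<eta>\<close> the bracket minus its mean shows that the bracket is constant,
  and this equation for \<open>g\<close> can be bootstrapped.
\<close>

section \<open>Absolutely continuous functions on the interval\<close>

text \<open>Two calibrations give the slope bound. They share the coefficient
  \<open>-2 * \<epsilon>\<close> of the \<open>u arctan p\<close> flux; the \<open>p / k\<close>
  flux has coefficient \<open>2\<close> in one and \<open>\<epsilon> - 2\<close> in the other. With
  one used between \<open>-y\<close> and \<open>y\<close> and the other outside, the arctan terms
  cancel and the jump \<open>4 - \<epsilon>\<close> leaves a multiple of
  \<open>\<bar>p y\<bar> / k\<close>. The squares have weights \<open>1 - \<epsilon> / 4\<close> and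
  \<open>\<epsilon> / 4\<close>, whence the range of \<epsilon>; for \<epsilon> < 4 the level pi (4
  + \<epsilon>) is where the bound would allow \<open>\<bar>p\<bar> / k\<close>, the sine of the
  inclination angle, to reach 1. For compactness the obstacle is that the coefficient of
  \<open>g\<^sup>2\<close> varies along the sequence: only after freezing it at the C^1 limit is
  there a fixed quadratic form. For regularity a test function must vanish with its derivative at
  both ends, which in general leaves the bracket affine. Evenness removes one condition: an even
  \<open>\<eta>\<close> of mean zero has a second primitive meeting all four boundary
  conditions.\<close>

definition abs_cont :: "(real \<Rightarrow> real) \<Rightarrow> (real \<Rightarrow> real) \<Rightarrow> bool" where
  "abs_cont p g \<longleftrightarrow> g absolutely_integrable_on {-1..1} \<and>
     (\<forall>a b. -1 \<le> a \<longrightarrow> a \<le> b \<longrightarrow> b \<le> 1 \<longrightarrow> (g has_integral (p b - p a)) {a..b})"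

lemma abs_contD:
  assumes "abs_cont p g"
  shows "g absolutely_integrable_on {-1..1}"
    and "\<And>a b. -1 \<le> a \<Longrightarrow> a \<le> b \<Longrightarrow> b \<le> 1 \<Longrightarrow> (g has_integral (p b - p a)) {a..b}"
    and "(g has_integral (p 1 - p (-1))) {-1..1}"
  using assms unfolding abs_cont_def by auto

lemma abs_cont_continuous:
  assumes "abs_cont p g"
  shows "continuous_on {-1..1} p"
proof -
  have "g integrable_on {-1..1}" using abs_contD(3)[OF assms] by blast
  then have "continuous_on {-1..1} (\<lambda>x. p (-1) + integral {-1..x} g)"
    by (intro continuous_intros indefinite_integral_continuous_1)
  moreover have "p (-1) + integral {-1..x} g = p x" if "x \<in> {-1..1}" for x
    using abs_contD(2)[OF assms, of "-1" x] that by (simp add: integral_unique)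
  ultimately show ?thesis by (metis (no_types, lifting) continuous_on_cong)
qed

lemma integrable_on_Icc_sub:
  assumes "(f::real\<Rightarrow>real) absolutely_integrable_on {-1..1}" "-1 \<le> a" "b \<le> 1"
  shows "f integrable_on {a..b}" "(\<lambda>x. \<bar>f x\<bar>) integrable_on {a..b}"
proof -
  have "f absolutely_integrable_on {a..b}"
    using assms by (intro absolutely_integrable_on_subinterval[OF assms(1)]) auto
  then show "f integrable_on {a..b}" "(\<lambda>x. \<bar>f x\<bar>) integrable_on {a..b}"
    by (auto simp: absolutely_integrable_on_def)
qed

lemma abs_cont_indefinite_integral:
  assumes "g absolutely_integrable_on {-1..1}"
  shows "abs_cont (\<lambda>x. c + integral {-1..x} g) g"
  unfolding abs_cont_def
proof (intro conjI allI impI)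
  fix a b :: real assume *: "-1 \<le> a" "a \<le> b" "b \<le> 1"
  have "integral {-1..a} g + integral {a..b} g = integral {-1..b} g"
    using * integrable_on_Icc_sub[OF assms]
    by (intro Henstock_Kurzweil_Integration.integral_combine) auto
  moreover have "(g has_integral integral {a..b} g) {a..b}"
    using * integrable_on_Icc_sub[OF assms] by (intro integrable_integral) auto
  moreover have "c + integral {-1..b} g - (c + integral {-1..a} g) = integral {a..b} g"
    using calculation(1) by linarith
  ultimately show "(g has_integral c + integral {-1..b} g - (c + integral {-1..a} g)) {a..b}"
    by (simp only:)
qed (use assms in auto)

lemma absolutely_integrable_continuous_mult:
  assumes "continuous_on {-1..1} f" "(g::real\<Rightarrow>real) absolutely_integrable_on {-1..1}"
  shows "(\<lambda>x. f x * g x) absolutely_integrable_on {-1..1}"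
proof (rule absolutely_integrable_bounded_measurable_product_real)
  show "f \<in> borel_measurable (lebesgue_on {-1..1})"
    using assms by (intro continuous_imp_measurable_on_sets_lebesgue) auto
  show "bounded (f ` {-1..1})"
    using assms by (intro compact_imp_bounded compact_continuous_image) auto
qed (use assms in auto)

text \<open>A function whose increments are those of an indefinite integral up to an arbitrarily
  small multiple of a fixed integrable weight is that indefinite integral, because the
  estimate is additive over adjacent intervals.\<close>

lemma abs_contI_local:
  assumes h: "h absolutely_integrable_on {-1..1}" and k: "k absolutely_integrable_on {-1..1}"
    and local: "\<And>e x. e > 0 \<Longrightarrow> x \<in> {-1..1} \<Longrightarrow> \<exists>d>0. \<forall>a b. -1 \<le> a \<and> a \<le> x \<and> x \<le> b \<and> b \<le> 1 \<and> b - a < d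
        \<longrightarrow> \<bar>P b - P a - integral {a..b} h\<bar> \<le> e * integral {a..b} k"
  shows "abs_cont P h"
  unfolding abs_cont_def
proof (intro conjI allI impI)
  fix a b :: real assume *: "-1 \<le> a" "a \<le> b" "b \<le> 1"
  have est: "\<bar>P b - P a - integral {a..b} h\<bar> \<le> e * integral {a..b} k" if "e > 0" for e
  proof -
    \<comment> \<open>Intervals leaving \<open>[-1, 1]\<close> satisfy \<open>Q\<close> vacuously,
      since the bisection argument behind \<open>Bolzano\<close> quantifies over all real
      intervals.\<close>
    define Q where "Q c d \<longleftrightarrow> (-1 \<le> c \<and> d \<le> 1 \<longrightarrow> \<bar>P d - P c - integral {c..d} h\<bar> \<le> e * integral {c..d} k)" for c d
    have "Q a b"
    proof (rule Bolzano[OF \<open>a \<le> b\<close>])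
      fix u v w assume Q: "Q u v" "Q v w" and le: "u \<le> v" "v \<le> w"
      show "Q u w"
        unfolding Q_def
      proof
        assume b: "-1 \<le> u \<and> w \<le> 1"
        have "integral {u..v} h + integral {v..w} h = integral {u..w} h"
          "integral {u..v} k + integral {v..w} k = integral {u..w} k"
          using b le integrable_on_Icc_sub[OF h] integrable_on_Icc_sub[OF k]
          by (auto intro!: Henstock_Kurzweil_Integration.integral_combine)
        then have eqs: "integral {u..w} h = integral {u..v} h + integral {v..w} h"
           "e * integral {u..w} k = e * integral {u..v} k + e * integral {v..w} k"
          by (simp_all flip: distrib_left)
        show "\<bar>P w - P u - integral {u..w} h\<bar> \<le> e * integral {u..w} k"
        proof -
          have "\<bar>P v - P u - integral {u..v} h\<bar> \<le> e * integral {u..v} k"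
            "\<bar>P w - P v - integral {v..w} h\<bar> \<le> e * integral {v..w} k"
            using Q b le unfolding Q_def by linarith+
          then show ?thesis unfolding eqs by linarith
        qed
      qed
    next
      fix x assume "a \<le> x" "x \<le> b"
      then show "\<exists>d>0. \<forall>a b. a \<le> x \<and> x \<le> b \<and> b - a < d \<longrightarrow> Q a b"
      proof -
        have "x \<in> {-1..1}" using * \<open>a \<le> x\<close> \<open>x \<le> b\<close> by auto
        from local[OF \<open>e > 0\<close> this] show ?thesis unfolding Q_def by blast
      qed
    qed
    then show ?thesis using * unfolding Q_def by blast
  qed
  have "\<bar>P b - P a - integral {a..b} h\<bar> \<le> 0"
  proof (rule field_le_epsilon)
    fix e :: real assume "e > 0"
    define K where "K = \<bar>integral {a..b} k\<bar> + 1"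
    have "\<bar>P b - P a - integral {a..b} h\<bar> \<le> e / K * integral {a..b} k"
      using \<open>e > 0\<close> by (intro est) (auto simp: K_def)
    also have "\<dots> \<le> e / K * K"
      using \<open>e > 0\<close> by (intro mult_left_mono) (auto simp: K_def)
    also have "\<dots> = e" by (auto simp: K_def)
    finally show "\<bar>P b - P a - integral {a..b} h\<bar> \<le> 0 + e" by simp
  qed
  then have "P b - P a = integral {a..b} h" by simp
  moreover have "(h has_integral integral {a..b} h) {a..b}"
    using * integrable_on_Icc_sub[OF h] by (intro integrable_integral) auto
  ultimately show "(h has_integral P b - P a) {a..b}" by simp
qed (use h in auto)

section \<open>Product rule, chain rule and parity for primitives\<close>

lemma continuous_on_Icc_local_variation:
  assumes "continuous_on {-1..1} (p::real\<Rightarrow>real)" "e > 0" "x \<in> {-1..1}"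
  shows "\<exists>d>0. \<forall>a b. -1 \<le> a \<and> a \<le> x \<and> x \<le> b \<and> b \<le> 1 \<and> b - a < d \<longrightarrow>
           (\<forall>s\<in>{a..b}. \<forall>t\<in>{a..b}. \<bar>p s - p t\<bar> \<le> e)"
proof -
  obtain d where d: "d > 0" "\<And>y. y \<in> {-1..1} \<Longrightarrow> dist y x < d \<Longrightarrow> dist (p y) (p x) < e / 2"
    using assms unfolding continuous_on_iff by (meson half_gt_zero)
  have "\<bar>p s - p t\<bar> \<le> e" if "-1 \<le> a" "a \<le> x" "x \<le> b" "b \<le> 1" "b - a < d" "s \<in> {a..b}" "t \<in> {a..b}" for a b s t
  proof -
    have "dist s x < d" "dist t x < d" using that by (auto simp: dist_real_def)
    then have "dist (p s) (p x) < e / 2" "dist (p t) (p x) < e / 2"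
      using that d(2)[of s] d(2)[of t] by auto
    then show ?thesis unfolding dist_real_def by linarith
  qed
  then show ?thesis using d(1) by (intro exI[of _ d]) auto
qed

lemma abs_cont_mult:
  assumes p: "abs_cont p g" and q: "abs_cont q h"
  shows "abs_cont (\<lambda>x. p x * q x) (\<lambda>x. p x * h x + q x * g x)"
proof (rule abs_contI_local[where k = "\<lambda>x. \<bar>h x\<bar> + \<bar>g x\<bar>"])
  note cp = abs_cont_continuous[OF p] and cq = abs_cont_continuous[OF q]
  show H: "(\<lambda>x. p x * h x + q x * g x) absolutely_integrable_on {-1..1}"
    by (intro set_integral_add absolutely_integrable_continuous_mult cp cq abs_contD(1)[OF p] abs_contD(1)[OF q])
  show "(\<lambda>x. \<bar>h x\<bar> + \<bar>g x\<bar>) absolutely_integrable_on {-1..1}"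
    by (intro set_integral_add set_integrable_abs abs_contD(1)[OF p] abs_contD(1)[OF q])
  fix e x :: real assume "e > 0" "x \<in> {-1..1}"
  obtain d1 where d1: "d1 > 0" "\<And>a b. -1 \<le> a \<and> a \<le> x \<and> x \<le> b \<and> b \<le> 1 \<and> b - a < d1 \<Longrightarrow>
           (\<forall>s\<in>{a..b}. \<forall>t\<in>{a..b}. \<bar>p s - p t\<bar> \<le> e)"
    using continuous_on_Icc_local_variation[OF cp \<open>e > 0\<close> \<open>x \<in> {-1..1}\<close>] by blast
  obtain d2 where d2: "d2 > 0" "\<And>a b. -1 \<le> a \<and> a \<le> x \<and> x \<le> b \<and> b \<le> 1 \<and> b - a < d2 \<Longrightarrow>
           (\<forall>s\<in>{a..b}. \<forall>t\<in>{a..b}. \<bar>q s - q t\<bar> \<le> e)"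
    using continuous_on_Icc_local_variation[OF cq \<open>e > 0\<close> \<open>x \<in> {-1..1}\<close>] by blast
  show "\<exists>d>0. \<forall>a b. -1 \<le> a \<and> a \<le> x \<and> x \<le> b \<and> b \<le> 1 \<and> b - a < d \<longrightarrow>
     \<bar>p b * q b - p a * q a - integral {a..b} (\<lambda>x. p x * h x + q x * g x)\<bar>
        \<le> e * integral {a..b} (\<lambda>x. \<bar>h x\<bar> + \<bar>g x\<bar>)"
  proof (intro exI[of _ "min d1 d2"] conjI allI impI)
    fix a b :: real assume ab: "-1 \<le> a \<and> a \<le> x \<and> x \<le> b \<and> b \<le> 1 \<and> b - a < min d1 d2"
    have hh: "(h has_integral (q b - q a)) {a..b}" and gg: "(g has_integral (p b - p a)) {a..b}"
      using ab abs_contD(2)[OF p] abs_contD(2)[OF q] by auto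
    have HH: "((\<lambda>x. p x * h x + q x * g x) has_integral integral {a..b} (\<lambda>x. p x * h x + q x * g x)) {a..b}"
      using ab integrable_on_Icc_sub[OF H] by (intro integrable_integral) auto
    have 1: "((\<lambda>t. p b * h t + q a * g t - (p t * h t + q t * g t)) has_integral
       p b * (q b - q a) + q a * (p b - p a) - integral {a..b} (\<lambda>x. p x * h x + q x * g x)) {a..b}"
      by (intro has_integral_diff has_integral_add has_integral_mult_right hh gg HH)
    have I: "(\<lambda>x. \<bar>h x\<bar>) integrable_on {a..b}" "(\<lambda>x. \<bar>g x\<bar>) integrable_on {a..b}"
      using ab integrable_on_Icc_sub[OF abs_contD(1)[OF p]]
        integrable_on_Icc_sub[OF abs_contD(1)[OF q]] by auto
    have 2: "((\<lambda>t. e * (\<bar>h t\<bar> + \<bar>g t\<bar>)) has_integral e * integral {a..b} (\<lambda>x. \<bar>h x\<bar> + \<bar>g x\<bar>)) {a..b}"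
      by (intro has_integral_mult_right integrable_integral integrable_add I)
    have "norm (integral {a..b} (\<lambda>t. p b * h t + q a * g t - (p t * h t + q t * g t))) \<le>
       integral {a..b} (\<lambda>t. e * (\<bar>h t\<bar> + \<bar>g t\<bar>))"
    proof (rule integral_norm_bound_integral)
      fix t assume t: "t \<in> {a..b}"
      have "\<bar>p b - p t\<bar> \<le> e" "\<bar>q a - q t\<bar> \<le> e"
        using d1(2)[of a b] d2(2)[of a b] ab t by auto
      then have "\<bar>(p b - p t) * h t\<bar> \<le> e * \<bar>h t\<bar>" "\<bar>(q a - q t) * g t\<bar> \<le> e * \<bar>g t\<bar>"
        by (auto simp: abs_mult intro: mult_right_mono)
      then have "\<bar>(p b - p t) * h t + (q a - q t) * g t\<bar> \<le> e * \<bar>h t\<bar> + e * \<bar>g t\<bar>"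
        by linarith
      then show "norm (p b * h t + q a * g t - (p t * h t + q t * g t)) \<le> e * (\<bar>h t\<bar> + \<bar>g t\<bar>)"
        by (simp add: algebra_simps)
    qed (use 1 2 in blast)+
    then show "\<bar>p b * q b - p a * q a - integral {a..b} (\<lambda>x. p x * h x + q x * g x)\<bar>
        \<le> e * integral {a..b} (\<lambda>x. \<bar>h x\<bar> + \<bar>g x\<bar>)"
      unfolding integral_unique[OF 1] integral_unique[OF 2] by (simp add: algebra_simps)
  qed (use d1 d2 in auto)
qed

text \<open>The mean value theorem for \<open>G\<close> and the intermediate value theorem for
  \<open>p\<close> give \<open>G (p b) - G (p a) = G' (p s) * (p b - p a)\<close> with
  \<open>s\<close> in \<open>{a..b}\<close>. The error against the claimed density is then bounded
  by the oscillation of \<open>G'\<close> along \<open>p\<close> times the integral of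
  \<open>\<bar>g\<bar>\<close>.\<close>

lemma abs_cont_compose:
  assumes p: "abs_cont p g" and G: "\<And>y. (G has_real_derivative G' y) (at y)" and G': "continuous_on UNIV G'"
  shows "abs_cont (\<lambda>x. G (p x)) (\<lambda>x. G' (p x) * g x)"
proof (rule abs_contI_local[where k = "\<lambda>x. \<bar>g x\<bar>"])
  note cp = abs_cont_continuous[OF p]
  have cG: "continuous_on {-1..1} (\<lambda>x. G' (p x))"
    using continuous_on_compose2[OF G' cp] by auto
  show H: "(\<lambda>x. G' (p x) * g x) absolutely_integrable_on {-1..1}"
    by (intro absolutely_integrable_continuous_mult cG abs_contD(1)[OF p])
  show "(\<lambda>x. \<bar>g x\<bar>) absolutely_integrable_on {-1..1}"
    by (intro set_integrable_abs abs_contD(1)[OF p])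
  fix e x :: real assume "e > 0" "x \<in> {-1..1}"
  obtain d where d: "d > 0" "\<And>a b. -1 \<le> a \<and> a \<le> x \<and> x \<le> b \<and> b \<le> 1 \<and> b - a < d \<Longrightarrow>
           (\<forall>s\<in>{a..b}. \<forall>t\<in>{a..b}. \<bar>G' (p s) - G' (p t)\<bar> \<le> e)"
    using continuous_on_Icc_local_variation[OF cG \<open>e > 0\<close> \<open>x \<in> {-1..1}\<close>] by blast
  show "\<exists>d>0. \<forall>a b. -1 \<le> a \<and> a \<le> x \<and> x \<le> b \<and> b \<le> 1 \<and> b - a < d \<longrightarrow>
     \<bar>G (p b) - G (p a) - integral {a..b} (\<lambda>x. G' (p x) * g x)\<bar> \<le> e * integral {a..b} (\<lambda>x. \<bar>g x\<bar>)"
  proof (intro exI[of _ d] conjI allI impI)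
    fix a b :: real assume ab: "-1 \<le> a \<and> a \<le> x \<and> x \<le> b \<and> b \<le> 1 \<and> b - a < d"
    have cpab: "continuous_on {a..b} p" using ab by (intro continuous_on_subset[OF cp]) auto
    have gg: "(g has_integral (p b - p a)) {a..b}"
      using ab abs_contD(2)[OF p] by auto
    have "\<exists>s\<in>{a..b}. G (p b) - G (p a) = G' (p s) * (p b - p a)"
    proof -
      consider "p a = p b" | "p a < p b" | "p b < p a" by linarith
      then show ?thesis
      proof cases
        case 1 then show ?thesis using ab by (auto intro!: bexI[of _ a])
      next
        case 2
        obtain z where z: "p a < z" "z < p b" "G (p b) - G (p a) = (p b - p a) * G' z"
          using MVT2[OF 2, of G G'] G by blast
        obtain s where "a \<le> s" "s \<le> b" "p s = z"
          using IVT'[of p a z b] z ab cpab by auto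
        then show ?thesis using z by (auto intro!: bexI[of _ s])
      next
        case 3
        obtain z where z: "p b < z" "z < p a" "G (p a) - G (p b) = (p a - p b) * G' z"
          using MVT2[OF 3, of G G'] G by blast
        obtain s where "a \<le> s" "s \<le> b" "p s = z"
          using IVT2'[of p b z a] z ab cpab by auto
        then show ?thesis using z by (auto intro!: bexI[of _ s] simp: algebra_simps)
      qed
    qed
    then obtain s where s: "s \<in> {a..b}" "G (p b) - G (p a) = G' (p s) * (p b - p a)" by blast
    have HH: "((\<lambda>x. G' (p x) * g x) has_integral integral {a..b} (\<lambda>x. G' (p x) * g x)) {a..b}"
      using ab integrable_on_Icc_sub[OF H] by (intro integrable_integral) auto
    have 1: "((\<lambda>t. G' (p s) * g t - G' (p t) * g t) has_integral
       G' (p s) * (p b - p a) - integral {a..b} (\<lambda>x. G' (p x) * g x)) {a..b}"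
      by (intro has_integral_diff has_integral_mult_right gg HH)
    have I: "(\<lambda>x. \<bar>g x\<bar>) integrable_on {a..b}"
      using ab integrable_on_Icc_sub[OF abs_contD(1)[OF p]] by auto
    have 2: "((\<lambda>t. e * \<bar>g t\<bar>) has_integral e * integral {a..b} (\<lambda>x. \<bar>g x\<bar>)) {a..b}"
      by (intro has_integral_mult_right integrable_integral I)
    have "norm (integral {a..b} (\<lambda>t. G' (p s) * g t - G' (p t) * g t)) \<le> integral {a..b} (\<lambda>t. e * \<bar>g t\<bar>)"
    proof (rule integral_norm_bound_integral)
      fix t assume t: "t \<in> {a..b}"
      have "\<bar>G' (p s) - G' (p t)\<bar> \<le> e" using d(2)[of a b] ab t s by auto
      then have "\<bar>(G' (p s) - G' (p t)) * g t\<bar> \<le> e * \<bar>g t\<bar>"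
        by (auto simp: abs_mult intro: mult_right_mono)
      then show "norm (G' (p s) * g t - G' (p t) * g t) \<le> e * \<bar>g t\<bar>"
        by (simp add: algebra_simps)
    qed (use 1 2 in blast)+
    then show "\<bar>G (p b) - G (p a) - integral {a..b} (\<lambda>x. G' (p x) * g x)\<bar> \<le> e * integral {a..b} (\<lambda>x. \<bar>g x\<bar>)"
      unfolding integral_unique[OF 1] integral_unique[OF 2] s(2) by simp
  qed (use d in auto)
qed

lemma abs_cont_C1:
  assumes "\<And>x. x \<in> {-1..1} \<Longrightarrow> (p has_real_derivative g x) (at x within {-1..1})" "continuous_on {-1..1} g"
  shows "abs_cont p g"
  unfolding abs_cont_def
proof (intro conjI allI impI)
  show "g absolutely_integrable_on {-1..1}" using assms(2) by (rule absolutely_integrable_continuous_real)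
  fix a b :: real assume *: "-1 \<le> a" "a \<le> b" "b \<le> 1"
  show "(g has_integral p b - p a) {a..b}"
  proof (rule fundamental_theorem_of_calculus)
    fix x assume "x \<in> {a..b}"
    then have "(p has_real_derivative g x) (at x within {a..b})"
      using * by (intro DERIV_subset[OF assms(1)]) auto
    then show "(p has_vector_derivative g x) (at x within {a..b})"
      by (simp add: has_real_derivative_iff_has_vector_derivative)
  qed (use * in auto)
qed

text \<open>A continuous density upgrades the integral identity to a pointwise derivative up to the
  end points, one-sided there. This turns information that holds almost everywhere into classical
  regularity.\<close>

lemma abs_cont_continuous_imp_C1:
  assumes "abs_cont p g" "continuous_on {-1..1} g" "x \<in> {-1..1}"
  shows "(p has_real_derivative g x) (at x within {-1..1})"
proof -
  have "((\<lambda>x. p (-1) + integral {-1..x} g) has_real_derivative 0 + g x) (at x within {-1..1})"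
    using integral_has_real_derivative[OF assms(2,3)] by (intro derivative_intros) auto
  then have "((\<lambda>x. p (-1) + integral {-1..x} g) has_real_derivative g x) (at x within {-1..1})" by simp
  moreover have "p (-1) + integral {-1..x} g = p x" if "x \<in> {-1..1}" for x
    using abs_contD(2)[OF assms(1), of "-1" x] that by (simp add: integral_unique)
  ultimately show ?thesis
    using assms(3) unfolding has_field_derivative_def
    by (elim has_derivative_transform[rotated 2]) auto
qed

lemma abs_cont_lin:
  assumes "abs_cont p g" "abs_cont q h"
  shows "abs_cont (\<lambda>x. p x + c * q x) (\<lambda>x. g x + c * h x)"
  unfolding abs_cont_def
proof (intro conjI allI impI)
  show "(\<lambda>x. g x + c * h x) absolutely_integrable_on {-1..1}"
    using abs_contD(1)[OF assms(1)] abs_contD(1)[OF assms(2)]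
    by (intro set_integral_add set_integrable_mult_right) auto
  fix a b :: real assume *: "-1 \<le> a" "a \<le> b" "b \<le> 1"
  have "((\<lambda>x. g x + c * h x) has_integral (p b - p a) + c * (q b - q a)) {a..b}"
    using * abs_contD(2)[OF assms(1)] abs_contD(2)[OF assms(2)]
    by (intro has_integral_add has_integral_mult_right) auto
  then show "((\<lambda>x. g x + c * h x) has_integral p b + c * q b - (p a + c * q a)) {a..b}"
    by (simp add: algebra_simps)
qed

lemma abs_cont_reflect:
  assumes "abs_cont p g"
  shows "abs_cont (\<lambda>x. p (- x)) (\<lambda>x. - g (- x))"
  unfolding abs_cont_def
proof (intro conjI allI impI)
  have "(\<lambda>x. g (- x)) absolutely_integrable_on {-1..- (-1)}"
    using abs_contD(1)[OF assms] by (rule absolutely_integrable_reflect_real[THEN iffD2])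
  then have "(\<lambda>x. g (- x)) absolutely_integrable_on {-1..1}" unfolding minus_minus .
  from set_integral_diff(1)[OF absolutely_integrable_zero this]
  show "(\<lambda>x. - g (- x)) absolutely_integrable_on {-1..1}" unfolding diff_0 .
  fix a b :: real assume *: "-1 \<le> a" "a \<le> b" "b \<le> 1"
  have "(g has_integral p (-a) - p (-b)) {-b..-a}"
    using * abs_contD(2)[OF assms] by auto
  then have "((\<lambda>x. g (- x)) has_integral p (-a) - p (-b)) {- (-a)..- (-b)}"
    by (rule has_integral_reflect_real[THEN iffD2])
  then have "((\<lambda>x. g (- x)) has_integral p (-a) - p (-b)) {a..b}" unfolding minus_minus .
  from has_integral_neg[OF this]
  show "((\<lambda>x. - g (- x)) has_integral p (- b) - p (- a)) {a..b}" unfolding minus_diff_eq .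
qed

text \<open>The density enters \<open>abs_cont\<close> only through integrals, so a negligible set
  is invisible to it, whereas the primitive is evaluated at every point. Representatives of
  \<open>u''\<close> can thus be exchanged without any theory of differentiation almost
  everywhere.\<close>

lemma abs_cont_cong:
  assumes "abs_cont p g" "\<And>x. x \<in> {-1..1} \<Longrightarrow> p x = q x" "negligible N" "\<And>x. x \<in> {-1..1} - N \<Longrightarrow> g x = h x"
  shows "abs_cont q h"
  unfolding abs_cont_def
proof (intro conjI allI impI)
  show "h absolutely_integrable_on {-1..1}"
    by (rule absolutely_integrable_spike[OF abs_contD(1)[OF assms(1)] assms(3)]) (rule assms(4)[symmetric])
  fix a b :: real assume *: "-1 \<le> a" "a \<le> b" "b \<le> 1"
  have "(h has_integral p b - p a) {a..b}"
  proof (rule has_integral_spike[OF assms(3) _ abs_contD(2)[OF assms(1) *]])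
    fix x assume "x \<in> {a..b} - N"
    then show "h x = g x" using * assms(4)[of x] by simp
  qed
  moreover have "p a = q a" "p b = q b" using assms(2)[of a] assms(2)[of b] * by auto
  ultimately show "(h has_integral q b - q a) {a..b}" by (simp only:)
qed

lemma abs_cont_const_diff:
  assumes "abs_cont p g" "abs_cont q g" "x \<in> {-1..1}" "y \<in> {-1..1}"
  shows "p x - q x = p y - q y"
proof -
  have *: "p b - p a = q b - q a" if "-1 \<le> a" "a \<le> b" "b \<le> 1" for a b
    using abs_contD(2)[OF assms(1) that] abs_contD(2)[OF assms(2) that] has_integral_unique by blast
  show ?thesis
  proof (cases "x \<le> y")
    case True then show ?thesis using *[of x y] assms by auto
  next
    case False then show ?thesis using *[of y x] assms by auto
  qed
qed

text \<open>\<open>F\<close> and its reflection have the same density, hence differ by a constant,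
  and they agree at 0.\<close>

lemma abs_cont_odd_imp_even:
  assumes "abs_cont F f" "\<And>x. x \<in> {-1..1} \<Longrightarrow> f (- x) = - f x" "x \<in> {-1..1}"
  shows "F (- x) = F x"
proof -
  have "abs_cont (\<lambda>x. F (- x)) f"
    by (rule abs_cont_cong[OF abs_cont_reflect[OF assms(1)] _ negligible_empty]) (use assms(2) in auto)
  from abs_cont_const_diff[OF this assms(1,3), of 0] show ?thesis by auto
qed

text \<open>Here parity passes to the primitive only up to a constant: \<open>F - F 0\<close> is
  odd. A suitable normalisation of \<open>F\<close> makes the constant vanish.\<close>

lemma abs_cont_even_imp_odd:
  assumes "abs_cont F f" "\<And>x. x \<in> {-1..1} \<Longrightarrow> f (- x) = f x" "x \<in> {-1..1}"
  shows "F (- x) + F x = 2 * F 0"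
proof -
  have "abs_cont (\<lambda>x. 0) (\<lambda>x. 0)"
    by (rule abs_cont_C1) (auto intro: derivative_eq_intros)
  from abs_cont_lin[OF this abs_cont_reflect[OF assms(1)], of "-1"]
  have "abs_cont (\<lambda>x. - F (- x)) f"
    by (rule abs_cont_cong[OF _ _ negligible_empty]) (use assms(2) in auto)
  from abs_cont_const_diff[OF this assms(1,3), of 0] show ?thesis by auto
qed

section \<open>Smooth functions and weak derivatives\<close>

text \<open>Each order has its own existential derivative, so closure rules are inductions on
  \<open>n\<close> that never exhibit a whole sequence of derivatives at once. Derivatives are taken
  within \<open>S\<close>, hence one-sided at the ends of a closed interval.\<close>

fun Ck :: "real set \<Rightarrow> nat \<Rightarrow> (real \<Rightarrow> real) \<Rightarrow> bool" where
  "Ck S 0 f \<longleftrightarrow> continuous_on S f"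
| "Ck S (Suc n) f \<longleftrightarrow> (\<exists>f'. (\<forall>x\<in>S. (f has_real_derivative f' x) (at x within S)) \<and> Ck S n f')"

lemma has_real_derivative_cong_on:
  assumes "(f has_real_derivative d) (at x within S)" "x \<in> S" "\<And>y. y \<in> S \<Longrightarrow> f y = g y"
  shows "(g has_real_derivative d) (at x within S)"
  using assms unfolding has_field_derivative_def
  by (elim has_derivative_transform[rotated 2]) auto

lemma Ck_cong:
  assumes "Ck S n f" "\<And>x. x \<in> S \<Longrightarrow> f x = g x"
  shows "Ck S n g"
proof (cases n)
  case 0
  then show ?thesis using assms continuous_on_cong[of S S f g] by simp
next
  case (Suc m)
  then show ?thesis
    using assms by (auto intro: has_real_derivative_cong_on)
qed

lemma Ck_SucD: "Ck S (Suc n) f \<Longrightarrow> Ck S n f"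
proof (induction n arbitrary: f)
  case 0
  then show ?case by (auto intro: DERIV_continuous_on)
next
  case (Suc n)
  from Suc.prems obtain f' where f': "\<forall>x\<in>S. (f has_real_derivative f' x) (at x within S)" "Ck S (Suc n) f'"
    by (subst (asm) Ck.simps(2)) blast
  show ?case
    using Suc.IH[OF f'(2)] f'(1) by auto
qed

lemma Ck_const: "Ck S n (\<lambda>x. c)"
proof (induction n arbitrary: c)
  case (Suc n)
  then show ?case by (auto intro!: exI[of _ "\<lambda>x. 0"])
qed simp

lemma Ck_add: "Ck S n f \<Longrightarrow> Ck S n g \<Longrightarrow> Ck S n (\<lambda>x. f x + g x)"
proof (induction n arbitrary: f g)
  case 0
  then show ?case by (auto intro: continuous_intros)
next
  case (Suc n)
  from Suc.prems obtain f' g' where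
    *: "\<forall>x\<in>S. (f has_real_derivative f' x) (at x within S)" "Ck S n f'"
      "\<forall>x\<in>S. (g has_real_derivative g' x) (at x within S)" "Ck S n g'" by auto
  then show ?case
    using Suc.IH[OF *(2,4)] by (auto intro!: exI[of _ "\<lambda>x. f' x + g' x"] derivative_eq_intros)
qed

lemma Ck_mult: "Ck S n f \<Longrightarrow> Ck S n g \<Longrightarrow> Ck S n (\<lambda>x. f x * g x)"
proof (induction n arbitrary: f g)
  case 0
  then show ?case by (auto intro: continuous_intros)
next
  case (Suc n)
  note low = Ck_SucD[OF Suc.prems(1)] Ck_SucD[OF Suc.prems(2)]
  from Suc.prems obtain f' g' where
    *: "\<forall>x\<in>S. (f has_real_derivative f' x) (at x within S)" "Ck S n f'"
      "\<forall>x\<in>S. (g has_real_derivative g' x) (at x within S)" "Ck S n g'" by auto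
  show ?case
    using Ck_add[OF Suc.IH[OF *(2) low(2)] Suc.IH[OF *(4) low(1)]] *
    by (auto intro!: exI[of _ "\<lambda>x. f' x * g x + g' x * f x"] derivative_eq_intros)
qed

lemma Ck_powr:
  assumes "\<And>x. x \<in> S \<Longrightarrow> f x > 0"
  shows "Ck S n f \<Longrightarrow> Ck S n (\<lambda>x. f x powr e)"
  using assms
proof (induction n arbitrary: e)
  case 0
  then show ?case by (auto intro!: continuous_intros dest: less_imp_neq[OF "0"(2)])
next
  case (Suc n)
  note low = Ck_SucD[OF Suc.prems(1)]
  from Suc.prems obtain f' where
    *: "\<forall>x\<in>S. (f has_real_derivative f' x) (at x within S)" "Ck S n f'" by auto
  have "Ck S n (\<lambda>x. e * (f x powr (e - 1) * f' x))"
    by (intro Ck_mult Ck_const Suc.IH low *(2) Suc.prems(2))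
  moreover have "((\<lambda>x. f x powr e) has_real_derivative e * (f x powr (e - 1) * f' x)) (at x within S)"
    if "x \<in> S" for x
    using * that Suc.prems(2)[OF that]
    by (auto intro!: derivative_eq_intros simp: powr_diff field_simps)
  ultimately show ?case by (auto intro!: exI[of _ "\<lambda>x. e * (f x powr (e - 1) * f' x)"])
qed

lemma Ck_affine:
  assumes "Ck UNIV n f"
  shows "Ck UNIV n (\<lambda>x. f (c * x + d))"
  using assms
proof (induction n arbitrary: f)
  case 0
  then have "continuous_on UNIV (\<lambda>x. f (c * x + d))"
    by (auto intro!: continuous_on_compose2[of UNIV f] continuous_intros)
  then show ?case by simp
next
  case (Suc n)
  then obtain f' where *: "\<forall>x. (f has_real_derivative f' x) (at x)" "Ck UNIV n f'" by auto
  have "((\<lambda>x. f (c * x + d)) has_real_derivative c * f' (c * x + d)) (at x)" for x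
  proof -
    have "((\<lambda>x. c * x + d) has_real_derivative c) (at x)" by (auto intro!: derivative_eq_intros)
    from DERIV_chain2[OF spec[OF *(1)] this] show ?thesis by (simp add: mult.commute)
  qed
  then show ?case
    using Ck_mult[OF Ck_const[of UNIV n c] Suc.IH[OF *(2)]]
    by (auto intro!: exI[of _ "\<lambda>x. c * f' (c * x + d)"])
qed

lemma has_real_derivative_unique_within:
  assumes "(f has_real_derivative a) (at x within S)" "(f has_real_derivative b) (at x within S)"
    "at x within S \<noteq> bot"
  shows "a = b"
  using assms tendsto_unique unfolding has_field_derivative_iff by blast

text \<open>Different orders could come with unrelated witnesses. Without isolated points the
  derivative within \<open>S\<close> is unique, so the chosen operator \<open>D\<close> agrees with
  each witness on \<open>S\<close>, and its iterates form the single sequence that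
  \<open>smooth_on\<close> asks for.\<close>

lemma smooth_on_Ck:
  assumes S: "\<And>x. x \<in> S \<Longrightarrow> at x within S \<noteq> bot" and f: "\<And>n. Ck S n f"
  shows "smooth_on S f"
proof -
  define D where "D f x = (SOME d. (f has_real_derivative d) (at x within S))" for f x
  have D: "D h x = h' x" if "x \<in> S" "\<forall>x\<in>S. (h has_real_derivative h' x) (at x within S)" for h h' x
    unfolding D_def using that S has_real_derivative_unique_within by (intro some_equality) blast+
  have *: "Ck S m ((D ^^ n) f)" for m n
  proof (induction n arbitrary: m)
    case (Suc n)
    obtain h' where h': "\<forall>x\<in>S. ((D ^^ n) f has_real_derivative h' x) (at x within S)" "Ck S m h'"
      using Suc.IH[of "Suc m"] by auto
    then show ?case using D[OF _ h'(1)] by (auto intro: Ck_cong)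
  qed (use f in auto)
  have "((D ^^ n) f has_real_derivative (D ^^ Suc n) f x) (at x within S)" if "x \<in> S" for n x
  proof -
    obtain h' where h': "\<forall>x\<in>S. ((D ^^ n) f has_real_derivative h' x) (at x within S)"
      using *[of "Suc 0" n] by auto
    then show ?thesis using D[OF that h'] that by simp
  qed
  then show ?thesis
    unfolding smooth_on_def by (intro exI[of _ "\<lambda>n. (D ^^ n) f"]) auto
qed

section \<open>Flat functions and smooth steps\<close>

definition flat :: "real poly \<Rightarrow> real \<Rightarrow> real" where
  "flat P x = (if x > 0 then poly P (1 / x) * exp (- (1 / x)) else 0)"

lemma tendsto_poly_exp_at_top: "((\<lambda>y::real. poly P y * exp (- y)) \<longlongrightarrow> 0) at_top"
proof -
  have "((\<lambda>y. \<Sum>i\<le>degree P. coeff P i * (y ^ i / exp y)) \<longlongrightarrow> (\<Sum>i\<le>degree P. coeff P i * 0)) at_top"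
    by (intro tendsto_intros tendsto_power_div_exp_0)
  moreover have "(\<Sum>i\<le>degree P. coeff P i * (y ^ i / exp y)) = poly P y * exp (- y)" for y
    by (simp add: poly_altdef sum_distrib_right exp_minus divide_inverse mult.assoc)
  ultimately show ?thesis by simp
qed

text \<open>With \<open>y = 1 / x\<close> the derivative of \<open>P y * exp (- y)\<close> in
  \<open>x\<close> is \<open>y\<^sup>2 * (P y - P' y) * exp (- y)\<close>, again of the form
  \<open>flat\<close> for another polynomial. The family is closed under differentiation, so
  smoothness across 0 reduces to this one step.\<close>

lemma DERIV_flat: "(flat P has_real_derivative flat ([:0,0,1:] * (P - pderiv P)) x) (at x)"
proof -
  consider "x > 0" | "x < 0" | "x = 0" by linarith
  then show ?thesis
  proof cases
    case 1
    have "((\<lambda>x. poly P (1 / x) * exp (- (1 / x))) has_real_derivative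
        flat ([:0,0,1:] * (P - pderiv P)) x) (at x)"
      using 1 unfolding flat_def
      by (auto intro!: derivative_eq_intros DERIV_chain2[OF poly_DERIV] simp: field_simps power2_eq_square)
    then show ?thesis
      by (rule DERIV_cong_ev[THEN iffD2, OF refl _ refl, rotated])
         (use eventually_nhds_in_open[of "{0<..}" x] 1 in \<open>auto simp: flat_def elim!: eventually_mono\<close>)
  next
    case 2
    have "((\<lambda>x. 0) has_real_derivative flat ([:0,0,1:] * (P - pderiv P)) x) (at x)"
      using 2 unfolding flat_def by auto
    then show ?thesis
      by (rule DERIV_cong_ev[THEN iffD2, OF refl _ refl, rotated])
         (use eventually_nhds_in_open[of "{..<0}" x] 2 in \<open>auto simp: flat_def elim!: eventually_mono\<close>)
  next
    case 3
    \<comment> \<open>From the right the difference quotient at 0 is \<open>flat\<close> of the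
      polynomial \<open>y * P y\<close>, which is \<open>pCons 0 P\<close>, and it decays because
      the exponential beats every power.\<close>
    have R: "((\<lambda>h. flat P h / h) \<longlongrightarrow> 0) (at_right 0)"
    proof -
      have "((\<lambda>h. poly (pCons 0 P) (inverse h) * exp (- (inverse h))) \<longlongrightarrow> 0) (at_right 0)"
        by (rule filterlim_compose[OF tendsto_poly_exp_at_top filterlim_inverse_at_top_right])
      then show ?thesis
        by (rule Lim_transform_eventually)
           (auto simp: eventually_at_right_field flat_def field_simps intro!: exI[of _ 1])
    qed
    have Lf: "((\<lambda>h. flat P h / h) \<longlongrightarrow> 0) (at_left 0)"
      by (rule Lim_transform_eventually[OF tendsto_const])
         (auto simp: eventually_at_left_field flat_def intro!: exI[of _ "-1"])
    have "((\<lambda>h. flat P h / h) \<longlongrightarrow> 0) (at 0)"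
      using R Lf by (simp add: filterlim_split_at)
    then show ?thesis
      using 3 by (simp add: has_field_derivative_iff flat_def)
  qed
qed

lemma Ck_flat: "Ck UNIV n (flat P)"
proof (induction n arbitrary: P)
  case 0
  have "continuous_on UNIV (flat P)"
    by (rule DERIV_continuous_on) (rule DERIV_flat)
  then show ?case by simp
next
  case (Suc n)
  then show ?case using DERIV_flat by auto
qed

text \<open>The quotient of \<open>flat 1 x\<close> by \<open>flat 1 x + flat 1 (1 - x)\<close> is a
  smooth step; the denominator never vanishes because \<open>x\<close> or \<open>1 - x\<close> is
  positive. Translates and dilations of it provide the test functions.\<close>

lemma smooth_step_exists:
  obtains s s' :: "real \<Rightarrow> real" where "\<And>n. Ck UNIV n s" "\<And>x. x \<le> 0 \<Longrightarrow> s x = 0" "\<And>x. x \<ge> 1 \<Longrightarrow> s x = 1"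
    "\<And>x. (s has_real_derivative s' x) (at x)" "continuous_on UNIV s'"
    "\<And>x. x < 0 \<Longrightarrow> s' x = 0" "\<And>x. x > 1 \<Longrightarrow> s' x = 0"
proof -
  define den where "den x = flat 1 x + flat 1 ((-1) * x + 1)" for x
  define s where "s x = flat 1 x * den x powr (-1)" for x
  have den: "den x > 0" for x unfolding den_def flat_def by (auto intro: add_pos_nonneg)
  have Ck: "Ck UNIV n s" for n
    unfolding s_def
    by (intro Ck_mult Ck_powr den Ck_flat) (unfold den_def, intro Ck_add Ck_flat Ck_affine)
  obtain s' where s': "\<And>x. (s has_real_derivative s' x) (at x)" "continuous_on UNIV s'"
    using Ck[of "Suc 0"] by auto
  have s0: "s x = 0" if "x \<le> 0" for x using that by (simp add: s_def flat_def)
  have s1: "s x = 1" if "x \<ge> 1" for x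
    using that den[of x] by (simp add: s_def den_def flat_def powr_minus)
  have "s' x = 0" if "x < 0" for x
  proof -
    have "(s has_real_derivative 0) (at x)"
      by (rule DERIV_cong_ev[THEN iffD2, OF refl _ refl, rotated, OF DERIV_const[of 0]])
         (use eventually_nhds_in_open[of "{..<0}" x] that in \<open>auto simp: s0 elim!: eventually_mono\<close>)
    then show ?thesis using s'(1) DERIV_unique by blast
  qed
  moreover have "s' x = 0" if "x > 1" for x
  proof -
    have "(s has_real_derivative 0) (at x)"
      by (rule DERIV_cong_ev[THEN iffD2, OF refl _ refl, rotated, OF DERIV_const[of 1]])
         (use eventually_nhds_in_open[of "{1<..}" x] that in \<open>auto simp: s1 elim!: eventually_mono\<close>)
    then show ?thesis using s'(1) DERIV_unique by blast
  qed
  ultimately show ?thesis using Ck s0 s1 s' by (intro that[of s s']) auto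
qed

section \<open>Lebesgue integrals on the open interval against gauge integrals on the closed
  one\<close>

lemma set_integrable_lborel_imp:
  fixes f :: "real \<Rightarrow> real"
  assumes "set_integrable lborel I01 f"
  shows "f absolutely_integrable_on {-1..1}" "(LINT x:I01|lborel. f x) = integral {-1..1} f"
proof -
  have "integrable lebesgue (\<lambda>x. indicator I01 x *\<^sub>R f x)"
    using assms unfolding set_integrable_def
    by (subst integrable_completion) (rule borel_measurable_integrable)
  then have "f absolutely_integrable_on I01" unfolding set_integrable_def .
  then show "f absolutely_integrable_on {-1..1}" by (rule absolutely_integrable_on_Icc_iff_Ioo[THEN iffD2])
  show "(LINT x:I01|lborel. f x) = integral {-1..1} f"
    using set_borel_integral_eq_integral(2)[OF assms] unfolding integral_open_interval_real .
qed

text \<open>Absolute integrability refers to the completed measure, so Borel measurability does not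
  follow from it and has to be carried along as a separate hypothesis.\<close>

lemma set_integrable_lborelI:
  fixes f :: "real \<Rightarrow> real"
  assumes "set_borel_measurable lborel I01 f" "f absolutely_integrable_on {-1..1}"
  shows "set_integrable lborel I01 f"
proof -
  have "integrable lebesgue (\<lambda>x. indicator I01 x *\<^sub>R f x)"
    using absolutely_integrable_on_Icc_iff_Ioo[THEN iffD1, OF assms(2)] unfolding set_integrable_def .
  then show ?thesis
    using integrable_completion[OF assms(1)[unfolded set_borel_measurable_def]]
    unfolding set_integrable_def by (rule iffD1[rotated])
qed

lemma set_borel_measurable_continuous_I01:
  assumes "continuous_on {-1..1} f"
  shows "set_borel_measurable lborel I01 (f :: real \<Rightarrow> real)"
proof -
  have "continuous_on I01 f" using assms by (rule continuous_on_subset) auto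
  from borel_measurable_continuous_on_indicator[OF _ this]
  show ?thesis unfolding set_borel_measurable_def by simp
qed

lemma set_borel_measurable_mult_I01:
  assumes "set_borel_measurable lborel I01 f" "set_borel_measurable lborel I01 (g :: real \<Rightarrow> real)"
  shows "set_borel_measurable lborel I01 (\<lambda>x. f x * g x)"
proof -
  have "(\<lambda>x. (indicator I01 x *\<^sub>R f x) * (indicator I01 x *\<^sub>R g x)) \<in> borel_measurable lborel"
    using assms unfolding set_borel_measurable_def by (rule borel_measurable_times)
  moreover have "(\<lambda>x. (indicator I01 x *\<^sub>R f x) * (indicator I01 x *\<^sub>R g x)) = (\<lambda>x. indicator I01 x *\<^sub>R (f x * g x))"
    by (auto simp: indicator_def)
  ultimately show ?thesis unfolding set_borel_measurable_def by simp
qed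

section \<open>Test functions and weak derivatives\<close>

lemma test_fn_abs_cont:
  assumes "test_fn \<phi>"
  shows "abs_cont \<phi> (deriv \<phi>)" "continuous_on {-1..1} \<phi>" "continuous_on {-1..1} (deriv \<phi>)" "\<phi> 1 = 0" "\<phi> (-1) = 0"
proof -
  obtain f where f: "\<And>x. f 0 x = \<phi> x" "\<And>n x. (f n has_real_derivative f (Suc n) x) (at x)"
    using assms unfolding test_fn_def smooth_on_def by auto
  have f0: "f 0 = \<phi>" by (rule ext) (rule f(1))
  have d: "(\<phi> has_real_derivative f 1 x) (at x)" for x using f(2)[of 0] unfolding f0 by simp
  then have eq: "deriv \<phi> = f 1" by (intro ext DERIV_imp_deriv)
  have "isCont (f 1) x" for x by (rule DERIV_isCont[OF f(2)])
  then show c: "continuous_on {-1..1} (deriv \<phi>)" unfolding eq by (simp add: continuous_at_imp_continuous_on)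
  show "continuous_on {-1..1} \<phi>" by (intro continuous_at_imp_continuous_on ballI DERIV_isCont[OF d])
  show "abs_cont \<phi> (deriv \<phi>)"
    by (rule abs_cont_C1[OF _ c]) (unfold eq, rule has_field_derivative_at_within[OF d])
  have "x \<in> I01" if "\<phi> x \<noteq> 0" for x
    using assms closure_subset[of "{x. \<phi> x \<noteq> 0}"] that unfolding test_fn_def by blast
  then show "\<phi> 1 = 0" "\<phi> (-1) = 0" by force+
qed

lemma abs_cont_imp_weak_deriv_integral:
  assumes "abs_cont p g" "test_fn \<phi>"
  shows "integral {-1..1} (\<lambda>x. p x * deriv \<phi> x) = - integral {-1..1} (\<lambda>x. g x * \<phi> x)"
proof -
  note T = test_fn_abs_cont[OF assms(2)]
  have "((\<lambda>x. p x * deriv \<phi> x + \<phi> x * g x) has_integral 0) {-1..1}"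
    using abs_contD(3)[OF abs_cont_mult[OF assms(1) T(1)]] by (simp only: T(4,5) mult_zero_right diff_self)
  moreover have "(\<lambda>x. p x * deriv \<phi> x) integrable_on {-1..1}"
    using abs_cont_continuous[OF assms(1)] T by (intro integrable_continuous_real continuous_intros)
  moreover have "(\<lambda>x. \<phi> x * g x) integrable_on {-1..1}"
    using absolutely_integrable_continuous_mult[OF T(2) abs_contD(1)[OF assms(1)]]
    unfolding absolutely_integrable_on_def by (rule conjunct1)
  ultimately have "integral {-1..1} (\<lambda>x. p x * deriv \<phi> x) + integral {-1..1} (\<lambda>x. \<phi> x * g x) = 0"
    by (simp only: integral_add[symmetric] integral_unique)
  then show ?thesis unfolding mult.commute[of "g _"] by linarith
qed

text \<open>This is the du Bois-Reymond lemma. The test function is the difference of two smooth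
  steps of width \<open>h\<close> rising at \<open>a\<close> and at \<open>b\<close>; its derivative
  is the difference of two unit masses spread over \<open>{a..a+h}\<close> and
  \<open>{b..b+h}\<close>. The hypothesis equates the two averages of \<open>D\<close>, which
  approach \<open>D a\<close> and \<open>D b\<close> as \<open>h\<close> tends to 0.\<close>

lemma constant_if_weak_deriv_zero:
  assumes D: "continuous_on {-1..1} D"
    and z: "\<And>\<phi>. test_fn \<phi> \<Longrightarrow> integral {-1..1} (\<lambda>x. D x * deriv \<phi> x) = 0"
    and ab: "a \<in> I01" "b \<in> I01" "a < b"
  shows "D a = D b"
proof -
  obtain s s' :: "real \<Rightarrow> real" where s: "\<And>n. Ck UNIV n s" "\<And>x. x \<le> 0 \<Longrightarrow> s x = 0" "\<And>x. x \<ge> 1 \<Longrightarrow> s x = 1"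
    "\<And>x. (s has_real_derivative s' x) (at x)" "continuous_on UNIV s'"
    "\<And>x. x < 0 \<Longrightarrow> s' x = 0" "\<And>x. x > 1 \<Longrightarrow> s' x = 0" by (rule smooth_step_exists) blast
  have "compact (s' ` {0..1})" using s(5) by (intro compact_continuous_image) (auto intro: continuous_on_subset)
  then obtain B where B: "B > 0" "\<And>x. x \<in> {0..1} \<Longrightarrow> \<bar>s' x\<bar> \<le> B"
    using compact_imp_bounded[OF \<open>compact (s' ` {0..1})\<close>] unfolding bounded_pos by auto
  have s'B: "\<bar>s' x\<bar> \<le> B" for x using s(6,7)[of x] B by (cases "x < 0"; cases "x > 1") auto
  \<comment> \<open>For \<open>h > 0\<close>, \<open>k c h\<close> is the derivative of
    \<open>s ((x - c) / h)\<close>: it vanishes off \<open>{c..c+h}\<close>, is at most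
    \<open>B / h\<close> in absolute value, and has integral 1 once that interval lies inside
    \<open>{-1..1}\<close>.\<close>
  define k where "k c h x = inverse h * s' (inverse h * x + (- inverse h * c))" for c h x :: real
  have dk: "((\<lambda>x. s (inverse h * x + (- inverse h * c))) has_real_derivative k c h x) (at x)" for c h x
  proof -
    have "((\<lambda>x. inverse h * x + (- inverse h * c)) has_real_derivative inverse h) (at x)"
      by (auto intro!: derivative_eq_intros)
    from DERIV_chain2[OF s(4) this] show ?thesis by (simp add: k_def mult.commute)
  qed
  have ck: "continuous_on A (k c h)" for A c h
    unfolding k_def using s(5) by (auto intro!: continuous_intros continuous_on_compose2[of UNIV s'])
  have av: "\<exists>h0>0. \<forall>h. 0 < h \<and> h < h0 \<longrightarrow> c + h \<le> 1 \<and> \<bar>integral {-1..1} (\<lambda>x. D x * k c h x) - D c\<bar> \<le> e * B"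
    if c: "c \<in> I01" and e: "e > 0" for c e
  proof -
    have "c \<in> {-1..1}" using c by auto
    then obtain d where d: "d > 0" "\<And>y. y \<in> {-1..1} \<Longrightarrow> dist y c < d \<Longrightarrow> dist (D y) (D c) < e"
      using D e unfolding continuous_on_iff by blast
    \<comment> \<open>The bound \<open>d\<close> keeps the oscillation of \<open>D\<close> on
      \<open>{c..c+h}\<close> below \<open>e\<close>; the bound \<open>1 - c\<close> keeps that
      interval inside \<open>{-1..1}\<close>.\<close>
    define h0 where "h0 = min d (1 - c)"
    have "\<bar>integral {-1..1} (\<lambda>x. D x * k c h x) - D c\<bar> \<le> e * B" if h: "0 < h" "h < h0" for h
    proof -
      have "((\<lambda>x. k c h x) has_integral s (inverse h * 1 + (- inverse h * c)) - s (inverse h * (-1) + (- inverse h * c))) {-1..1}"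
        by (rule fundamental_theorem_of_calculus, simp)
           (unfold has_real_derivative_iff_has_vector_derivative[symmetric], rule has_field_derivative_at_within[OF dk])
      moreover have "s (inverse h * 1 + (- inverse h * c)) = 1" "s (inverse h * (-1) + (- inverse h * c)) = 0"
        using h c by (auto intro!: s(2,3) simp: h0_def field_simps)
      ultimately have "(k c h has_integral 1) {-1..1}" by simp
      from has_integral_mult_right[OF this, of "D c"]
      have 1: "((\<lambda>x. D c * k c h x) has_integral D c) {-1..1}" by (simp only: mult_1_right)
      have 2: "(\<lambda>x. D x * k c h x) integrable_on {-1..1}"
        using D ck by (intro integrable_continuous_real continuous_intros)
      have 3: "((\<lambda>x. D x * k c h x - D c * k c h x) has_integral integral {-1..1} (\<lambda>x. D x * k c h x) - D c) {-1..1}"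
        by (intro has_integral_diff 1 integrable_integral 2)
      have out: "k c h x = 0" if "x \<notin> {c..c+h}" for x
      proof -
        have "inverse h * x + (- inverse h * c) < 0 \<or> inverse h * x + (- inverse h * c) > 1"
          using that h by (auto simp: field_simps)
        then show ?thesis using s(6,7) by (auto simp: k_def)
      qed
      have ch: "{c..c+h} \<subseteq> {-1..1}" using h c by (auto simp: h0_def)
      have 4: "((\<lambda>x. D x * k c h x - D c * k c h x) has_integral integral {-1..1} (\<lambda>x. D x * k c h x) - D c) {c..c+h}"
      proof -
        have "((\<lambda>x. if x \<in> {c..c+h} then D x * k c h x - D c * k c h x else 0) has_integral
            integral {-1..1} (\<lambda>x. D x * k c h x) - D c) {-1..1}"
          by (rule has_integral_eq[OF _ 3]) (simp add: out)
        then show ?thesis using has_integral_restrict[OF ch] by (rule iffD1[rotated])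
      qed
      have "\<bar>integral {-1..1} (\<lambda>x. D x * k c h x) - D c\<bar> \<le> (e * B * inverse h) * measure lborel (cbox c (c+h))"
      proof (rule has_integral_bound[of _ "\<lambda>x. D x * k c h x - D c * k c h x", unfolded real_norm_def])
        fix x assume "x \<in> cbox c (c + h)"
        then have "x \<in> {-1..1}" "dist x c < d" using h ch by (auto simp: dist_real_def h0_def)
        then have "\<bar>D x - D c\<bar> \<le> e" using d(2)[of x] by (simp add: dist_real_def)
        moreover have "\<bar>k c h x\<bar> \<le> inverse h * B" using s'B h by (auto simp: k_def abs_mult)
        ultimately have "\<bar>D x - D c\<bar> * \<bar>k c h x\<bar> \<le> e * (inverse h * B)" by (intro mult_mono) auto
        then show "\<bar>D x * k c h x - D c * k c h x\<bar> \<le> e * B * inverse h"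
          by (simp add: mult_ac left_diff_distrib[symmetric] abs_mult[symmetric])
      qed (use e B h 4 in simp_all)
      also have "\<dots> = e * B" using h by simp
      finally show ?thesis .
    qed
    then show ?thesis using d c by (intro exI[of _ h0]) (auto simp: h0_def)
  qed
  have "\<bar>D a - D b\<bar> \<le> 0"
  proof (rule field_le_epsilon)
    fix e :: real assume "e > 0"
    define e' where "e' = e / (2 * B)"
    have "e' > 0" using \<open>e > 0\<close> B by (simp add: e'_def)
    obtain h1 where h1: "h1 > 0" "\<And>h. 0 < h \<Longrightarrow> h < h1 \<Longrightarrow> a + h \<le> 1 \<and> \<bar>integral {-1..1} (\<lambda>x. D x * k a h x) - D a\<bar> \<le> e' * B"
      using av[OF ab(1) \<open>e' > 0\<close>] by blast
    obtain h2 where h2: "h2 > 0" "\<And>h. 0 < h \<Longrightarrow> h < h2 \<Longrightarrow> b + h \<le> 1 \<and> \<bar>integral {-1..1} (\<lambda>x. D x * k b h x) - D b\<bar> \<le> e' * B"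
      using av[OF ab(2) \<open>e' > 0\<close>] by blast
    \<comment> \<open>Halving makes all three bounds strict; in particular \<open>b + h < 1\<close>
      keeps the support of the test function inside the open interval.\<close>
    define h where "h = min (min h1 h2) (1 - b) / 2"
    have h: "0 < h" "h < h1" "h < h2" "b + h < 1" using h1 h2 ab by (auto simp: h_def min_def field_simps)
    define \<phi> where "\<phi> x = s (inverse h * x + (- inverse h * a)) + (-1) * s (inverse h * x + (- inverse h * b))" for x
    have d\<phi>: "(\<phi> has_real_derivative k a h x - k b h x) (at x)" for x
      unfolding \<phi>_def using DERIV_diff[OF dk[of h a x] dk[of h b x]] by simp
    have zero: "\<phi> x = 0" if out: "x \<notin> {a..b+h}" for x
    proof -
      consider "x < a" | "x > b + h" using out unfolding atLeastAtMost_iff by linarith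
      then show ?thesis
      proof cases
        case 1
        then have "inverse h * x + (- inverse h * a) \<le> 0" "inverse h * x + (- inverse h * b) \<le> 0"
          using h ab by (auto simp: field_simps)
        then show ?thesis by (simp add: \<phi>_def s(2))
      next
        case 2
        then have "inverse h * x + (- inverse h * a) \<ge> 1" "inverse h * x + (- inverse h * b) \<ge> 1"
          using h ab by (auto simp: field_simps)
        then show ?thesis by (simp add: \<phi>_def s(3))
      qed
    qed
    then have sub: "{x. \<phi> x \<noteq> 0} \<subseteq> {a..b+h}" by blast
    then have cl: "closure {x. \<phi> x \<noteq> 0} \<subseteq> {a..b+h}" by (rule closure_minimal) auto
    have "test_fn \<phi>"
      unfolding test_fn_def
    proof (intro conjI)
      have "Ck UNIV n \<phi>" for n unfolding \<phi>_def by (intro Ck_add Ck_mult Ck_const Ck_affine s(1))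
      then show "smooth_on UNIV \<phi>" by (intro smooth_on_Ck) auto
      show "compact (closure {x. \<phi> x \<noteq> 0})"
        by (rule compact_closure[THEN iffD2], rule bounded_subset[OF _ sub], simp)
      have "{a..b+h} \<subseteq> I01" using ab h by auto
      then show "closure {x. \<phi> x \<noteq> 0} \<subseteq> I01" using cl by blast
    qed
    from z[OF this] have "integral {-1..1} (\<lambda>x. D x * k a h x - D x * k b h x) = 0"
      using DERIV_imp_deriv[OF d\<phi>] by (simp add: right_diff_distrib)
    moreover have "(\<lambda>x. D x * k a h x) integrable_on {-1..1}" "(\<lambda>x. D x * k b h x) integrable_on {-1..1}"
      using D ck by (auto intro!: integrable_continuous_real continuous_intros)
    ultimately have "integral {-1..1} (\<lambda>x. D x * k a h x) = integral {-1..1} (\<lambda>x. D x * k b h x)"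
      by (simp add: integral_diff)
    moreover have "e' * B = e / 2" using B by (simp add: e'_def)
    ultimately show "\<bar>D a - D b\<bar> \<le> 0 + e" using h1(2)[of h] h2(2)[of h] h by linarith
  qed
  then show ?thesis by simp
qed

lemma set_borel_measurable_add_I01:
  assumes "set_borel_measurable lborel I01 f" "set_borel_measurable lborel I01 (g :: real \<Rightarrow> real)"
  shows "set_borel_measurable lborel I01 (\<lambda>x. f x + g x)"
  using borel_measurable_add[OF assms[unfolded set_borel_measurable_def]]
  unfolding set_borel_measurable_def scaleR_add_right .

lemma set_integrable_continuous_mult_I01:
  assumes "continuous_on {-1..1} f" "set_integrable lborel I01 (g :: real \<Rightarrow> real)"
  shows "set_integrable lborel I01 (\<lambda>x. f x * g x)"
proof (rule set_integrable_lborelI)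
  have "set_borel_measurable lborel I01 g"
    using assms(2) unfolding set_integrable_def set_borel_measurable_def by (rule borel_measurable_integrable)
  then show "set_borel_measurable lborel I01 (\<lambda>x. f x * g x)"
    by (rule set_borel_measurable_mult_I01[OF set_borel_measurable_continuous_I01[OF assms(1)]])
  show "(\<lambda>x. f x * g x) absolutely_integrable_on {-1..1}"
    by (rule absolutely_integrable_continuous_mult[OF assms(1) set_integrable_lborel_imp(1)[OF assms(2)]])
qed

lemma set_integrable_continuous_I01:
  assumes "continuous_on {-1..1} (f :: real \<Rightarrow> real)"
  shows "set_integrable lborel I01 f"
  by (rule set_integrable_lborelI[OF set_borel_measurable_continuous_I01[OF assms] absolutely_integrable_continuous_real[OF assms]])

lemma abs_cont_imp_weak_deriv:
  assumes "abs_cont p g" "set_borel_measurable lborel I01 g"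
  shows "weak_deriv p g"
  unfolding weak_deriv_def
proof (intro conjI allI impI)
  note cp = abs_cont_continuous[OF assms(1)]
  show "set_integrable lborel I01 p" by (rule set_integrable_continuous_I01[OF cp])
  show g: "set_integrable lborel I01 g" by (rule set_integrable_lborelI[OF assms(2) abs_contD(1)[OF assms(1)]])
  fix \<phi> assume \<phi>: "test_fn \<phi>"
  note T = test_fn_abs_cont[OF \<phi>]
  have 1: "set_integrable lborel I01 (\<lambda>x. p x * deriv \<phi> x)"
    by (intro set_integrable_continuous_I01 continuous_intros cp T(3))
  have 2: "set_integrable lborel I01 (\<lambda>x. \<phi> x * g x)"
    by (rule set_integrable_continuous_mult_I01[OF T(2) g])
  show "(LINT x:I01|lborel. p x * deriv \<phi> x) = - (LINT x:I01|lborel. g x * \<phi> x)"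
    unfolding mult.commute[of "g _"] set_integrable_lborel_imp(2)[OF 1] set_integrable_lborel_imp(2)[OF 2]
    using abs_cont_imp_weak_deriv_integral[OF assms(1) \<phi>] unfolding mult.commute[of "g _"] .
qed

text \<open>The difference of \<open>p\<close> and a primitive of \<open>g\<close> has weak
  derivative zero, hence is constant on the open interval and, by continuity, on the closed one.
  Continuity of \<open>p\<close> is what selects the right representative.\<close>

lemma weak_deriv_imp_abs_cont:
  assumes w: "weak_deriv p g" and cp: "continuous_on {-1..1} p"
  shows "abs_cont p g"
proof -
  have g: "set_integrable lborel I01 g" using w by (simp add: weak_deriv_def)
  define q where "q x = 0 + integral {-1..x} g" for x
  have q: "abs_cont q g"
    unfolding q_def by (rule abs_cont_indefinite_integral[OF set_integrable_lborel_imp(1)[OF g]])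
  note cq = abs_cont_continuous[OF q]
  define D where "D x = p x - q x" for x
  have cD: "continuous_on {-1..1} D" unfolding D_def by (intro continuous_intros cp cq)
  have z: "integral {-1..1} (\<lambda>x. D x * deriv \<phi> x) = 0" if \<phi>: "test_fn \<phi>" for \<phi>
  proof -
    note T = test_fn_abs_cont[OF \<phi>]
    have 1: "set_integrable lborel I01 (\<lambda>x. p x * deriv \<phi> x)"
      by (intro set_integrable_continuous_I01 continuous_intros cp T(3))
    have 2: "set_integrable lborel I01 (\<lambda>x. \<phi> x * g x)"
      by (rule set_integrable_continuous_mult_I01[OF T(2) g])
    have "(LINT x:I01|lborel. p x * deriv \<phi> x) = - (LINT x:I01|lborel. g x * \<phi> x)"
      using w \<phi> unfolding weak_deriv_def by simp
    then have "(LINT x:I01|lborel. p x * deriv \<phi> x) = - (LINT x:I01|lborel. \<phi> x * g x)"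
      unfolding mult.commute[of "g _"] .
    then have "integral {-1..1} (\<lambda>x. p x * deriv \<phi> x) = integral {-1..1} (\<lambda>x. q x * deriv \<phi> x)"
      using abs_cont_imp_weak_deriv_integral[OF q \<phi>]
      unfolding set_integrable_lborel_imp(2)[OF 1] set_integrable_lborel_imp(2)[OF 2] mult.commute[of "g _"] by linarith
    moreover have "integral {-1..1} (\<lambda>x. D x * deriv \<phi> x) =
        integral {-1..1} (\<lambda>x. p x * deriv \<phi> x) - integral {-1..1} (\<lambda>x. q x * deriv \<phi> x)"
      unfolding D_def left_diff_distrib
      by (intro integral_diff integrable_continuous_real continuous_intros cp cq T(3))
    ultimately show ?thesis by simp
  qed
  have "D x = D 0" if "x \<in> I01" for x
  proof -
    consider "x < 0" | "x = 0" | "x > 0" by linarith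
    then show ?thesis
    proof cases
      case 1 then show ?thesis by (intro constant_if_weak_deriv_zero[OF cD z that]) simp_all
    next
      case 3 then show ?thesis by (intro constant_if_weak_deriv_zero[OF cD z _ that, symmetric]) simp_all
    qed simp
  qed
  moreover have "closure I01 = {-1..1::real}" by simp
  ultimately have c: "D x = D 0" if "x \<in> {-1..1}" for x
    using continuous_constant_on_closure[of I01 D "D 0" x] cD that by (simp only:)
  have "abs_cont (\<lambda>x. D 0 + integral {-1..x} g) g"
    by (rule abs_cont_indefinite_integral[OF set_integrable_lborel_imp(1)[OF g]])
  then show ?thesis
  proof (rule abs_cont_cong[OF _ _ negligible_empty])
    fix x :: real assume "x \<in> {-1..1}"
    from c[OF this] show "D 0 + integral {-1..x} g = p x" by (simp add: D_def q_def)
  qed simp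
qed

text \<open>The positive and the negative part of \<open>f\<close>, taken as densities, give the
  same mass to every half-line and so define the same measure. Two parts that agree almost
  everywhere can only be 0, since at each point one of them vanishes.\<close>

lemma AE_zero_if_integral_zero:
  fixes f :: "real \<Rightarrow> real"
  assumes f: "set_integrable lborel I01 f" and z: "\<And>a b. -1 \<le> a \<Longrightarrow> a \<le> b \<Longrightarrow> b \<le> 1 \<Longrightarrow> integral {a..b} f = 0"
  shows "AE x in lborel. x \<in> I01 \<longrightarrow> f x = 0"
proof -
  define F where "F x = indicator I01 x *\<^sub>R f x" for x
  have F: "integrable lborel F" using f unfolding set_integrable_def F_def .
  then have Fm[measurable]: "F \<in> borel_measurable borel" by simp
  have tail: "(\<integral>x. F x * indicator {c<..} x \<partial>lborel) = 0" for c
  proof (cases "c < 1")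
    case True
    define a where "a = max c (-1)"
    have a: "-1 \<le> a" "a < 1" using True by (auto simp: a_def)
    have eq: "F x * indicator {c<..} x = indicator {a<..<1} x *\<^sub>R f x" for x
      unfolding F_def a_def by (auto simp: indicator_def)
    have "set_integrable lborel {a<..<1} f"
      by (rule set_integrable_subset[OF f]) (use a in auto)
    from set_borel_integral_eq_integral(2)[OF this]
    have "(LINT x:{a<..<1}|lborel. f x) = integral {a..1} f" unfolding integral_open_interval_real .
    then show ?thesis unfolding eq set_lebesgue_integral_def using z[of a 1] a by simp
  next
    case False
    then have "(\<lambda>x. F x * indicator {c<..} x) = (\<lambda>x. 0)" unfolding F_def by (auto simp: indicator_def)
    then show ?thesis by (simp only: Bochner_Integration.integral_zero)
  qed
  have em: "emeasure (density lborel (\<lambda>x. ennreal (h x))) {c<..} = ennreal (\<integral>x. max 0 (h x) * indicator {c<..} x \<partial>lborel)"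
    and ih: "integrable lborel (\<lambda>x. max 0 (h x) * indicator {c<..} x)"
    if h: "integrable lborel h" for h and c :: real
  proof -
    have [measurable]: "h \<in> borel_measurable borel" using h by simp
    show ih: "integrable lborel (\<lambda>x. max 0 (h x) * indicator {c<..} x)"
      by (rule Bochner_Integration.integrable_bound[OF h]) (auto simp: indicator_def)
    have "emeasure (density lborel (\<lambda>x. ennreal (h x))) {c<..} = (\<integral>\<^sup>+x. ennreal (h x) * indicator {c<..} x \<partial>lborel)"
      by (subst emeasure_density) auto
    also have "\<dots> = (\<integral>\<^sup>+x. ennreal (max 0 (h x) * indicator {c<..} x) \<partial>lborel)"
      by (intro nn_integral_cong) (auto simp: indicator_def ennreal_max_0)
    also have "\<dots> = ennreal (\<integral>x. max 0 (h x) * indicator {c<..} x \<partial>lborel)"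
      by (rule nn_integral_eq_integral[OF ih]) auto
    finally show "emeasure (density lborel (\<lambda>x. ennreal (h x))) {c<..} = ennreal (\<integral>x. max 0 (h x) * indicator {c<..} x \<partial>lborel)" .
  qed
  have F': "integrable lborel (\<lambda>x. - F x)" using F by simp
  have "(\<integral>x. max 0 (F x) * indicator {c<..} x \<partial>lborel) = (\<integral>x. max 0 (- F x) * indicator {c<..} x \<partial>lborel)" for c
  proof -
    have "(\<integral>x. max 0 (F x) * indicator {c<..} x \<partial>lborel) - (\<integral>x. max 0 (- F x) * indicator {c<..} x \<partial>lborel)
      = (\<integral>x. max 0 (F x) * indicator {c<..} x - max 0 (- F x) * indicator {c<..} x \<partial>lborel)"
      by (rule Bochner_Integration.integral_diff[OF ih[OF F] ih[OF F'], symmetric])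
    also have "\<dots> = (\<integral>x. F x * indicator {c<..} x \<partial>lborel)"
      by (intro Bochner_Integration.integral_cong) (auto simp: max_def indicator_def)
    finally show ?thesis using tail[of c] by simp
  qed
  \<comment> \<open>\<open>ennreal\<close> sends negative reals to 0, so the two densities are the
    positive and the negative part of \<open>F\<close>.\<close>
  then have "density lborel (\<lambda>x. ennreal (F x)) = density lborel (\<lambda>x. ennreal (- F x))"
    by (intro measure_eqI_lessThan) (simp_all add: em[OF F] em[OF F'])
  then have "AE x in lborel. ennreal (F x) = ennreal (- F x)"
    by (intro sigma_finite_measure.density_unique[OF lborel.sigma_finite_measure_axioms]) measurable
  then show ?thesis
  proof eventually_elim
    case (elim x)
    show ?case
    proof
      assume "x \<in> I01"
      then have "ennreal (f x) = ennreal (- f x)" using elim by (simp add: F_def)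
      then show "f x = 0"
        by (cases "f x \<ge> 0") (auto simp: ennreal_neg ennreal_eq_0_iff dest: sym)
    qed
  qed
qed

lemma AE_I01_negligible:
  assumes "AE x in lborel. x \<in> I01 \<longrightarrow> P x"
  obtains N where "negligible N" "\<And>x. x \<in> {-1..1} - N \<Longrightarrow> P x"
proof -
  obtain N where N: "N \<in> null_sets lborel" "{x \<in> space lborel. \<not> (x \<in> I01 \<longrightarrow> P x)} \<subseteq> N"
    using assms unfolding eventually_ae_filter by auto
  have "negligible N" using N(1) by (simp add: negligible_iff_null_sets null_sets_completionI)
  then have "negligible (N \<union> {-1,1})" by (simp add: negligible_Un)
  moreover have "P x" if "x \<in> {-1..1} - (N \<union> {-1,1})" for x
  proof -
    have "x \<in> I01" using that by auto
    then show ?thesis using N(2) that by auto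
  qed
  ultimately show ?thesis by (rule that)
qed

lemma abs_cont_unique_AE:
  assumes "abs_cont p g" "abs_cont p h" "set_borel_measurable lborel I01 g" "set_borel_measurable lborel I01 h"
  shows "AE x in lborel. x \<in> I01 \<longrightarrow> g x = h x"
proof -
  have "AE x in lborel. x \<in> I01 \<longrightarrow> g x - h x = 0"
  proof (rule AE_zero_if_integral_zero)
    show "set_integrable lborel I01 (\<lambda>x. g x - h x)"
      using assms by (intro set_integral_diff(1) set_integrable_lborelI abs_contD(1))
    fix a b :: real assume *: "-1 \<le> a" "a \<le> b" "b \<le> 1"
    show "integral {a..b} (\<lambda>x. g x - h x) = 0"
      using has_integral_diff[OF abs_contD(2)[OF assms(1) *] abs_contD(2)[OF assms(2) *]] by (simp add: integral_unique)
  qed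
  then show ?thesis by eventually_elim auto
qed

lemma LINT_I01_cong_AE:
  assumes "AE x in lborel. x \<in> I01 \<longrightarrow> f x = (g x :: real)"
    "set_borel_measurable lborel I01 f" "set_borel_measurable lborel I01 g"
  shows "(LINT x:I01|lborel. f x) = (LINT x:I01|lborel. g x)"
    "set_integrable lborel I01 f \<longleftrightarrow> set_integrable lborel I01 g"
proof -
  have *: "AE x in lborel. indicator I01 x *\<^sub>R f x = indicator I01 x *\<^sub>R g x"
    using assms(1) by eventually_elim (auto simp: indicator_def)
  show "(LINT x:I01|lborel. f x) = (LINT x:I01|lborel. g x)"
    unfolding set_lebesgue_integral_def
    by (rule integral_cong_AE[OF _ _ *]) (use assms in \<open>simp_all add: set_borel_measurable_def\<close>)
  show "set_integrable lborel I01 f \<longleftrightarrow> set_integrable lborel I01 g"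
    unfolding set_integrable_def
    by (rule integrable_cong_AE[OF _ _ *]) (use assms in \<open>simp_all add: set_borel_measurable_def\<close>)
qed

lemma set_integrable_imp_set_borel_measurable:
  "set_integrable lborel I01 f \<Longrightarrow> set_borel_measurable lborel I01 (f :: real \<Rightarrow> real)"
  unfolding set_integrable_def set_borel_measurable_def by (rule borel_measurable_integrable)

lemma L2_on_cong_AE:
  assumes "L2_on f" "AE x in lborel. x \<in> I01 \<longrightarrow> f x = g x" "set_borel_measurable lborel I01 g"
  shows "L2_on g"
proof -
  have sq: "set_borel_measurable lborel I01 (\<lambda>x. (g x)\<^sup>2)"
    unfolding power2_eq_square by (rule set_borel_measurable_mult_I01[OF assms(3,3)])
  have i: "set_integrable lborel I01 (\<lambda>x. (f x)\<^sup>2)" using assms(1) by (simp add: L2_on_def)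
  have "AE x in lborel. x \<in> I01 \<longrightarrow> (f x)\<^sup>2 = (g x)\<^sup>2" using assms(2) by eventually_elim auto
  from LINT_I01_cong_AE(2)[OF this set_integrable_imp_set_borel_measurable[OF i] sq] i
  show ?thesis using assms(3) by (simp add: L2_on_def)
qed

text \<open>Membership in \<open>N_set\<close> with the derivatives as explicit data:
  \<open>p\<close> is the classical \<open>u'\<close> and \<open>g\<close> any square integrable
  representative of \<open>u''\<close>. This frees later arguments from the choice operators in
  \<open>d1\<close> and \<open>d2\<close>. The values at -1 follow from evenness of \<open>u\<close>
  and the resulting oddness of \<open>p\<close>.\<close>

definition profile :: "real \<Rightarrow> (real \<Rightarrow> real) \<Rightarrow> (real \<Rightarrow> real) \<Rightarrow> (real \<Rightarrow> real) \<Rightarrow> bool" where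
  "profile \<alpha> u p g \<longleftrightarrow> (\<forall>x\<in>{-1..1}. (u has_real_derivative p x) (at x within {-1..1})) \<and>
     abs_cont p g \<and> L2_on g \<and> (\<forall>x\<in>{-1..1}. u (- x) = u x) \<and> (\<forall>x\<in>{-1..1}. u x > 0) \<and> u 1 = \<alpha> \<and> p 1 = 0"

lemma at_within_Icc_ne_bot: "x \<in> {-1..1::real} \<Longrightarrow> at x within {-1..1} \<noteq> bot"
  by (simp add: trivial_limit_within islimpt_Icc)

lemma derivative_even_imp_odd:
  assumes "\<And>x. x \<in> {-1..1} \<Longrightarrow> (u has_real_derivative p x) (at x within {-1..1})"
    "\<And>x. x \<in> {-1..1} \<Longrightarrow> u (- x) = u x" "x \<in> {-1..1::real}"
  shows "p (- x) = - p x"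
proof -
  have "-x \<in> {-1..1}" using assms(3) by auto
  from assms(1)[OF this]
  have "(u has_real_derivative p (- x)) (at (- x) within uminus ` {-1..1})" by simp
  moreover have "(uminus has_real_derivative -1) (at x within {-1..1})"
    by (auto intro!: derivative_eq_intros)
  ultimately have "(u \<circ> uminus has_real_derivative p (- x) * (-1)) (at x within {-1..1})"
    by (rule DERIV_image_chain)
  then have "(u has_real_derivative p (- x) * (-1)) (at x within {-1..1})"
    by (rule has_real_derivative_cong_on[OF _ assms(3)]) (use assms(2) in auto)
  from has_real_derivative_unique_within[OF this assms(1)[OF assms(3)] at_within_Icc_ne_bot[OF assms(3)]]
  show ?thesis by simp
qed

lemma d1_eq:
  assumes "(u has_real_derivative d) (at x within {-1..1})" "x \<in> {-1..1}"
  shows "d1 u x = d"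
  unfolding d1_def
proof (rule some_equality)
  show "d' = d" if "(u has_real_derivative d') (at x within {-1..1})" for d'
    by (rule has_real_derivative_unique_within[OF that assms(1) at_within_Icc_ne_bot[OF assms(2)]])
qed (rule assms(1))

text \<open>The weak derivative \<open>g1\<close> from \<open>H2\<close> need not be the pointwise
  derivative, but both are densities of \<open>u\<close> and so agree almost everywhere. Hence
  \<open>g2\<close> is a weak derivative of \<open>d1 u\<close>, the choice in \<open>d2 u\<close>
  is not void, and \<open>d2 u\<close> agrees with \<open>g2\<close> almost everywhere and inherits
  square integrability.\<close>

lemma N_set_profile:
  assumes "u \<in> N_set \<alpha>"
  shows "profile \<alpha> u (d1 u) (d2 u)"
proof -
  obtain g1 g2 where g: "L2_on u" "L2_on g1" "L2_on g2" "weak_deriv u g1" "weak_deriv g1 g2"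
    using assms unfolding N_set_def H2_def by blast
  obtain u1 where u1: "continuous_on {-1..1} u1" "\<And>x. x \<in> {-1..1} \<Longrightarrow> (u has_real_derivative u1 x) (at x within {-1..1})"
    using assms unfolding N_set_def C1_rep_def by blast
  have eq: "u1 x = d1 u x" if "x \<in> {-1..1}" for x using d1_eq[OF u1(2)[OF that] that] by simp
  have c: "continuous_on {-1..1} (d1 u)" by (rule continuous_on_eq[OF u1(1) eq])
  have d: "(u has_real_derivative d1 u x) (at x within {-1..1})" if "x \<in> {-1..1}" for x
    using u1(2)[OF that] eq[OF that] by simp
  have ac: "abs_cont u (d1 u)" by (rule abs_cont_C1[OF d c])
  have ac1: "abs_cont u g1" by (rule weak_deriv_imp_abs_cont[OF g(4) abs_cont_continuous[OF ac]])
  have ae: "AE x in lborel. x \<in> I01 \<longrightarrow> g1 x = d1 u x"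
    by (rule abs_cont_unique_AE[OF ac1 ac _ set_borel_measurable_continuous_I01[OF c]]) (use g(2) in \<open>simp add: L2_on_def\<close>)
  have m1: "set_borel_measurable lborel I01 g1" using g(2) by (simp add: L2_on_def)
  have md: "set_borel_measurable lborel I01 (d1 u)" by (rule set_borel_measurable_continuous_I01[OF c])
  have "weak_deriv (d1 u) g2"
    unfolding weak_deriv_def
  proof (intro conjI allI impI)
    show "set_integrable lborel I01 (d1 u)" by (rule set_integrable_continuous_I01[OF c])
    show "set_integrable lborel I01 g2" using g(5) by (simp add: weak_deriv_def)
    fix \<phi> assume \<phi>: "test_fn \<phi>"
    have ae': "AE x in lborel. x \<in> I01 \<longrightarrow> d1 u x * deriv \<phi> x = g1 x * deriv \<phi> x"
      using ae by eventually_elim auto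
    have "(LINT x:I01|lborel. d1 u x * deriv \<phi> x) = (LINT x:I01|lborel. g1 x * deriv \<phi> x)"
      by (rule LINT_I01_cong_AE(1)[OF ae'])
         (rule set_borel_measurable_mult_I01[OF md set_borel_measurable_continuous_I01[OF test_fn_abs_cont(3)[OF \<phi>]]]
            set_borel_measurable_mult_I01[OF m1 set_borel_measurable_continuous_I01[OF test_fn_abs_cont(3)[OF \<phi>]]])+
    then show "(LINT x:I01|lborel. d1 u x * deriv \<phi> x) = - (LINT x:I01|lborel. g2 x * \<phi> x)"
      using g(5) \<phi> by (simp add: weak_deriv_def)
  qed
  note w' = this
  have w2: "weak_deriv (d1 u) (d2 u)" unfolding d2_def by (rule someI[of "weak_deriv (d1 u)" g2, OF w'])
  have ac2: "abs_cont (d1 u) g2" by (rule weak_deriv_imp_abs_cont[OF w' c])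
  have ac3: "abs_cont (d1 u) (d2 u)" by (rule weak_deriv_imp_abs_cont[OF w2 c])
  have m3: "set_borel_measurable lborel I01 (d2 u)"
    using w2 by (simp add: weak_deriv_def set_integrable_imp_set_borel_measurable)
  have m2: "set_borel_measurable lborel I01 g2" using g(3) by (simp add: L2_on_def)
  have "L2_on (d2 u)" by (rule L2_on_cong_AE[OF g(3) abs_cont_unique_AE[OF ac2 ac3 m2 m3] m3])
  moreover have "d1 u 1 = 0"
    by (rule d1_eq) (use assms in \<open>simp_all add: N_set_def\<close>)
  ultimately show ?thesis
    unfolding profile_def using d ac3 assms[unfolded N_set_def mem_Collect_eq] by blast
qed

lemma profileD:
  assumes "profile \<alpha> u p g"
  shows "\<And>x. x \<in> {-1..1} \<Longrightarrow> (u has_real_derivative p x) (at x within {-1..1})"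
    "abs_cont p g" "L2_on g" "\<And>x. x \<in> {-1..1} \<Longrightarrow> u (- x) = u x" "\<And>x. x \<in> {-1..1} \<Longrightarrow> u x > 0"
    "u 1 = \<alpha>" "p 1 = 0" "continuous_on {-1..1} u" "continuous_on {-1..1} p" "abs_cont u p"
    "\<And>x. x \<in> {-1..1} \<Longrightarrow> p (- x) = - p x" "u (-1) = \<alpha>" "p (-1) = 0"
    "set_borel_measurable lborel I01 g" "(\<lambda>x. (g x)\<^sup>2) absolutely_integrable_on {-1..1}"
proof -
  show *: "\<And>x. x \<in> {-1..1} \<Longrightarrow> (u has_real_derivative p x) (at x within {-1..1})"
    "abs_cont p g" "L2_on g" "\<And>x. x \<in> {-1..1} \<Longrightarrow> u (- x) = u x" "\<And>x. x \<in> {-1..1} \<Longrightarrow> u x > 0"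
    "u 1 = \<alpha>" "p 1 = 0"
    using assms by (auto simp: profile_def)
  show "continuous_on {-1..1} u" by (rule DERIV_continuous_on[OF *(1)])
  show c: "continuous_on {-1..1} p" by (rule abs_cont_continuous[OF *(2)])
  show "abs_cont u p" by (rule abs_cont_C1[OF *(1) c])
  show odd: "p (- x) = - p x" if "x \<in> {-1..1}" for x by (rule derivative_even_imp_odd[OF *(1,4) that])
  show "u (-1) = \<alpha>" "p (-1) = 0" using *(4)[of 1] odd[of 1] *(6,7) by auto
  show "set_borel_measurable lborel I01 g" using *(3) by (simp add: L2_on_def)
  show "(\<lambda>x. (g x)\<^sup>2) absolutely_integrable_on {-1..1}"
    using *(3) by (intro set_integrable_lborel_imp(1)) (simp add: L2_on_def)
qed

lemma L2_on_continuous: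
  assumes "continuous_on {-1..1} f" shows "L2_on f"
  unfolding L2_on_def
  by (intro conjI set_borel_measurable_continuous_I01 set_integrable_continuous_I01 continuous_intros assms)

lemma profile_N_set:
  assumes P: "profile \<alpha> u p g"
  shows "u \<in> N_set \<alpha>"
proof -
  note D = profileD[OF P]
  have "weak_deriv u p" by (rule abs_cont_imp_weak_deriv[OF D(10) set_borel_measurable_continuous_I01[OF D(9)]])
  moreover have "weak_deriv p g" by (rule abs_cont_imp_weak_deriv[OF D(2) D(14)])
  ultimately have "H2 u" unfolding H2_def using L2_on_continuous[OF D(8)] L2_on_continuous[OF D(9)] D(3) by blast
  moreover have "C1_rep u" unfolding C1_rep_def using D(1,9) by blast
  moreover have "(u has_real_derivative 0) (at (-1) within {-1..1})" "(u has_real_derivative 0) (at 1 within {-1..1})"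
    using D(1)[of 1] D(1)[of "-1"] D(7,13) by auto
  ultimately show ?thesis using D by (simp add: N_set_def)
qed

lemma profile_d1_d2:
  assumes P: "profile \<alpha> u p g"
  shows "\<And>x. x \<in> {-1..1} \<Longrightarrow> d1 u x = p x"
    and "\<exists>N. negligible N \<and> (\<forall>x\<in>{-1..1} - N. d2 u x = g x)"
proof -
  note D = profileD[OF P] and D' = profileD[OF N_set_profile[OF profile_N_set[OF P]]]
  show eq: "d1 u x = p x" if "x \<in> {-1..1}" for x by (rule d1_eq[OF D(1)[OF that] that])
  have "abs_cont p (d2 u)" by (rule abs_cont_cong[OF D'(2) eq negligible_empty]) auto
  from AE_I01_negligible[OF abs_cont_unique_AE[OF this D(2) D'(14) D(14)]]
  show "\<exists>N. negligible N \<and> (\<forall>x\<in>{-1..1} - N. d2 u x = g x)" by metis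
qed

section \<open>Energy and a priori bounds\<close>

text \<open>\<open>Q e p\<close> is \<open>k\<close> to the power \<open>2 * e\<close> with
  \<open>k = sqrt (1 + p\<^sup>2)\<close>. One family with a free exponent lets continuity,
  smoothness and expansion be settled once for all weights that occur.\<close>

definition Q :: "real \<Rightarrow> real \<Rightarrow> real" where "Q e p = (1 + p\<^sup>2) powr e"

definition Ja :: "real \<Rightarrow> real \<Rightarrow> real" where "Ja u p = u * Q (-5/2) p"

text \<open>The factor 4 compensates for the normalisation: \<open>Area\<close> carries
  \<open>2 * pi\<close>, whereas the reduced energy is multiplied by \<open>pi / 2\<close>.\<close>

definition Jb :: "real \<Rightarrow> real \<Rightarrow> real \<Rightarrow> real" where
  "Jb \<epsilon> u p = Q (-1/2) p / u + 4 * \<epsilon> * u * Q (1/2) p"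

definition energy :: "real \<Rightarrow> (real \<Rightarrow> real) \<Rightarrow> (real \<Rightarrow> real) \<Rightarrow> (real \<Rightarrow> real) \<Rightarrow> real" where
  "energy \<epsilon> u p g = integral {-1..1} (\<lambda>x. Ja (u x) (p x) * (g x)\<^sup>2 + Jb \<epsilon> (u x) (p x))"

lemma one_plus_sq_pos: "0 < 1 + (p::real)\<^sup>2"
  by (simp add: add_pos_nonneg)

lemma Q_pos: "Q e p > 0"
  unfolding Q_def using one_plus_sq_pos[of p] by simp

lemma Q_sqrt:
  fixes p :: real
  defines "k \<equiv> sqrt (1 + p\<^sup>2)"
  shows "Q (1/2) p = k" "Q (-1/2) p = 1 / k" "Q (-3/2) p = 1 / k ^ 3" "Q (-5/2) p = 1 / k ^ 5" "Q (3/2) p = k ^ 3"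
    "k > 0" "k ^ 2 = 1 + p\<^sup>2"
proof -
  show k: "k > 0" "k ^ 2 = 1 + p\<^sup>2" using one_plus_sq_pos[of p] by (auto simp: k_def)
  have k2: "1 + p\<^sup>2 = k powr 2" using k by simp
  have "Q e p = k powr (2 * e)" for e unfolding Q_def k2 by (simp add: powr_powr)
  note E = this
  show "Q (1/2) p = k" using k E by simp
  have m: "k powr (- n) = 1 / k powr n" for n by (simp add: powr_minus_divide)
  show "Q (-1/2) p = 1 / k" using k E[of "-1/2"] m[of 1] by simp
  have r: "k powr 3 = k ^ 3" "k powr 5 = k ^ 5" using k by simp_all
  show "Q (-3/2) p = 1 / k ^ 3" using E[of "-3/2"] m[of 3] r by simp
  show "Q (-5/2) p = 1 / k ^ 5" using E[of "-5/2"] m[of 5] r by simp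
  show "Q (3/2) p = k ^ 3" using E[of "3/2"] r by simp
qed

lemma continuous_on_Q [continuous_intros]: "continuous_on S p \<Longrightarrow> continuous_on S (\<lambda>x. Q e (p x))"
  unfolding Q_def using one_plus_sq_pos by (intro continuous_intros) (auto simp: less_imp_neq[symmetric])

lemma continuous_on_Ja [continuous_intros]:
  "continuous_on S u \<Longrightarrow> continuous_on S p \<Longrightarrow> continuous_on S (\<lambda>x. Ja (u x) (p x))"
  unfolding Ja_def by (intro continuous_intros)

lemma continuous_on_Jb [continuous_intros]:
  assumes "continuous_on S u" "continuous_on S p" "\<And>x. x \<in> S \<Longrightarrow> u x > 0"
  shows "continuous_on S (\<lambda>x. Jb \<epsilon> (u x) (p x))"
  unfolding Jb_def by (intro continuous_intros assms(1,2)) (metis assms(3) less_irrefl)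

lemma LINT_quadratic_I01:
  assumes c: "continuous_on {-1..1} c1" "continuous_on {-1..1} c2" "continuous_on {-1..1} c3"
    and g: "L2_on g" "g absolutely_integrable_on {-1..1}"
    and f: "\<And>x. x \<in> I01 \<Longrightarrow> f x = c1 x * (g x)\<^sup>2 + c2 x * g x + c3 x"
  shows "(LINT x:I01|lborel. f x) = integral {-1..1} (\<lambda>x. c1 x * (g x)\<^sup>2 + c2 x * g x + c3 x)"
proof -
  have g': "set_integrable lborel I01 (\<lambda>x. (g x)\<^sup>2)" "set_integrable lborel I01 g"
    using g set_integrable_lborelI[OF _ g(2)] by (simp_all add: L2_on_def)
  have "set_integrable lborel I01 (\<lambda>x. c1 x * (g x)\<^sup>2 + c2 x * g x + c3 x)"
    by (intro set_integral_add(1) set_integrable_continuous_mult_I01 c g' set_integrable_continuous_I01)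
  note s = set_integrable_lborel_imp(2)[OF this]
  have "(LINT x:I01|lborel. f x) = (LINT x:I01|lborel. c1 x * (g x)\<^sup>2 + c2 x * g x + c3 x)"
    by (rule set_lebesgue_integral_cong) (use f in auto)
  then show ?thesis unfolding s .
qed

text \<open>\<open>p / k\<close> is the sine of the inclination angle of the profile curve; its
  derivative in \<open>p\<close> comes from
  \<open>1 / k - p\<^sup>2 / k ^ 3 = 1 / k ^ 3\<close>.\<close>

lemma abs_cont_sine:
  assumes "abs_cont p g"
  shows "abs_cont (\<lambda>x. p x * Q (-1/2) (p x)) (\<lambda>x. Q (-3/2) (p x) * g x)"
proof (rule abs_cont_compose[OF assms])
  show "continuous_on UNIV (Q (-3/2))" using continuous_on_Q[OF continuous_on_id, of UNIV] by simp
  fix y :: real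
  define k where "k = sqrt (1 + y\<^sup>2)"
  note Qk = Q_sqrt[of y, folded k_def]
  have "((\<lambda>y. y * Q (-1/2) y) has_real_derivative Q (-1/2) y + y * ((-1/2) * (1 + y\<^sup>2) powr (-1/2 - 1) * (2 * y))) (at y)"
    unfolding Q_def using one_plus_sq_pos[of y]
    by (auto intro!: derivative_eq_intros simp: powr_diff field_simps)
  moreover have "(1 + y\<^sup>2) powr (-1/2 - 1) = 1 / k ^ 3" using Qk(3) by (simp add: Q_def)
  moreover have "1 / k + y * ((-1/2) * (1 / k ^ 3) * (2 * y)) = 1 / k ^ 3"
  proof -
    have "1 / k = k ^ 2 / k ^ 3" using Qk(6) by (simp add: power3_eq_cube power2_eq_square)
    then have "1 / k = (1 + y\<^sup>2) / k ^ 3" unfolding Qk(7) .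
    then show ?thesis by (simp add: power2_eq_square add_divide_distrib)
  qed
  ultimately show "((\<lambda>y. y * Q (-1/2) y) has_real_derivative Q (-3/2) y) (at y)"
    unfolding Qk(2,3) by simp
qed

section \<open>The Helfrich energy in reduced form\<close>

lemma profile_integrable:
  assumes P: "profile \<alpha> u p g"
  shows "(\<lambda>x. Ja (u x) (p x) * (g x)\<^sup>2) absolutely_integrable_on {-1..1}"
    "continuous_on {-1..1} (\<lambda>x. Jb \<epsilon> (u x) (p x))"
    "(\<lambda>x. Ja (u x) (p x) * (g x)\<^sup>2 + Jb \<epsilon> (u x) (p x)) absolutely_integrable_on {-1..1}"
proof -
  note D = profileD[OF P]
  show 1: "(\<lambda>x. Ja (u x) (p x) * (g x)\<^sup>2) absolutely_integrable_on {-1..1}"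
    by (intro absolutely_integrable_continuous_mult continuous_intros D)
  show 2: "continuous_on {-1..1} (\<lambda>x. Jb \<epsilon> (u x) (p x))"
    by (intro continuous_intros D)
  show "(\<lambda>x. Ja (u x) (p x) * (g x)\<^sup>2 + Jb \<epsilon> (u x) (p x)) absolutely_integrable_on {-1..1}"
    by (rule set_integral_add(1)[OF 1 absolutely_integrable_continuous_real[OF 2]])
qed

lemma Helfrich_eq_energy_aux:
  assumes P: "profile \<alpha> u (d1 u) (d2 u)"
  shows "Helfrich \<epsilon> u = pi / 2 * energy \<epsilon> u (d1 u) (d2 u)"
proof -
  define p where "p = d1 u"
  define g where "g = d2 u"
  note P' = P[folded p_def g_def]
  note D = profileD[OF P']
  have w: "(1 / (u x * sqrt (1 + (p x)\<^sup>2)) - g x / (1 + (p x)\<^sup>2) powr (3/2))\<^sup>2 * u x * sqrt (1 + (p x)\<^sup>2)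
      = Ja (u x) (p x) * (g x)\<^sup>2 + (-2) * Q (-3/2) (p x) * g x + Q (-1/2) (p x) / u x" if "x \<in> {-1..1}" for x
  proof -
    define k where "k = sqrt (1 + (p x)\<^sup>2)"
    note Qk = Q_sqrt[of "p x", folded k_def]
    have u: "u x > 0" using D(5)[OF that] .
    have "(1 / (u x * k) - g x / k ^ 3)\<^sup>2 * u x * k = u x * (1 / k ^ 5) * (g x)\<^sup>2 + (-2) * (1 / k ^ 3) * g x + 1 / k / u x"
      using u Qk(6) by (simp add: field_simps power2_eq_square eval_nat_numeral)
    then show ?thesis
      unfolding Ja_def Qk(2,3,4) k_def[symmetric] using Qk(5) by (simp add: Q_def)
  qed
  have c1: "continuous_on {-1..1} (\<lambda>x. Ja (u x) (p x))" by (intro continuous_intros D)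
  have c2: "continuous_on {-1..1} (\<lambda>x. (-2) * Q (-3/2) (p x))" by (intro continuous_intros D)
  have c3: "continuous_on {-1..1} (\<lambda>x. Q (-1/2) (p x) / u x)"
    by (intro continuous_intros D) (metis D(5) less_irrefl)
  have W: "Willmore u = pi / 2 * integral {-1..1} (\<lambda>x. Ja (u x) (p x) * (g x)\<^sup>2 + (-2) * Q (-3/2) (p x) * g x + Q (-1/2) (p x) / u x)"
    unfolding Willmore_def p_def[symmetric] g_def[symmetric]
    by (subst LINT_quadratic_I01[OF c1 c2 c3 D(3) abs_contD(1)[OF D(2)]]) (use w in auto)
  have c4: "continuous_on {-1..1} (\<lambda>x. u x * Q (1/2) (p x))" by (intro continuous_intros D)
  have "(LINT x:I01|lborel. u x * sqrt (1 + (p x)\<^sup>2)) = integral {-1..1} (\<lambda>x. u x * Q (1/2) (p x))"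
    using set_integrable_lborel_imp(2)[OF set_integrable_continuous_I01[OF c4]] unfolding Q_sqrt(1) .
  then have A: "Area u = 2 * pi * integral {-1..1} (\<lambda>x. u x * Q (1/2) (p x))"
    unfolding Area_def p_def[symmetric] by simp
  have i1: "((\<lambda>x. Ja (u x) (p x) * (g x)\<^sup>2) has_integral integral {-1..1} (\<lambda>x. Ja (u x) (p x) * (g x)\<^sup>2)) {-1..1}"
    by (rule integrable_integral[OF integrable_on_Icc_sub(1)[OF profile_integrable(1)[OF P']]]) auto
  have i2: "((\<lambda>x. Q (-3/2) (p x) * g x) has_integral 0) {-1..1}"
    using abs_contD(3)[OF abs_cont_sine[OF D(2)]] unfolding D(7,13) by simp
  have i3: "((\<lambda>x. Q (-1/2) (p x) / u x) has_integral integral {-1..1} (\<lambda>x. Q (-1/2) (p x) / u x)) {-1..1}"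
    by (rule integrable_integral[OF integrable_continuous_real[OF c3]])
  have i4: "((\<lambda>x. u x * Q (1/2) (p x)) has_integral integral {-1..1} (\<lambda>x. u x * Q (1/2) (p x))) {-1..1}"
    by (rule integrable_integral[OF integrable_continuous_real[OF c4]])
  have "integral {-1..1} (\<lambda>x. Ja (u x) (p x) * (g x)\<^sup>2 + (-2) * (Q (-3/2) (p x) * g x) + Q (-1/2) (p x) / u x) =
      integral {-1..1} (\<lambda>x. Ja (u x) (p x) * (g x)\<^sup>2) + (-2) * 0 + integral {-1..1} (\<lambda>x. Q (-1/2) (p x) / u x)"
    by (rule integral_unique[OF has_integral_add[OF has_integral_add[OF i1 has_integral_mult_right[OF i2]] i3]])
  moreover have "integral {-1..1} (\<lambda>x. Ja (u x) (p x) * (g x)\<^sup>2 + (Q (-1/2) (p x) / u x + 4 * \<epsilon> * (u x * Q (1/2) (p x)))) =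
      integral {-1..1} (\<lambda>x. Ja (u x) (p x) * (g x)\<^sup>2) + (integral {-1..1} (\<lambda>x. Q (-1/2) (p x) / u x)
        + 4 * \<epsilon> * integral {-1..1} (\<lambda>x. u x * Q (1/2) (p x)))"
    by (rule integral_unique[OF has_integral_add[OF i1 has_integral_add[OF i3 has_integral_mult_right[OF i4]]]])
  ultimately show ?thesis
    unfolding Helfrich_def W A energy_def Jb_def p_def[symmetric] g_def[symmetric]
    by (simp add: algebra_simps)
qed

text \<open>Passing from \<open>d2 u\<close> to another representative changes the integrand only on
  a negligible set, so the reduced energy may be computed with any \<open>g\<close> that completes a
  profile.\<close>

lemma Helfrich_eq_energy:
  assumes P: "profile \<alpha> u p g"
  shows "Helfrich \<epsilon> u = pi / 2 * energy \<epsilon> u p g"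
proof -
  obtain N where N: "negligible N" "\<And>x. x \<in> {-1..1} - N \<Longrightarrow> d2 u x = g x" using profile_d1_d2(2)[OF P] by blast
  have "energy \<epsilon> u (d1 u) (d2 u) = energy \<epsilon> u p g"
    unfolding energy_def
    by (rule integral_spike[OF N(1)]) (use N(2) profile_d1_d2(1)[OF P] in simp)
  then show ?thesis using Helfrich_eq_energy_aux[OF N_set_profile[OF profile_N_set[OF P]]] by simp
qed

text \<open>With \<open>k = sqrt (1 + p\<^sup>2)\<close>, \<open>X = u g / k\<^sup>3\<close>, \<open>a = 1 / k\<close> and \<open>c = \<epsilon> / 4\<close> the difference of the two sides is
  \<open>(k / u) ((1 - c) (X \<plusminus> a)\<^sup>2 + c (X - a + 4 u)\<^sup>2) + 2 \<epsilon> p arctan p\<close>; the right-hand side is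
  \<open>2 \<epsilon>\<close> plus an exact derivative.\<close>

lemma calibration:
  assumes u: "u > 0" and eps: "0 \<le> \<epsilon>" "\<epsilon> \<le> 4" and lam: "lam = 0 \<or> lam = 1"
  shows "2 * \<epsilon> + (-2 * \<epsilon>) * (u * (inverse (1 + p\<^sup>2) * g) + arctan p * p) + (2 - lam * (4 - \<epsilon>)) * (Q (-3/2) p * g)
    \<le> Ja u p * g\<^sup>2 + Jb \<epsilon> u p"
proof -
  define k where "k = sqrt (1 + p\<^sup>2)"
  note Qk = Q_sqrt[of p, folded k_def]
  define X where "X = u * g / k ^ 3"
  define a where "a = 1 / k"
  define c where "c = \<epsilon> / 4"
  have k: "k > 0" by (rule Qk)
  have ka: "k * a = 1" using k by (simp add: a_def)
  have g: "g = X * k ^ 3 / u" using k u by (simp add: X_def)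
  have 1: "Ja u p * g\<^sup>2 = k / u * X\<^sup>2"
    using k u unfolding Ja_def Qk(4) g by (simp add: field_simps power2_eq_square eval_nat_numeral)
  have 2: "Jb \<epsilon> u p = k / u * a\<^sup>2 + k / u * (16 * c * u\<^sup>2)"
    using k u unfolding Jb_def Qk(1,2) a_def c_def by (simp add: field_simps power2_eq_square)
  have 3: "u * (inverse (1 + p\<^sup>2) * g) = k * X"
    using k u unfolding Qk(7)[symmetric] g by (simp add: field_simps power2_eq_square eval_nat_numeral)
  have 4: "Q (-3/2) p * g = k / u * (a * X)"
    using k u unfolding Qk(3) g a_def by (simp add: field_simps)
  have 5: "2 * \<epsilon> = k / u * (8 * c * u * a)" using ka u by (simp add: c_def field_simps)
  have 6: "\<epsilon> * (k * X) = k / u * (4 * c * u * X)" using u by (simp add: c_def field_simps)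
  have "arctan p * p \<ge> 0"
    by (cases "p \<ge> 0") (auto intro: mult_nonpos_nonpos mult_nonneg_nonneg simp: not_le less_imp_le)
  then have 7: "\<epsilon> * (arctan p * p) \<ge> 0" using eps by simp
  have "0 \<le> k / u * ((1 - c) * (X + (2 * lam - 1) * a)\<^sup>2 + c * (X - a + 4 * u)\<^sup>2)"
    using k u eps by (intro mult_nonneg_nonneg add_nonneg_nonneg) (auto simp: c_def)
  also have "(1 - c) * (X + (2 * lam - 1) * a)\<^sup>2 + c * (X - a + 4 * u)\<^sup>2 =
      X\<^sup>2 + a\<^sup>2 + 16 * c * u\<^sup>2 - 8 * c * u * a + 8 * c * u * X - (2 - lam * (4 - 4 * c)) * (a * X)"
    using lam by (auto simp: power2_eq_square algebra_simps)
  also have "k / u * \<dots> = k / u * X\<^sup>2 + k / u * a\<^sup>2 + k / u * (16 * c * u\<^sup>2) - k / u * (8 * c * u * a)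
       + 2 * (k / u * (4 * c * u * X)) - (2 - lam * (4 - 4 * c)) * (k / u * (a * X))"
    by (simp add: algebra_simps)
  also have "\<dots> = Ja u p * g\<^sup>2 + Jb \<epsilon> u p - 2 * \<epsilon> + 2 * (\<epsilon> * (k * X)) - (2 - lam * (4 - \<epsilon>)) * (Q (-3/2) p * g)"
    unfolding 1 2 4 5[symmetric] 6[symmetric] by (simp add: c_def)
  finally show ?thesis unfolding 3 using 7 by (simp add: algebra_simps)
qed

text \<open>For \<epsilon> = 0 the discarded square vanishes exactly when
  \<open>u * g = k\<^sup>2\<close> if \<open>lam = 0\<close>, the equation of catenaries, and when
  \<open>u * g = - k\<^sup>2\<close> if \<open>lam = 1\<close>, the equation of circular arcs
  centred on the axis. The choice of \<open>lam\<close> affects only the coefficient of the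
  \<open>p / k\<close> flux.\<close>

lemma calibration_integrated:
  assumes P: "profile \<alpha> u p g" and eps: "0 \<le> \<epsilon>" "\<epsilon> \<le> 4" and lam: "lam = 0 \<or> lam = 1"
    and ab: "-1 \<le> a" "a \<le> b" "b \<le> 1"
  shows "2 * \<epsilon> * (b - a) - 2 * \<epsilon> * (u b * arctan (p b) - u a * arctan (p a))
      + (2 - lam * (4 - \<epsilon>)) * (p b * Q (-1/2) (p b) - p a * Q (-1/2) (p a))
    \<le> integral {a..b} (\<lambda>x. Ja (u x) (p x) * (g x)\<^sup>2 + Jb \<epsilon> (u x) (p x))"
proof -
  note D = profileD[OF P]
  have "abs_cont (\<lambda>x. arctan (p x)) (\<lambda>x. inverse (1 + (p x)\<^sup>2) * g x)"
    by (rule abs_cont_compose[OF D(2) DERIV_arctan])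
       (intro continuous_intros, use one_plus_sq_pos in \<open>auto simp: less_imp_neq[symmetric]\<close>)
  from abs_contD(2)[OF abs_cont_mult[OF D(10) this] ab]
  have 1: "((\<lambda>x. u x * (inverse (1 + (p x)\<^sup>2) * g x) + arctan (p x) * p x) has_integral
      u b * arctan (p b) - u a * arctan (p a)) {a..b}" .
  note 2 = abs_contD(2)[OF abs_cont_sine[OF D(2)] ab]
  have 3: "((\<lambda>x. 2 * \<epsilon>) has_integral 2 * \<epsilon> * (b - a)) {a..b}"
    using has_integral_const_real[of "2 * \<epsilon>" a b] ab by (simp add: mult.commute)
  have 4: "((\<lambda>x. Ja (u x) (p x) * (g x)\<^sup>2 + Jb \<epsilon> (u x) (p x)) has_integral
      integral {a..b} (\<lambda>x. Ja (u x) (p x) * (g x)\<^sup>2 + Jb \<epsilon> (u x) (p x))) {a..b}"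
    by (rule integrable_integral[OF integrable_on_Icc_sub(1)[OF profile_integrable(3)[OF P]]]) (use ab in auto)
  have "2 * \<epsilon> * (b - a) + (-2 * \<epsilon>) * (u b * arctan (p b) - u a * arctan (p a))
      + (2 - lam * (4 - \<epsilon>)) * (p b * Q (-1/2) (p b) - p a * Q (-1/2) (p a))
      \<le> integral {a..b} (\<lambda>x. Ja (u x) (p x) * (g x)\<^sup>2 + Jb \<epsilon> (u x) (p x))"
  proof (rule has_integral_le[OF has_integral_add[OF has_integral_add[OF 3 has_integral_mult_right[OF 1]] has_integral_mult_right[OF 2]] 4])
    fix x assume "x \<in> {a..b}"
    then show "2 * \<epsilon> + (-2 * \<epsilon>) * (u x * (inverse (1 + (p x)\<^sup>2) * g x) + arctan (p x) * p x)
        + (2 - lam * (4 - \<epsilon>)) * (Q (-3/2) (p x) * g x) \<le> Ja (u x) (p x) * (g x)\<^sup>2 + Jb \<epsilon> (u x) (p x)"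
      using ab by (intro calibration eps lam D(5)) auto
  qed
  then show ?thesis by simp
qed

text \<open>The interval is cut at \<open>-y\<close> and \<open>y\<close>. If \<open>p y\<close> is
  nonnegative, \<open>lam = 0\<close> is used between the cuts and \<open>lam = 1\<close> outside;
  otherwise the roles are exchanged. The \<open>arctan\<close> fluxes telescope to 0 because
  \<open>p\<close> vanishes at the ends, and each cut contributes
  \<open>(4 - \<epsilon>) * \<bar>s\<bar>\<close> through the jump of the other coefficient.\<close>

lemma energy_slope_bound:
  assumes P: "profile \<alpha> u p g" and eps: "0 \<le> \<epsilon>" "\<epsilon> \<le> 4" and x: "x \<in> {-1..1}"
  shows "4 * \<epsilon> + 2 * (4 - \<epsilon>) * (\<bar>p x\<bar> * Q (-1/2) (p x)) \<le> energy \<epsilon> u p g"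
proof -
  note D = profileD[OF P]
  have sym: "Q e (- y) = Q e y" for e y by (simp add: Q_def)
  have main: "4 * \<epsilon> + 2 * (4 - \<epsilon>) * (\<bar>p y\<bar> * Q (-1/2) (p y)) \<le> energy \<epsilon> u p g" if y: "0 \<le> y" "y \<le> 1" for y
  proof -
    let ?f = "\<lambda>x. Ja (u x) (p x) * (g x)\<^sup>2 + Jb \<epsilon> (u x) (p x)"
    note I = integrable_on_Icc_sub(1)[OF profile_integrable(3)[OF P]]
    have "integral {-1..-y} ?f + integral {-y..1} ?f = integral {-1..1} ?f"
      by (rule Henstock_Kurzweil_Integration.integral_combine) (use y I in auto)
    moreover have "integral {-y..y} ?f + integral {y..1} ?f = integral {-y..1} ?f"
      by (rule Henstock_Kurzweil_Integration.integral_combine) (use y I in auto)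
    ultimately have E: "energy \<epsilon> u p g = integral {-1..-y} ?f + integral {-y..y} ?f + integral {y..1} ?f"
      by (simp add: energy_def)
    define s where "s = p y * Q (-1/2) (p y)"
    define t where "t = u y * arctan (p y)"
    have py: "p (-y) = - p y" using D(11)[of y] y by auto
    have sy: "p (- y) * Q (-1/2) (p (- y)) = - s" unfolding py sym s_def by simp
    have ty: "u (- y) * arctan (p (- y)) = - t" unfolding py t_def using D(4)[of y] y by (simp add: arctan_minus)
    note c = calibration_integrated[OF P eps]
    show ?thesis
    proof (cases "p y \<ge> 0")
      case True
      have "2 * \<epsilon> * (-y - (-1)) - 2 * \<epsilon> * (- t - 0) + (2 - (4 - \<epsilon>)) * (- s - 0) \<le> integral {-1..-y} ?f"
        using c[of 1 "-1" "-y"] y unfolding sy ty D(13) by simp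
      moreover have "2 * \<epsilon> * (y - (-y)) - 2 * \<epsilon> * (t - (- t)) + 2 * (s - (- s)) \<le> integral {-y..y} ?f"
        using c[of 0 "-y" y] y unfolding sy ty s_def[symmetric] t_def[symmetric] by simp
      moreover have "2 * \<epsilon> * (1 - y) - 2 * \<epsilon> * (0 - t) + (2 - (4 - \<epsilon>)) * (0 - s) \<le> integral {y..1} ?f"
        using c[of 1 y 1] y unfolding D(7) s_def[symmetric] t_def[symmetric] by simp
      ultimately have "4 * \<epsilon> + 2 * (4 - \<epsilon>) * s \<le> energy \<epsilon> u p g"
        unfolding E by (simp add: algebra_simps)
      then show ?thesis using True by (simp add: s_def)
    next
      case False
      have "2 * \<epsilon> * (-y - (-1)) - 2 * \<epsilon> * (- t - 0) + 2 * (- s - 0) \<le> integral {-1..-y} ?f"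
        using c[of 0 "-1" "-y"] y unfolding sy ty D(13) by simp
      moreover have "2 * \<epsilon> * (y - (-y)) - 2 * \<epsilon> * (t - (- t)) + (2 - (4 - \<epsilon>)) * (s - (- s)) \<le> integral {-y..y} ?f"
        using c[of 1 "-y" y] y unfolding sy ty s_def[symmetric] t_def[symmetric] by simp
      moreover have "2 * \<epsilon> * (1 - y) - 2 * \<epsilon> * (0 - t) + 2 * (0 - s) \<le> integral {y..1} ?f"
        using c[of 0 y 1] y unfolding D(7) s_def[symmetric] t_def[symmetric] by simp
      ultimately have "4 * \<epsilon> + 2 * (4 - \<epsilon>) * (- s) \<le> energy \<epsilon> u p g"
        unfolding E by (simp add: algebra_simps)
      then show ?thesis using False by (simp add: s_def)
    qed
  qed
  show ?thesis
  proof (cases "x \<ge> 0")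
    case True then show ?thesis using main[of x] x by simp
  next
    case False
    then have "4 * \<epsilon> + 2 * (4 - \<epsilon>) * (\<bar>p (- x)\<bar> * Q (-1/2) (p (- x))) \<le> energy \<epsilon> u p g" using main[of "-x"] x by simp
    then show ?thesis unfolding D(11)[OF x] sym by simp
  qed
qed

text \<open>For \<epsilon> < 4 the slope bound reads \<open>\<bar>p\<bar> / k \<le> (E0 - 4 *
  \<epsilon>) / (2 * (4 - \<epsilon>))\<close>, and the right-hand side is below 1 exactly when
  \<open>E0 < 2 * (4 + \<epsilon>)\<close>. Everything else follows from the bound on the slope,
  with constants independent of the profile.\<close>

lemma energy_bounds:
  assumes "\<alpha> > 0" "0 \<le> \<epsilon>" "\<epsilon> \<le> 4" "E0 < 2 * (4 + \<epsilon>)"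
  obtains M c C B where "M > 0" "c > 0"
    "\<And>u p g x. profile \<alpha> u p g \<Longrightarrow> energy \<epsilon> u p g \<le> E0 \<Longrightarrow> x \<in> {-1..1} \<Longrightarrow> \<bar>p x\<bar> \<le> M \<and> c \<le> u x \<and> u x \<le> C"
    "\<And>u p g. profile \<alpha> u p g \<Longrightarrow> energy \<epsilon> u p g \<le> E0 \<Longrightarrow> integral {-1..1} (\<lambda>x. (g x)\<^sup>2) \<le> B"
proof -
  \<comment> \<open>At \<epsilon> = 4 the quotient is 0 by division by zero, so \<open>s = 0\<close>
    there.\<close>
  define s where "s = max 0 ((E0 - 4 * \<epsilon>) / (2 * (4 - \<epsilon>)))"
  \<comment> \<open>From \<open>\<bar>p\<bar> \<le> s * k\<close> and
    \<open>k \<le> 1 + \<bar>p\<bar>\<close> comes \<open>\<bar>p\<bar> \<le> s / (1 - s)\<close>;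
    the summand 1 makes \<open>M\<close> positive.\<close>
  define M where "M = s / (1 - s) + 1"
  \<comment> \<open>The derivative of \<open>ln u\<close> is at most \<open>M / u\<close> in
    absolute value, and \<open>(1 + M) * E0\<close> bounds the integral of \<open>1 / u\<close>
    because \<open>k \<le> 1 + M\<close>.\<close>
  define c where "c = \<alpha> * exp (- (M * ((1 + M) * E0)))"
  define C where "C = \<alpha> + 2 * M"
  \<comment> \<open>The factor is the reciprocal of \<open>c / (1 + M) ^ 5\<close>, a lower bound
    for \<open>Ja\<close>.\<close>
  define B where "B = (1 + M) ^ 5 / c * E0"
  have s: "0 \<le> s" "s < 1"
  proof -
    show "0 \<le> s" by (simp add: s_def)
    have "(E0 - 4 * \<epsilon>) / (2 * (4 - \<epsilon>)) < 1"
    proof (cases "\<epsilon> = 4")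
      case False then show ?thesis using assms by (simp add: divide_less_eq)
    qed simp
    then show "s < 1" by (simp add: s_def)
  qed
  have M: "M > 0" using s by (simp add: M_def add_nonneg_pos)
  have c: "c > 0" using assms by (simp add: c_def)
  have bounds: "(\<forall>x\<in>{-1..1}. \<bar>p x\<bar> \<le> M \<and> c \<le> u x \<and> u x \<le> C) \<and> integral {-1..1} (\<lambda>x. (g x)\<^sup>2) \<le> B"
    if P: "profile \<alpha> u p g" and E: "energy \<epsilon> u p g \<le> E0" for u p g
  proof -
    note D = profileD[OF P]
    have eps: "\<epsilon> < 4"
      \<comment> \<open>At \<epsilon> = 4 the slope bound degenerates to
        \<open>16 \<le> energy\<close>, which contradicts \<open>E0 < 16\<close>.\<close>
      using energy_slope_bound[OF P assms(2,3), of 0] E assms(3,4) by (cases "\<epsilon> = 4") auto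
    have p: "\<bar>p x\<bar> \<le> M" if x: "x \<in> {-1..1}" for x
    proof -
      define k where "k = sqrt (1 + (p x)\<^sup>2)"
      note Qk = Q_sqrt[of "p x", folded k_def]
      have "2 * (4 - \<epsilon>) * (\<bar>p x\<bar> / k) \<le> E0 - 4 * \<epsilon>"
        using energy_slope_bound[OF P assms(2,3) x] E unfolding Qk by simp
      then have "\<bar>p x\<bar> / k \<le> s"
        using eps by (simp add: s_def le_max_iff_disj pos_le_divide_eq mult.commute)
      then have "\<bar>p x\<bar> \<le> s * k" using Qk(6) by (simp add: pos_divide_le_eq)
      also have "k \<le> 1 + \<bar>p x\<bar>"
        unfolding k_def by (rule real_le_lsqrt) (auto simp: power2_eq_square algebra_simps)
      then have "s * k \<le> s * (1 + \<bar>p x\<bar>)" using s by (intro mult_left_mono)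
      finally have "\<bar>p x\<bar> * (1 - s) \<le> s" by (simp add: algebra_simps)
      then have "\<bar>p x\<bar> \<le> s / (1 - s)" using s by (simp add: pos_le_divide_eq)
      then show ?thesis by (simp add: M_def)
    qed
    have k: "sqrt (1 + (p x)\<^sup>2) \<le> 1 + M" if x: "x \<in> {-1..1}" for x
    proof -
      have "(p x)\<^sup>2 \<le> M\<^sup>2" using p[OF x] M by (simp add: abs_le_square_iff[symmetric])
      then show ?thesis using M by (intro real_le_lsqrt) (auto simp: power2_eq_square algebra_simps)
    qed
    have nz: "u x \<noteq> 0" if "x \<in> {-1..1}" for x using D(5)[OF that] by simp
    have Iu: "(\<lambda>x. 1 / u x) integrable_on {a..b}" if "-1 \<le> a" "b \<le> 1" for a b
      by (rule integrable_continuous_real, rule continuous_on_subset[of "{-1..1}"])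
         (use that nz in \<open>auto intro!: continuous_intros D(8)\<close>)
    have Jn: "0 \<le> Ja (u x) (p x) * (g x)\<^sup>2" "Q (-1/2) (p x) / u x \<le> Jb \<epsilon> (u x) (p x)" "0 \<le> Jb \<epsilon> (u x) (p x)"
      if x: "x \<in> {-1..1}" for x
      using D(5)[OF x] assms(2) Q_pos[of _ "p x"] unfolding Ja_def Jb_def
      by (auto intro!: mult_nonneg_nonneg add_nonneg_nonneg simp: less_imp_le)
    have IJ: "(\<lambda>x. Ja (u x) (p x) * (g x)\<^sup>2 + Jb \<epsilon> (u x) (p x)) integrable_on {-1..1}"
      by (rule integrable_on_Icc_sub(1)[OF profile_integrable(3)[OF P]]) auto
    have int_u: "integral {-1..1} (\<lambda>x. 1 / u x) \<le> (1 + M) * E0"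
    proof -
      have "integral {-1..1} (\<lambda>x. 1 / u x) \<le> integral {-1..1} (\<lambda>x. (1 + M) * (Ja (u x) (p x) * (g x)\<^sup>2 + Jb \<epsilon> (u x) (p x)))"
      proof (rule integral_le)
        show "(\<lambda>x. 1 / u x) integrable_on {-1..1}" by (rule Iu) auto
        show "(\<lambda>x. (1 + M) * (Ja (u x) (p x) * (g x)\<^sup>2 + Jb \<epsilon> (u x) (p x))) integrable_on {-1..1}"
          using integrable_on_cmult_left[OF IJ, of "1 + M"] by simp
        fix x :: real assume x: "x \<in> {-1..1}"
        note Qk = Q_sqrt[of "p x"]
        have "1 / u x \<le> (1 + M) * (Q (-1/2) (p x) / u x)"
          using k[OF x] D(5)[OF x] Qk(6) unfolding Qk(2) by (simp add: field_simps)
        also have "\<dots> \<le> (1 + M) * (Ja (u x) (p x) * (g x)\<^sup>2 + Jb \<epsilon> (u x) (p x))"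
          using Jn[OF x] M by (intro mult_left_mono) auto
        finally show "1 / u x \<le> (1 + M) * (Ja (u x) (p x) * (g x)\<^sup>2 + Jb \<epsilon> (u x) (p x))" .
      qed
      also have "\<dots> = (1 + M) * energy \<epsilon> u p g" by (simp add: energy_def)
      also have "\<dots> \<le> (1 + M) * E0" using E M by (intro mult_left_mono) auto
      finally show ?thesis .
    qed
    have ul: "c \<le> u x" if x: "x \<in> {-1..1}" for x
    proof -
      have "((\<lambda>y. p y / u y) has_integral ln (u 1) - ln (u x)) {x..1}"
      proof (rule fundamental_theorem_of_calculus)
        fix y assume "y \<in> {x..1}"
        then have y: "y \<in> {-1..1}" using x by auto
        have "((\<lambda>y. ln (u y)) has_real_derivative p y / u y) (at y within {-1..1})"
          using D(1)[OF y] D(5)[OF y] by (auto intro!: derivative_eq_intros)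
        then have "((\<lambda>y. ln (u y)) has_real_derivative p y / u y) (at y within {x..1})"
          by (rule DERIV_subset) (use x in auto)
        then show "((\<lambda>y. ln (u y)) has_vector_derivative p y / u y) (at y within {x..1})"
          unfolding has_real_derivative_iff_has_vector_derivative .
      qed (use x in auto)
      note h = this
      have "ln (u 1) - ln (u x) \<le> integral {x..1} (\<lambda>y. M * (1 / u y))"
      proof (rule has_integral_le[OF h integrable_integral])
        show "(\<lambda>y. M * (1 / u y)) integrable_on {x..1}"
          using integrable_on_cmult_left[OF Iu[of x 1], of M] x by simp
        fix y assume "y \<in> {x..1}"
        then have y: "y \<in> {-1..1}" using x by auto
        have "p y \<le> M" using p[OF y] by simp
        then show "p y / u y \<le> M * (1 / u y)" using D(5)[OF y] by (simp add: divide_right_mono)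
      qed
      also have "\<dots> = M * integral {x..1} (\<lambda>y. 1 / u y)" by (rule integral_mult_right)
      also have "\<dots> \<le> M * integral {-1..1} (\<lambda>y. 1 / u y)"
      proof (rule mult_left_mono)
        show "integral {x..1} (\<lambda>y. 1 / u y) \<le> integral {-1..1} (\<lambda>y. 1 / u y)"
        proof (rule integral_subset_le)
          show "{x..1} \<subseteq> {-1..1}" using x by auto
          show "(\<lambda>y. 1 / u y) integrable_on {x..1}" by (rule Iu) (use x in auto)
          show "(\<lambda>y. 1 / u y) integrable_on {-1..1}" by (rule Iu) auto
          show "\<forall>y\<in>{-1..1}. 0 \<le> 1 / u y"
          proof
            fix y :: real assume "y \<in> {-1..1}"
            from D(5)[OF this] show "0 \<le> 1 / u y" by simp
          qed
        qed
      qed (use M in simp)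
      also have "\<dots> \<le> M * ((1 + M) * E0)" using int_u M by (intro mult_left_mono) auto
      finally have "ln \<alpha> - M * ((1 + M) * E0) \<le> ln (u x)" unfolding D(6) by simp
      then have "exp (ln \<alpha> - M * ((1 + M) * E0)) \<le> u x"
        using D(5)[OF x] by (simp add: ln_ge_iff)
      then show ?thesis using assms(1) by (simp add: c_def exp_diff exp_minus divide_inverse)
    qed
    have uu: "u x \<le> C" if x: "x \<in> {-1..1}" for x
    proof -
      have h1: "(p has_integral u 1 - u x) {x..1}" by (rule abs_contD(2)[OF D(10)]) (use x in auto)
      have h2: "((\<lambda>y. - M) has_integral (1 - x) * (- M)) {x..1}"
        using has_integral_const_real[of "-M" x 1] x by simp
      have "(1 - x) * (- M) \<le> u 1 - u x"
      proof (rule has_integral_le[OF h2 h1])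
        fix y assume "y \<in> {x..1}"
        then have "\<bar>p y\<bar> \<le> M" using x by (intro p) auto
        then show "- M \<le> p y" by simp
      qed
      moreover have "(1 - x) * M \<le> 2 * M" using x M by (intro mult_right_mono) auto
      ultimately show ?thesis unfolding D(6) C_def by simp
    qed
    have "integral {-1..1} (\<lambda>x. (g x)\<^sup>2) \<le> integral {-1..1} (\<lambda>x. (1 + M) ^ 5 / c * (Ja (u x) (p x) * (g x)\<^sup>2 + Jb \<epsilon> (u x) (p x)))"
    proof (rule integral_le)
      show "(\<lambda>x. (g x)\<^sup>2) integrable_on {-1..1}" by (rule integrable_on_Icc_sub(1)[OF D(15)]) auto
      show "(\<lambda>x. (1 + M) ^ 5 / c * (Ja (u x) (p x) * (g x)\<^sup>2 + Jb \<epsilon> (u x) (p x))) integrable_on {-1..1}"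
        using integrable_on_cmult_left[OF IJ, of "(1 + M) ^ 5 / c"] by simp
      fix x :: real assume x: "x \<in> {-1..1}"
      define k where "k = sqrt (1 + (p x)\<^sup>2)"
      note Qk = Q_sqrt[of "p x", folded k_def]
      have k5: "k ^ 5 \<le> (1 + M) ^ 5" using k[OF x] Qk(6) by (intro power_mono) (auto simp: k_def)
      have "c * k ^ 5 \<le> u x * (1 + M) ^ 5" using ul[OF x] k5 Qk(6) c M by (intro mult_mono) auto
      then have "1 \<le> (1 + M) ^ 5 / c * (u x * (1 / k ^ 5))" using c Qk(6) by (simp add: field_simps)
      then have "1 * (g x)\<^sup>2 \<le> ((1 + M) ^ 5 / c * (u x * (1 / k ^ 5))) * (g x)\<^sup>2"
        by (intro mult_right_mono) auto
      then have "(g x)\<^sup>2 \<le> (1 + M) ^ 5 / c * (Ja (u x) (p x) * (g x)\<^sup>2)"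
        unfolding Ja_def Qk(4) by (simp add: mult.assoc)
      also have "\<dots> \<le> (1 + M) ^ 5 / c * (Ja (u x) (p x) * (g x)\<^sup>2 + Jb \<epsilon> (u x) (p x))"
        using Jn[OF x] M c by (intro mult_left_mono) auto
      finally show "(g x)\<^sup>2 \<le> (1 + M) ^ 5 / c * (Ja (u x) (p x) * (g x)\<^sup>2 + Jb \<epsilon> (u x) (p x))" .
    qed
    also have "\<dots> = (1 + M) ^ 5 / c * energy \<epsilon> u p g" by (simp add: energy_def)
    also have "\<dots> \<le> B" unfolding B_def using E M c by (intro mult_left_mono) auto
    finally show ?thesis using p ul uu by blast
  qed
  show ?thesis by (rule that[OF M c]) (use bounds in blast)+
qed

section \<open>Limits of square integrable functions\<close>

text \<open>The series of absolute increments is integrable, which gives convergence almost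
  everywhere and, together with the first term, a dominating function. Dominated convergence then
  yields the limits of the integrals over every measurable set, in particular over
  intervals.\<close>

lemma L1_fast_Cauchy_limit:
  fixes F :: "nat \<Rightarrow> 'a \<Rightarrow> real"
  assumes F: "\<And>k. integrable M (F k)" and fast: "\<And>k. (\<integral>x. \<bar>F (Suc k) x - F k x\<bar> \<partial>M) \<le> 2 * (1/2) ^ k"
  obtains G where "integrable M G" "AE x in M. (\<lambda>k. F k x) \<longlonglongrightarrow> G x"
    "\<And>A. A \<in> sets M \<Longrightarrow> (\<lambda>k. \<integral>x. indicator A x * F k x \<partial>M) \<longlonglongrightarrow> (\<integral>x. indicator A x * G x \<partial>M)"
proof -
  have Fm[measurable]: "F k \<in> borel_measurable M" for k using F by (rule borel_measurable_integrable)
  define H where "H k x = F (Suc k) x - F k x" for k x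
  have H: "integrable M (H k)" for k unfolding H_def using F by (intro Bochner_Integration.integrable_diff)
  have Hm[measurable]: "H k \<in> borel_measurable M" for k using H by (rule borel_measurable_integrable)
  have Hn: "integrable M (\<lambda>x. \<bar>H k x\<bar>)" for k using H by (rule integrable_abs)
  have sm: "summable (\<lambda>k. 2 * (1/2) ^ k :: real)" by (intro summable_mult summable_geometric) simp
  have "(\<integral>\<^sup>+x. (\<Sum>k. ennreal \<bar>H k x\<bar>) \<partial>M) = (\<Sum>k. \<integral>\<^sup>+x. ennreal \<bar>H k x\<bar> \<partial>M)"
    by (rule nn_integral_suminf) measurable
  also have "\<dots> \<le> (\<Sum>k. ennreal (2 * (1/2) ^ k))"
  proof (rule suminf_le)
    fix k
    have "(\<integral>\<^sup>+x. ennreal \<bar>H k x\<bar> \<partial>M) = ennreal (\<integral>x. \<bar>H k x\<bar> \<partial>M)"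
      by (rule nn_integral_eq_integral[OF Hn]) simp
    also have "\<dots> \<le> ennreal (2 * (1/2) ^ k)" using fast[of k] unfolding H_def by (rule ennreal_leI)
    finally show "(\<integral>\<^sup>+x. ennreal \<bar>H k x\<bar> \<partial>M) \<le> ennreal (2 * (1/2) ^ k)" .
  qed auto
  also have "\<dots> = ennreal (\<Sum>k. 2 * (1/2) ^ k)" by (rule suminf_ennreal2[OF _ sm]) simp
  finally have fin: "(\<integral>\<^sup>+x. (\<Sum>k. ennreal \<bar>H k x\<bar>) \<partial>M) < \<infinity>" by (simp add: le_less_trans)
  then have "AE x in M. (\<Sum>k. ennreal \<bar>H k x\<bar>) \<noteq> \<infinity>"
    by (intro nn_integral_PInf_AE) auto
  then have sumH: "AE x in M. summable (\<lambda>k. \<bar>H k x\<bar>)"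
    by eventually_elim (rule summable_suminf_not_top, auto)
  have sI: "summable (\<lambda>k. \<integral>x. norm \<bar>H k x\<bar> \<partial>M)"
    by (rule summable_comparison_test'[OF sm, of 0]) (use fast in \<open>simp add: H_def\<close>)
  have iw: "integrable M (\<lambda>x. \<Sum>k. \<bar>H k x\<bar>)"
    by (rule integrable_suminf[OF Hn _ sI]) (use sumH in simp)
  define w where "w x = \<bar>F 0 x\<bar> + (\<Sum>k. \<bar>H k x\<bar>)" for x
  have w: "integrable M w" unfolding w_def by (intro Bochner_Integration.integrable_add integrable_abs F iw)
  define G where "G x = lim (\<lambda>k. F k x)" for x
  have Gm[measurable]: "G \<in> borel_measurable M" unfolding G_def by (rule borel_measurable_lim_metric) simp
  have tel: "F n x = F 0 x + (\<Sum>k<n. H k x)" for n x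
    by (induction n) (auto simp: H_def)
  have lim: "AE x in M. (\<lambda>k. F k x) \<longlonglongrightarrow> G x"
    using sumH
  proof eventually_elim
    case (elim x)
    then have "summable (\<lambda>k. H k x)" by (rule summable_rabs_cancel)
    then have "(\<lambda>n. F 0 x + (\<Sum>k<n. H k x)) \<longlonglongrightarrow> F 0 x + (\<Sum>k. H k x)"
      by (intro tendsto_intros summable_LIMSEQ)
    then have "(\<lambda>n. F n x) \<longlonglongrightarrow> F 0 x + (\<Sum>k. H k x)" unfolding tel[symmetric] .
    then show ?case unfolding G_def by (metis limI)
  qed
  have bd: "AE x in M. norm (F n x) \<le> w x" for n
    using sumH
  proof eventually_elim
    case (elim x)
    have "\<bar>F n x\<bar> \<le> \<bar>F 0 x\<bar> + (\<Sum>k<n. \<bar>H k x\<bar>)"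
      unfolding tel[of n] using sum_abs[of "\<lambda>k. H k x" "{..<n}"] by linarith
    also have "(\<Sum>k<n. \<bar>H k x\<bar>) \<le> (\<Sum>k. \<bar>H k x\<bar>)" by (rule sum_le_suminf[OF elim]) auto
    finally show ?case by (simp add: w_def)
  qed
  have iG: "integrable M G"
    by (rule integrable_dominated_convergence[OF Gm Fm w lim bd])
  have "(\<lambda>k. \<integral>x. indicator A x * F k x \<partial>M) \<longlonglongrightarrow> (\<integral>x. indicator A x * G x \<partial>M)" if [measurable]: "A \<in> sets M" for A
  proof (rule integral_dominated_convergence[OF _ _ w])
    show "AE x in M. (\<lambda>k. indicator A x * F k x) \<longlonglongrightarrow> indicator A x * G x"
      using lim by eventually_elim (intro tendsto_intros)
    show "AE x in M. norm (indicator A x * F k x) \<le> w x" for k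
      using bd[of k] by eventually_elim (auto simp: indicator_def intro: order_trans[OF norm_ge_zero])
  qed measurable
  then show ?thesis using iG lim by (intro that[of G]) auto
qed

text \<open>Fatou for nonnegative integrals gives the estimate; the finite real bound is what brings
  integrability of the limit, and with it a statement about real integrals.\<close>

lemma Fatou_real:
  fixes F :: "nat \<Rightarrow> 'a \<Rightarrow> real"
  assumes F: "\<And>k. integrable M (F k)" "\<And>k x. 0 \<le> F k x" and G: "G \<in> borel_measurable M"
    and lim: "AE x in M. (\<lambda>k. F k x) \<longlonglongrightarrow> G x" and b: "\<And>k. (\<integral>x. F k x \<partial>M) \<le> b"
  shows "integrable M G" "(\<integral>x. G x \<partial>M) \<le> b"
proof -
  note [measurable] = G borel_measurable_integrable[OF F(1)]
  have nn: "AE x in M. 0 \<le> G x"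
    using lim by eventually_elim (rule LIMSEQ_le_const, auto simp: F(2))
  have "0 \<le> (\<integral>x. F 0 x \<partial>M)" by (rule Bochner_Integration.integral_nonneg) (rule F(2))
  then have b0: "0 \<le> b" using b[of 0] by linarith
  have "(\<integral>\<^sup>+x. ennreal (G x) \<partial>M) = (\<integral>\<^sup>+x. liminf (\<lambda>k. ennreal (F k x)) \<partial>M)"
  proof (rule nn_integral_cong_AE)
    show "AE x in M. ennreal (G x) = liminf (\<lambda>k. ennreal (F k x))"
      using lim by eventually_elim (metis lim_imp_Liminf sequentially_bot tendsto_ennrealI)
  qed
  also have "\<dots> \<le> liminf (\<lambda>k. \<integral>\<^sup>+x. ennreal (F k x) \<partial>M)"
    by (rule nn_integral_liminf) measurable
  also have "\<dots> \<le> ennreal b"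
  proof -
    have "(\<integral>\<^sup>+x. ennreal (F k x) \<partial>M) \<le> ennreal b" for k
      using nn_integral_eq_integral[OF F(1)[of k]] F(2) b[of k] by (simp add: ennreal_leI)
    then show ?thesis by (intro Liminf_le) (auto simp: always_eventually)
  qed
  finally have le: "(\<integral>\<^sup>+x. ennreal (G x) \<partial>M) \<le> ennreal b" .
  show iG: "integrable M G"
    using le by (intro integrableI_nonneg[OF G nn]) (metis ennreal_less_top infinity_ennreal_def le_less_trans)
  have "ennreal (\<integral>x. G x \<partial>M) \<le> ennreal b" using le nn_integral_eq_integral[OF iG nn] by simp
  then show "(\<integral>x. G x \<partial>M) \<le> b" using b0 by (simp add: ennreal_le_iff)
qed

lemma L2_on_lin:
  assumes "L2_on f" "L2_on g"
  shows "L2_on (\<lambda>x. a * f x + b * g x)"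
proof -
  note mf = assms[unfolded L2_on_def]
  have c: "set_borel_measurable lborel I01 (\<lambda>x. c)" for c :: real
    by (rule set_borel_measurable_continuous_I01) (rule continuous_on_const)
  have m: "set_borel_measurable lborel I01 (\<lambda>x. a * f x + b * g x)"
    by (intro set_borel_measurable_add_I01 set_borel_measurable_mult_I01 c conjunct1[OF mf(1)] conjunct1[OF mf(2)])
  have "set_integrable lborel I01 (\<lambda>x. (a * f x + b * g x)\<^sup>2)"
  proof -
    have i: "set_integrable lborel I01 (\<lambda>x. 2 * a\<^sup>2 * (f x)\<^sup>2 + 2 * b\<^sup>2 * (g x)\<^sup>2)"
      by (intro set_integral_add(1) set_integrable_continuous_mult_I01 continuous_on_const
          conjunct2[OF mf(1)] conjunct2[OF mf(2)])
    have m2: "set_borel_measurable lborel I01 (\<lambda>x. (a * f x + b * g x)\<^sup>2)"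
      unfolding power2_eq_square by (rule set_borel_measurable_mult_I01[OF m m])
    have le: "(a * f x + b * g x)\<^sup>2 \<le> 2 * a\<^sup>2 * (f x)\<^sup>2 + 2 * b\<^sup>2 * (g x)\<^sup>2" for x
      using sum_squares_bound[of "a * f x" "b * g x"] by (simp add: power2_sum power_mult_distrib)
    show ?thesis
      unfolding set_integrable_def
    proof (rule Bochner_Integration.integrable_bound[OF i[unfolded set_integrable_def]])
      show "(\<lambda>x. indicator I01 x *\<^sub>R (a * f x + b * g x)\<^sup>2) \<in> borel_measurable lborel"
        using m2 unfolding set_borel_measurable_def .
      show "AE x in lborel. norm (indicator I01 x *\<^sub>R (a * f x + b * g x)\<^sup>2)
          \<le> norm (indicator I01 x *\<^sub>R (2 * a\<^sup>2 * (f x)\<^sup>2 + 2 * b\<^sup>2 * (g x)\<^sup>2))"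
        using le by (intro AE_I2) (auto simp: indicator_def intro: order_trans[OF le abs_ge_self])
    qed
  qed
  then show ?thesis using m by (simp add: L2_on_def)
qed

lemma abs_cont_lin2:
  assumes "abs_cont p g" "abs_cont q h"
  shows "abs_cont (\<lambda>x. a * p x + b * q x) (\<lambda>x. a * g x + b * h x)"
proof -
  have "abs_cont (\<lambda>x. 0) (\<lambda>x. 0)"
    by (rule abs_cont_C1) (auto intro: derivative_eq_intros)
  from abs_cont_lin[OF abs_cont_lin[OF this assms(1), of a] assms(2), of b] show ?thesis by simp
qed

lemma L2_on_sq_absolutely_integrable: "L2_on f \<Longrightarrow> (\<lambda>x. (f x)\<^sup>2) absolutely_integrable_on {-1..1}"
  by (rule set_integrable_lborel_imp(1)) (simp add: L2_on_def)

text \<open>An almost everywhere limit of a subsequence and convergence of integrals over intervals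
  suffice for what follows; square integrability of the limit comes later from Fatou. The passage to
  L1 uses \<open>2 * \<bar>d\<bar> \<le> 2 ^ k * d\<^sup>2 + (1/2) ^ k\<close> in place of
  Cauchy-Schwarz.\<close>

lemma L2_Cauchy_limit:
  assumes L2: "\<And>k. L2_on (g k)" and ai: "\<And>k. g k absolutely_integrable_on {-1..1}"
    and Cauchy: "\<And>e. e > 0 \<Longrightarrow> \<exists>N. \<forall>k\<ge>N. \<forall>l\<ge>N. integral {-1..1} (\<lambda>x. (g k x - g l x)\<^sup>2) \<le> e"
  obtains h r where "strict_mono (r :: nat \<Rightarrow> nat)" "set_integrable lborel I01 h"
    "AE x in lborel. x \<in> I01 \<longrightarrow> (\<lambda>k. g (r k) x) \<longlonglongrightarrow> h x"
    "\<And>a b. -1 \<le> a \<Longrightarrow> a \<le> b \<Longrightarrow> b \<le> 1 \<Longrightarrow> (\<lambda>k. integral {a..b} (g (r k))) \<longlonglongrightarrow> integral {a..b} h"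
proof -
  have "\<exists>N. \<forall>j. \<forall>k\<ge>N j. \<forall>l\<ge>N j. integral {-1..1} (\<lambda>x. (g k x - g l x)\<^sup>2) \<le> (1/4) ^ j"
    by (rule choice) (intro allI Cauchy, simp)
  then obtain N where N: "\<And>j k l. k \<ge> N j \<Longrightarrow> l \<ge> N j \<Longrightarrow> integral {-1..1} (\<lambda>x. (g k x - g l x)\<^sup>2) \<le> (1/4) ^ j"
    by blast
  \<comment> \<open>The partial sums dominate each \<open>N k\<close>, and the summand
    \<open>k\<close> makes the subsequence strictly increasing.\<close>
  define r where "r k = (\<Sum>i\<le>k. N i) + k" for k
  have r: "strict_mono r" unfolding strict_mono_Suc_iff r_def by simp
  have rN: "r k \<ge> N k" "r (Suc k) \<ge> N k" for k
  proof -
    have "N k \<le> (\<Sum>i\<le>k. N i)" by (rule member_le_sum) auto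
    then show "r k \<ge> N k" "r (Suc k) \<ge> N k" unfolding r_def by auto
  qed
  have si: "set_integrable lborel I01 (g k)" for k
    using L2 by (intro set_integrable_lborelI[OF _ ai]) (simp add: L2_on_def)
  define F where "F k x = indicator I01 x *\<^sub>R g (r k) x" for k x
  have F: "integrable lborel (F k)" for k using si unfolding F_def set_integrable_def .
  have fast: "(\<integral>x. \<bar>F (Suc k) x - F k x\<bar> \<partial>lborel) \<le> 2 * (1/2) ^ k" for k
  proof -
    define d where "d x = g (r (Suc k)) x - g (r k) x" for x
    have sd: "set_integrable lborel I01 d" unfolding d_def by (intro set_integral_diff(1) si)
    have "L2_on d" using L2_on_lin[OF L2[of "r (Suc k)"] L2[of "r k"], of 1 "-1"] by (simp add: d_def[abs_def])
    then have d2: "(\<lambda>x. (d x)\<^sup>2) absolutely_integrable_on {-1..1}" by (rule L2_on_sq_absolutely_integrable)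
    have h1: "((\<lambda>x. (d x)\<^sup>2) has_integral integral {-1..1} (\<lambda>x. (d x)\<^sup>2)) {-1..1}"
      by (rule integrable_integral[OF integrable_on_Icc_sub(1)[OF d2]]) auto
    have h2: "((\<lambda>x::real. (1/2) ^ k / 2) has_integral (1 - (-1)) * ((1/2) ^ k / 2 :: real)) {-1..1}"
      using has_integral_const_real[of "(1/2) ^ k / 2 :: real" "-1" 1] by simp
    note h12 = has_integral_add[OF has_integral_mult_right[OF h1, of "2 ^ k / 2"] h2]
    have "(\<integral>x. \<bar>F (Suc k) x - F k x\<bar> \<partial>lborel) = (LINT x:I01|lborel. \<bar>d x\<bar>)"
      unfolding set_lebesgue_integral_def F_def d_def
      by (intro Bochner_Integration.integral_cong) (auto simp: indicator_def)
    also have "\<dots> = integral {-1..1} (\<lambda>x. \<bar>d x\<bar>)"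
      by (rule set_integrable_lborel_imp(2)[OF set_integrable_abs[OF sd]])
    also have "\<dots> \<le> integral {-1..1} (\<lambda>x. 2 ^ k / 2 * (d x)\<^sup>2 + (1/2) ^ k / 2)"
    proof (rule integral_le)
      show "(\<lambda>x. \<bar>d x\<bar>) integrable_on {-1..1}"
        by (rule integrable_on_Icc_sub(2)[OF set_integrable_lborel_imp(1)[OF sd]]) auto
      show "(\<lambda>x. 2 ^ k / 2 * (d x)\<^sup>2 + (1/2) ^ k / 2) integrable_on {-1..1}"
        by (rule has_integral_integrable[OF h12])
      fix x :: real
      have "0 \<le> (2 ^ k * \<bar>d x\<bar> - 1)\<^sup>2" by simp
      then have "2 * (2 ^ k * \<bar>d x\<bar>) \<le> 2 ^ k * (2 ^ k * (d x)\<^sup>2) + 1"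
        by (simp add: power2_eq_square algebra_simps)
      then show "\<bar>d x\<bar> \<le> 2 ^ k / 2 * (d x)\<^sup>2 + (1/2) ^ k / 2"
        by (simp add: field_simps power_divide)
    qed
    also have "\<dots> = 2 ^ k / 2 * integral {-1..1} (\<lambda>x. (d x)\<^sup>2) + (1/2) ^ k"
      using integral_unique[OF h12] by simp
    \<comment> \<open>The rate \<open>(1/4) ^ k\<close> for squares is chosen so that the weight
      \<open>2 ^ k\<close> still leaves a multiple of \<open>(1/2) ^ k\<close>; the total is
      \<open>3/2 * (1/2) ^ k\<close>.\<close>
    also have "\<dots> \<le> 2 ^ k / 2 * (1/4) ^ k + (1/2) ^ k"
      using N[OF rN(2,1), of k] unfolding d_def by (intro add_right_mono mult_left_mono) auto
    also have "(2::real) ^ k / 2 * (1/4) ^ k = (1/2) ^ k / 2"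
      by (simp add: power_mult_distrib[symmetric])
    finally show ?thesis using zero_le_power[of "1/2::real" k] by linarith
  qed
  obtain G where G: "integrable lborel G" "AE x in lborel. (\<lambda>k. F k x) \<longlonglongrightarrow> G x"
    "\<And>A. A \<in> sets lborel \<Longrightarrow> (\<lambda>k. \<integral>x. indicator A x * F k x \<partial>lborel) \<longlonglongrightarrow> (\<integral>x. indicator A x * G x \<partial>lborel)"
    by (rule L1_fast_Cauchy_limit[OF F fast]) (rule that)
  have sG: "set_integrable lborel I01 G"
    unfolding set_integrable_def using G(1) by (intro integrable_mult_indicator) auto
  have ae: "AE x in lborel. x \<in> I01 \<longrightarrow> (\<lambda>k. g (r k) x) \<longlonglongrightarrow> G x"
    using G(2) by eventually_elim (auto simp: F_def)
  have "(\<lambda>k. integral {a..b} (g (r k))) \<longlonglongrightarrow> integral {a..b} G" if ab: "-1 \<le> a" "a \<le> b" "b \<le> 1" for a b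
  proof -
    have sub: "{a<..<b} \<subseteq> I01" using ab by auto
    have 1: "(\<integral>x. indicator {a<..<b} x * F k x \<partial>lborel) = integral {a..b} (g (r k))" for k
    proof -
      have "set_integrable lborel {a<..<b} (g (r k))"
        by (rule set_integrable_subset[OF si _ sub]) simp
      from set_borel_integral_eq_integral(2)[OF this]
      have "(LINT x:{a<..<b}|lborel. g (r k) x) = integral {a..b} (g (r k))" unfolding integral_open_interval_real .
      moreover have "(\<integral>x. indicator {a<..<b} x * F k x \<partial>lborel) = (LINT x:{a<..<b}|lborel. g (r k) x)"
        unfolding set_lebesgue_integral_def F_def using sub
        by (intro Bochner_Integration.integral_cong) (auto simp: indicator_def)
      ultimately show ?thesis by simp
    qed
    have 2: "(\<integral>x. indicator {a<..<b} x * G x \<partial>lborel) = integral {a..b} G"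
    proof -
      have "set_integrable lborel {a<..<b} G"
        by (rule set_integrable_subset[OF sG _ sub]) simp
      from set_borel_integral_eq_integral(2)[OF this]
      show ?thesis unfolding integral_open_interval_real set_lebesgue_integral_def by simp
    qed
    show ?thesis using G(3)[of "{a<..<b}"] unfolding 1 2 by simp
  qed
  with r sG ae show ?thesis by (rule that)
qed

text \<open>Weight 1 shows that the limit is square integrable; the weight
  \<open>Ja (u x) (p x)\<close> gives lower semicontinuity of the leading part of the
  energy.\<close>

lemma Fatou_weighted:
  assumes w: "continuous_on {-1..1} w" "\<And>x. x \<in> {-1..1} \<Longrightarrow> 0 \<le> w x" and L2: "\<And>k. L2_on (g k)"
    and h: "set_borel_measurable lborel I01 h" and lim: "AE x in lborel. x \<in> I01 \<longrightarrow> (\<lambda>k. g k x) \<longlonglongrightarrow> h x"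
    and b: "\<And>k. integral {-1..1} (\<lambda>x. w x * (g k x)\<^sup>2) \<le> b"
  shows "set_integrable lborel I01 (\<lambda>x. w x * (h x)\<^sup>2)" "integral {-1..1} (\<lambda>x. w x * (h x)\<^sup>2) \<le> b"
proof -
  have s: "set_integrable lborel I01 (\<lambda>x. w x * (g k x)\<^sup>2)" for k
    using L2 by (intro set_integrable_continuous_mult_I01 w) (simp add: L2_on_def)
  have m: "set_borel_measurable lborel I01 (\<lambda>x. w x * (h x)\<^sup>2)"
    unfolding power2_eq_square
    by (intro set_borel_measurable_mult_I01 h set_borel_measurable_continuous_I01 w)
  have lim': "AE x in lborel. (\<lambda>k. indicator I01 x *\<^sub>R (w x * (g k x)\<^sup>2)) \<longlonglongrightarrow> indicator I01 x *\<^sub>R (w x * (h x)\<^sup>2)"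
    using lim
  proof eventually_elim
    case (elim x)
    show ?case
    proof (cases "x \<in> I01")
      case True
      then have "(\<lambda>k. w x * (g k x)\<^sup>2) \<longlonglongrightarrow> w x * (h x)\<^sup>2" using elim by (intro tendsto_intros) auto
      then show ?thesis using True by simp
    qed simp
  qed
  have b': "(\<integral>x. indicator I01 x *\<^sub>R (w x * (g k x)\<^sup>2) \<partial>lborel) \<le> b" for k
    using b[of k] set_integrable_lborel_imp(2)[OF s[of k]] unfolding set_lebesgue_integral_def by simp
  have nn: "0 \<le> indicator I01 x *\<^sub>R (w x * (g k x)\<^sup>2)" for k x
    using w(2)[of x] by (auto simp: indicator_def)
  note F = Fatou_real[of lborel "\<lambda>k x. indicator I01 x *\<^sub>R (w x * (g k x)\<^sup>2)", OF s[unfolded set_integrable_def] nn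
      m[unfolded set_borel_measurable_def] lim' b']
  show si: "set_integrable lborel I01 (\<lambda>x. w x * (h x)\<^sup>2)" unfolding set_integrable_def by (rule F(1))
  show "integral {-1..1} (\<lambda>x. w x * (h x)\<^sup>2) \<le> b"
    using F(2) unfolding set_integrable_lborel_imp(2)[OF si, symmetric] set_lebesgue_integral_def .
qed

section \<open>Existence of a minimiser\<close>

lemma profile_midpoint:
  assumes "profile \<alpha> u p g" "profile \<alpha> v q h"
  shows "profile \<alpha> (\<lambda>x. 1/2 * u x + 1/2 * v x) (\<lambda>x. 1/2 * p x + 1/2 * q x) (\<lambda>x. 1/2 * g x + 1/2 * h x)"
proof -
  note D = profileD[OF assms(1)] and D' = profileD[OF assms(2)]
  show ?thesis
    unfolding profile_def
  proof (intro conjI ballI)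
    show "abs_cont (\<lambda>x. 1/2 * p x + 1/2 * q x) (\<lambda>x. 1/2 * g x + 1/2 * h x)" by (rule abs_cont_lin2[OF D(2) D'(2)])
    show "L2_on (\<lambda>x. 1/2 * g x + 1/2 * h x)" by (rule L2_on_lin[OF D(3) D'(3)])
    show "1/2 * u 1 + 1/2 * v 1 = \<alpha>" "1/2 * p 1 + 1/2 * q 1 = 0" using D(6,7) D'(6,7) by auto
    fix x :: real assume x: "x \<in> {-1..1}"
    show "((\<lambda>x. 1/2 * u x + 1/2 * v x) has_real_derivative 1/2 * p x + 1/2 * q x) (at x within {-1..1})"
      by (intro DERIV_add DERIV_cmult D(1) D'(1) x)
    show "1/2 * u (- x) + 1/2 * v (- x) = 1/2 * u x + 1/2 * v x" using D(4)[OF x] D'(4)[OF x] by simp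
    show "0 < 1/2 * u x + 1/2 * v x" using D(5)[OF x] D'(5)[OF x] by simp
  qed
qed

text \<open>Young's inequality \<open>\<bar>g\<bar> \<le> l * g\<^sup>2 + 1 / (4 * l)\<close> stands
  in for Cauchy-Schwarz: \<open>l\<close> is taken small for the first term, then
  \<open>y - x\<close> small for the second, uniformly in the profile.\<close>

lemma profile_equicontinuous:
  assumes P: "profile \<alpha> u p g" and B: "integral {-1..1} (\<lambda>x. (g x)\<^sup>2) \<le> B" and l: "l > 0"
    and xy: "-1 \<le> x" "x \<le> y" "y \<le> 1"
  shows "\<bar>p y - p x\<bar> \<le> l * B + (y - x) / (4 * l)"
proof -
  note D = profileD[OF P]
  note I = integrable_on_Icc_sub(1)[OF D(15)]
  note h = abs_contD(2)[OF D(2) xy]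
  have h1: "((\<lambda>t. (g t)\<^sup>2) has_integral integral {x..y} (\<lambda>t. (g t)\<^sup>2)) {x..y}"
    by (rule integrable_integral[OF I]) (use xy in auto)
  have h2: "((\<lambda>t. 1 / (4 * l)) has_integral (y - x) * (1 / (4 * l))) {x..y}"
    using has_integral_const_real[of "1 / (4 * l)" x y] xy by simp
  note h12 = has_integral_add[OF has_integral_mult_right[OF h1, of l] h2]
  have "norm (integral {x..y} g) \<le> integral {x..y} (\<lambda>t. l * (g t)\<^sup>2 + 1 / (4 * l))"
  proof (rule integral_norm_bound_integral[OF has_integral_integrable[OF h] has_integral_integrable[OF h12]])
    fix t assume "t \<in> {x..y}"
    have "0 \<le> (2 * l * \<bar>g t\<bar> - 1)\<^sup>2" by simp
    then have "4 * l * \<bar>g t\<bar> \<le> 4 * l * (l * (g t)\<^sup>2) + 1" by (simp add: power2_eq_square algebra_simps)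
    then show "norm (g t) \<le> l * (g t)\<^sup>2 + 1 / (4 * l)" using l by (simp add: field_simps)
  qed
  then have "\<bar>p y - p x\<bar> \<le> l * integral {x..y} (\<lambda>t. (g t)\<^sup>2) + (y - x) * (1 / (4 * l))"
    unfolding integral_unique[OF h] integral_unique[OF h12] by simp
  moreover have "integral {x..y} (\<lambda>t. (g t)\<^sup>2) \<le> integral {-1..1} (\<lambda>t. (g t)\<^sup>2)"
    by (rule integral_subset_le) (use xy in \<open>auto intro!: I\<close>)
  then have "l * integral {x..y} (\<lambda>t. (g t)\<^sup>2) \<le> l * B" using B l by (intro mult_left_mono) auto
  ultimately show ?thesis by simp
qed

section \<open>Freezing the coefficients of the energy\<close>

lemma density_uniformly_continuous:
  assumes c: "c > 0" and e: "e > 0"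
  obtains d where "d > 0" "\<And>u u' p p'. u \<in> {c..C} \<Longrightarrow> u' \<in> {c..C} \<Longrightarrow> p \<in> {-M..M} \<Longrightarrow> p' \<in> {-M..M} \<Longrightarrow>
     \<bar>u - u'\<bar> < d \<Longrightarrow> \<bar>p - p'\<bar> < d \<Longrightarrow> \<bar>Ja u p - Ja u' p'\<bar> \<le> e \<and> \<bar>Jb \<epsilon> u p - Jb \<epsilon> u' p'\<bar> \<le> e"
proof -
  define K where "K = {c..C} \<times> {-M..M}"
  have K: "compact K" unfolding K_def by (intro compact_Times compact_Icc)
  have 1: "continuous_on K (\<lambda>z. Ja (fst z) (snd z))" by (intro continuous_intros)
  have 2: "continuous_on K (\<lambda>z. Jb \<epsilon> (fst z) (snd z))"
    by (intro continuous_intros) (use c in \<open>auto simp: K_def\<close>)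
  obtain d1 where d1: "d1 > 0" "\<And>z z'. z \<in> K \<Longrightarrow> z' \<in> K \<Longrightarrow> dist z' z < d1 \<Longrightarrow> dist (Ja (fst z') (snd z')) (Ja (fst z) (snd z)) < e"
    using compact_uniformly_continuous[OF 1 K] e unfolding uniformly_continuous_on_def by metis
  obtain d2 where d2: "d2 > 0" "\<And>z z'. z \<in> K \<Longrightarrow> z' \<in> K \<Longrightarrow> dist z' z < d2 \<Longrightarrow> dist (Jb \<epsilon> (fst z') (snd z')) (Jb \<epsilon> (fst z) (snd z)) < e"
    using compact_uniformly_continuous[OF 2 K] e unfolding uniformly_continuous_on_def by metis
  show ?thesis
  proof (rule that[of "min d1 d2 / 2"])
    fix u u' p p' assume *: "u \<in> {c..C}" "u' \<in> {c..C}" "p \<in> {-M..M}" "p' \<in> {-M..M}"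
      "\<bar>u - u'\<bar> < min d1 d2 / 2" "\<bar>p - p'\<bar> < min d1 d2 / 2"
    have "dist (u, p) (u', p') \<le> \<bar>u - u'\<bar> + \<bar>p - p'\<bar>"
      unfolding dist_Pair_Pair dist_real_def using sqrt_sum_squares_le_sum_abs[of "u - u'" "p - p'"] by simp
    then have "dist (u, p) (u', p') < d1" "dist (u, p) (u', p') < d2" using * by auto
    moreover have "(u, p) \<in> K" "(u', p') \<in> K" using * by (auto simp: K_def)
    ultimately show "\<bar>Ja u p - Ja u' p'\<bar> \<le> e \<and> \<bar>Jb \<epsilon> u p - Jb \<epsilon> u' p'\<bar> \<le> e"
      using d1(2)[of "(u', p')" "(u, p)"] d2(2)[of "(u', p')" "(u, p)"] by (simp add: dist_real_def)
  qed (use d1 d2 in auto)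
qed

text \<open>The coefficients are frozen at fixed functions \<open>A\<close> and \<open>b\<close>,
  with an error that is uniform over profiles whose \<open>g\<^sup>2\<close> has integral at most
  \<open>B\<close>. The 2 in \<open>B + 2\<close> is the length of the interval.\<close>

lemma energy_perturbation:
  assumes P: "profile \<alpha> u p g" and A: "continuous_on {-1..1} A" and b: "continuous_on {-1..1} b"
    and near: "\<And>x. x \<in> {-1..1} \<Longrightarrow> \<bar>Ja (u x) (p x) - A x\<bar> \<le> e \<and> \<bar>Jb \<epsilon> (u x) (p x) - b x\<bar> \<le> e"
    and B: "integral {-1..1} (\<lambda>x. (g x)\<^sup>2) \<le> B" and e: "e \<ge> 0"
  shows "\<bar>energy \<epsilon> u p g - (integral {-1..1} (\<lambda>x. A x * (g x)\<^sup>2) + integral {-1..1} b)\<bar> \<le> e * (B + 2)"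
proof -
  note D = profileD[OF P]
  have h1: "((\<lambda>x. Ja (u x) (p x) * (g x)\<^sup>2 + Jb \<epsilon> (u x) (p x)) has_integral energy \<epsilon> u p g) {-1..1}"
    unfolding energy_def
    by (rule integrable_integral[OF integrable_on_Icc_sub(1)[OF profile_integrable(3)[OF P]]]) auto
  have h2: "((\<lambda>x. A x * (g x)\<^sup>2) has_integral integral {-1..1} (\<lambda>x. A x * (g x)\<^sup>2)) {-1..1}"
    by (rule integrable_integral[OF integrable_on_Icc_sub(1)[OF absolutely_integrable_continuous_mult[OF A D(15)]]]) auto
  have h3: "(b has_integral integral {-1..1} b) {-1..1}"
    by (rule integrable_integral[OF integrable_continuous_real[OF b]])
  have h4: "((\<lambda>x. (g x)\<^sup>2) has_integral integral {-1..1} (\<lambda>x. (g x)\<^sup>2)) {-1..1}"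
    by (rule integrable_integral[OF integrable_on_Icc_sub(1)[OF D(15)]]) auto
  have h5: "((\<lambda>x::real. e) has_integral (1 - (-1)) * e) {-1..1}"
    using has_integral_const_real[of e "-1" 1] by simp
  note H = has_integral_diff[OF h1 has_integral_add[OF h2 h3]]
  note H' = has_integral_add[OF has_integral_mult_right[OF h4, of e] h5]
  have "norm (integral {-1..1} (\<lambda>x. Ja (u x) (p x) * (g x)\<^sup>2 + Jb \<epsilon> (u x) (p x) - (A x * (g x)\<^sup>2 + b x)))
      \<le> integral {-1..1} (\<lambda>x. e * (g x)\<^sup>2 + e)"
  proof (rule integral_norm_bound_integral[OF has_integral_integrable[OF H] has_integral_integrable[OF H']])
    fix x :: real assume x: "x \<in> {-1..1}"
    have "\<bar>(Ja (u x) (p x) - A x) * (g x)\<^sup>2\<bar> \<le> e * (g x)\<^sup>2"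
      using near[OF x] by (simp add: abs_mult mult_right_mono)
    then have "\<bar>(Ja (u x) (p x) - A x) * (g x)\<^sup>2 + (Jb \<epsilon> (u x) (p x) - b x)\<bar> \<le> e * (g x)\<^sup>2 + e"
      using near[OF x] by linarith
    then show "norm (Ja (u x) (p x) * (g x)\<^sup>2 + Jb \<epsilon> (u x) (p x) - (A x * (g x)\<^sup>2 + b x)) \<le> e * (g x)\<^sup>2 + e"
      by (simp add: algebra_simps)
  qed
  then have "\<bar>energy \<epsilon> u p g - (integral {-1..1} (\<lambda>x. A x * (g x)\<^sup>2) + integral {-1..1} b)\<bar>
      \<le> e * integral {-1..1} (\<lambda>x. (g x)\<^sup>2) + 2 * e"
    unfolding integral_unique[OF H] integral_unique[OF H'] by simp
  also have "\<dots> \<le> e * B + 2 * e" using B e by (intro add_right_mono mult_left_mono)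
  finally show ?thesis by (simp add: algebra_simps)
qed

lemma energy_nonneg:
  assumes P: "profile \<alpha> u p g" and "0 \<le> \<epsilon>"
  shows "0 \<le> energy \<epsilon> u p g"
  unfolding energy_def
proof (rule integral_nonneg)
  show "(\<lambda>x. Ja (u x) (p x) * (g x)\<^sup>2 + Jb \<epsilon> (u x) (p x)) integrable_on {-1..1}"
    by (rule integrable_on_Icc_sub(1)[OF profile_integrable(3)[OF P]]) auto
  fix x :: real assume x: "x \<in> {-1..1}"
  show "0 \<le> Ja (u x) (p x) * (g x)\<^sup>2 + Jb \<epsilon> (u x) (p x)"
    using profileD(5)[OF P x] assms(2) Q_pos[of _ "p x"] unfolding Ja_def Jb_def
    by (auto intro!: mult_nonneg_nonneg add_nonneg_nonneg divide_nonneg_nonneg simp: less_imp_le)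
qed

lemma quadratic_midpoint_identity:
  assumes A: "continuous_on {-1..1} A" and g: "L2_on g" and h: "L2_on h"
  shows "integral {-1..1} (\<lambda>x. A x * (g x - h x)\<^sup>2) = 2 * integral {-1..1} (\<lambda>x. A x * (g x)\<^sup>2)
     + 2 * integral {-1..1} (\<lambda>x. A x * (h x)\<^sup>2) - 4 * integral {-1..1} (\<lambda>x. A x * (1/2 * g x + 1/2 * h x)\<^sup>2)"
proof -
  have i: "((\<lambda>x. A x * (f x)\<^sup>2) has_integral integral {-1..1} (\<lambda>x. A x * (f x)\<^sup>2)) {-1..1}" if "L2_on f" for f
    by (rule integrable_integral[OF integrable_on_Icc_sub(1)[OF
        absolutely_integrable_continuous_mult[OF A L2_on_sq_absolutely_integrable[OF that]]]]) auto
  note H = has_integral_diff[OF has_integral_add[OF has_integral_mult_right[OF i[OF g], of 2]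
      has_integral_mult_right[OF i[OF h], of 2]] has_integral_mult_right[OF i[OF L2_on_lin[OF g h, of "1/2" "1/2"]], of 4]]
  have "(\<lambda>x. A x * (g x - h x)\<^sup>2) = (\<lambda>x. 2 * (A x * (g x)\<^sup>2) + 2 * (A x * (h x)\<^sup>2) - 4 * (A x * (1/2 * g x + 1/2 * h x)\<^sup>2))"
    by (rule ext) (simp add: power2_eq_square algebra_simps)
  then show ?thesis using integral_unique[OF H] by (simp only:)
qed

text \<open>\<open>Ja\<close> and \<open>Jb\<close> move with \<open>u\<close> and \<open>p\<close>,
  so the parallelogram identity does not apply to the energy directly. Uniform convergence permits
  freezing both at the limit; then \<open>a (G k)\<close> hardly exceeds \<open>I - \<beta>\<close>,
  while midpoints, being profiles themselves, cannot fall noticeably below that value. Hence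
  \<open>G k - G l\<close> is small.\<close>

lemma energy_minimizer_exists:
  assumes par: "\<alpha> > 0" "0 \<le> \<epsilon>" "\<epsilon> \<le> 4" and v: "profile \<alpha> v pv gv" and Ev: "energy \<epsilon> v pv gv < 2 * (4 + \<epsilon>)"
  obtains u p g where "profile \<alpha> u p g" "\<And>w q h. profile \<alpha> w q h \<Longrightarrow> energy \<epsilon> u p g \<le> energy \<epsilon> w q h"
proof -
  define E0 where "E0 = energy \<epsilon> v pv gv"
  define S where "S = {E. \<exists>u p g. profile \<alpha> u p g \<and> E = energy \<epsilon> u p g}"
  define I where "I = Inf S"
  have bdd: "bdd_below S" unfolding S_def using energy_nonneg[OF _ par(2)] by (intro bdd_belowI[of _ 0]) blast
  have I_le: "I \<le> energy \<epsilon> u p g" if "profile \<alpha> u p g" for u p g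
    unfolding I_def using that by (intro cInf_lower[OF _ bdd]) (auto simp: S_def)
  have ne: "S \<noteq> {}" using v by (auto simp: S_def)
  have "\<forall>k. \<exists>T. (case T of (u, p, g) \<Rightarrow> profile \<alpha> u p g \<and> energy \<epsilon> u p g \<le> E0 \<and> energy \<epsilon> u p g < I + 1 / real (Suc k))"
  proof
    fix k :: nat
    have "Inf S < I + 1 / real (Suc k)" by (simp add: I_def)
    from cInf_lessD[OF ne this] obtain u p g where *: "profile \<alpha> u p g" "energy \<epsilon> u p g < I + 1 / real (Suc k)"
      by (auto simp: S_def)
    show "\<exists>T. (case T of (u, p, g) \<Rightarrow> profile \<alpha> u p g \<and> energy \<epsilon> u p g \<le> E0 \<and> energy \<epsilon> u p g < I + 1 / real (Suc k))"
    \<comment> \<open>If the near-minimiser has energy above \<open>E0\<close>, then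
      \<open>v\<close> lies below it and is a near-minimiser as well; so the a priori bounds apply
      along the whole sequence.\<close>
    proof (cases "energy \<epsilon> u p g \<le> E0")
      case True then show ?thesis using * by (intro exI[of _ "(u, p, g)"]) simp
    next
      case False then show ?thesis using * v by (intro exI[of _ "(v, pv, gv)"]) (simp add: E0_def)
    qed
  qed
  then obtain T where T: "\<And>k. case T k of (u, p, g) \<Rightarrow> profile \<alpha> u p g \<and> energy \<epsilon> u p g \<le> E0 \<and> energy \<epsilon> u p g < I + 1 / real (Suc k)"
    using choice[of "\<lambda>k T. case T of (u, p, g) \<Rightarrow> profile \<alpha> u p g \<and> energy \<epsilon> u p g \<le> E0 \<and> energy \<epsilon> u p g < I + 1 / real (Suc k)"] by blast
  define U0 where "U0 k = fst (T k)" for k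
  define P0 where "P0 k = fst (snd (T k))" for k
  define G0 where "G0 k = snd (snd (T k))" for k
  have T0: "profile \<alpha> (U0 k) (P0 k) (G0 k)" "energy \<epsilon> (U0 k) (P0 k) (G0 k) \<le> E0"
    "energy \<epsilon> (U0 k) (P0 k) (G0 k) < I + 1 / real (Suc k)" for k
    using T[of k] by (simp_all add: U0_def P0_def G0_def split: prod.splits)
  obtain M c C B where bd: "M > 0" "c > 0"
    "\<And>u p g x. profile \<alpha> u p g \<Longrightarrow> energy \<epsilon> u p g \<le> E0 \<Longrightarrow> x \<in> {-1..1} \<Longrightarrow> \<bar>p x\<bar> \<le> M \<and> c \<le> u x \<and> u x \<le> C"
    "\<And>u p g. profile \<alpha> u p g \<Longrightarrow> energy \<epsilon> u p g \<le> E0 \<Longrightarrow> integral {-1..1} (\<lambda>x. (g x)\<^sup>2) \<le> B"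
    by (rule energy_bounds[OF par Ev[folded E0_def]]) (rule that)
  have B0: "0 \<le> B"
  proof -
    have "0 \<le> integral {-1..1} (\<lambda>x. (G0 0 x)\<^sup>2)"
      by (rule integral_nonneg[OF integrable_on_Icc_sub(1)[OF profileD(15)[OF T0(1)]]]) auto
    then show ?thesis using bd(4)[OF T0(1,2)[of 0]] by linarith
  qed
  have equi: "\<exists>d. 0 < d \<and> (\<forall>n y. y \<in> {-1..1} \<and> norm (x - y) < d \<longrightarrow> norm (P0 n x - P0 n y) < e)"
    if x: "x \<in> {-1..1}" and e: "0 < e" for x e
  proof -
    \<comment> \<open>This \<open>l\<close> makes \<open>l * B\<close> at most \<open>e / 4\<close>,
      and \<open>b - a < l * e\<close> does the same for the second term; \<open>B + 1\<close>
      avoids a zero denominator.\<close>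
    define l where "l = e / (4 * (B + 1))"
    have l: "l > 0" using e B0 by (simp add: l_def)
    have lB: "l * B \<le> e / 4"
    proof -
      have "l * B \<le> l * (B + 1)" using l by (intro mult_left_mono) auto
      also have "\<dots> = e / 4" using B0 by (simp add: l_def field_simps)
      finally show ?thesis .
    qed
    have main: "\<bar>P0 n b - P0 n a\<bar> < e" if "-1 \<le> a" "a \<le> b" "b \<le> 1" "b - a < l * e" for a b n
    proof -
      have "\<bar>P0 n b - P0 n a\<bar> \<le> l * B + (b - a) / (4 * l)"
        by (rule profile_equicontinuous[OF T0(1) bd(4)[OF T0(1,2)] l that(1-3)])
      moreover have "(b - a) / (4 * l) \<le> e / 4" using that(4) l by (simp add: field_simps)
      ultimately show ?thesis using lB e by linarith
    qed
    have "norm (P0 n x - P0 n y) < e" if y: "y \<in> {-1..1}" "norm (x - y) < l * e" for n y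
    proof (cases "x \<le> y")
      case True
      then show ?thesis using main[of x y n] x y by (simp add: abs_minus_commute)
    next
      case False
      then show ?thesis using main[of y x n] x y by simp
    qed
    then show ?thesis using l e by (intro exI[of _ "l * e"]) auto
  qed
  have PM: "norm (P0 n x) \<le> M" if "x \<in> {-1..1}" for n x
    using bd(3)[OF T0(1,2) that] by simp
  obtain p r where p: "continuous_on {-1..1} p" and r: "strict_mono (r :: nat \<Rightarrow> nat)"
    and conv: "\<And>e. 0 < e \<Longrightarrow> \<exists>N. \<forall>n x. n \<ge> N \<and> x \<in> {-1..1} \<longrightarrow> norm (P0 (r n) x - p x) < e"
    by (rule Arzela_Ascoli[of "{-1..1::real}" P0 M, OF compact_Icc PM equi]) (assumption | rule that)+
  define U where "U n = U0 (r n)" for n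
  define P where "P n = P0 (r n)" for n
  define G where "G n = G0 (r n)" for n
  have T: "profile \<alpha> (U n) (P n) (G n)" "energy \<epsilon> (U n) (P n) (G n) \<le> E0"
    "energy \<epsilon> (U n) (P n) (G n) < I + 1 / real (Suc n)" for n
  proof -
    show "profile \<alpha> (U n) (P n) (G n)" "energy \<epsilon> (U n) (P n) (G n) \<le> E0"
      unfolding U_def P_def G_def by (rule T0)+
    have "energy \<epsilon> (U n) (P n) (G n) < I + 1 / real (Suc (r n))"
      unfolding U_def P_def G_def by (rule T0)
    also have "1 / real (Suc (r n)) \<le> 1 / real (Suc n)"
      using seq_suble[OF r, of n] by (intro divide_left_mono) auto
    finally show "energy \<epsilon> (U n) (P n) (G n) < I + 1 / real (Suc n)" by simp
  qed
  note D = profileD[OF T(1)]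
  have box: "\<bar>P n x\<bar> \<le> M" "c \<le> U n x" "U n x \<le> C" if "x \<in> {-1..1}" for n x
    using bd(3)[OF T(1,2) that] by auto
  \<comment> \<open>Compactness is applied to the slopes only; the profile is recovered by
    integrating from -1, where every \<open>U n\<close> has the value \<alpha>.\<close>
  define u where "u x = \<alpha> + integral {-1..x} p" for x
  have ac_u: "abs_cont u p"
    unfolding u_def by (rule abs_cont_indefinite_integral[OF absolutely_integrable_continuous_real[OF p]])
  have du: "(u has_real_derivative p x) (at x within {-1..1})" if "x \<in> {-1..1}" for x
    by (rule abs_cont_continuous_imp_C1[OF ac_u p that])
  have um1: "u (-1) = \<alpha>" by (simp add: u_def)
  have unif: "\<exists>N. \<forall>n\<ge>N. \<forall>x\<in>{-1..1}. \<bar>P n x - p x\<bar> < e \<and> \<bar>U n x - u x\<bar> < e" if e: "e > 0" for e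
  proof -
    obtain N where N: "\<And>n x. n \<ge> N \<Longrightarrow> x \<in> {-1..1} \<Longrightarrow> \<bar>P n x - p x\<bar> < e / 4"
      using conv[of "e / 4"] e unfolding P_def by auto
    have "\<bar>P n x - p x\<bar> < e \<and> \<bar>U n x - u x\<bar> < e" if n: "n \<ge> N" and x: "x \<in> {-1..1}" for n x
    proof
      show "\<bar>P n x - p x\<bar> < e" using N[OF n x] e by linarith
      have x': "-1 \<le> x" "x \<le> 1" using x by auto
      have H: "((\<lambda>t. P n t - p t) has_integral (U n x - U n (-1)) - (u x - u (-1))) {-1..x}"
        by (intro has_integral_diff abs_contD(2)[OF D(10)] abs_contD(2)[OF ac_u] x' order_refl)
      have H': "((\<lambda>t. e / 4) has_integral (x - (-1)) * (e / 4)) {-1..x}"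
        using has_integral_const_real[of "e / 4" "-1" x] x' by simp
      have "norm (integral {-1..x} (\<lambda>t. P n t - p t)) \<le> integral {-1..x} (\<lambda>t. e / 4)"
      proof (rule integral_norm_bound_integral[OF has_integral_integrable[OF H] has_integral_integrable[OF H']])
        fix t assume "t \<in> {-1..x}"
        then have "t \<in> {-1..1}" using x' by auto
        from N[OF n this] show "norm (P n t - p t) \<le> e / 4" by simp
      qed
      then have "\<bar>U n x - u x\<bar> \<le> (x + 1) * (e / 4)"
        unfolding integral_unique[OF H] integral_unique[OF H'] um1 D(12) by simp
      also have "\<dots> \<le> 2 * (e / 4)" using x' e by (intro mult_right_mono) auto
      finally show "\<bar>U n x - u x\<bar> < e" using e by linarith
    qed
    then show ?thesis by blast
  qed
  have limP: "(\<lambda>n. P n x) \<longlonglongrightarrow> p x" and limU: "(\<lambda>n. U n x) \<longlonglongrightarrow> u x" if x: "x \<in> {-1..1}" for x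
    using unif x unfolding lim_sequentially dist_real_def by meson+
  have up: "c \<le> u x" "u x \<le> C" "\<bar>p x\<bar> \<le> M" if x: "x \<in> {-1..1}" for x
  proof -
    show "c \<le> u x" by (rule LIMSEQ_le_const[OF limU[OF x]]) (use box[OF x] in blast)
    show "u x \<le> C" by (rule LIMSEQ_le_const2[OF limU[OF x]]) (use box[OF x] in blast)
    show "\<bar>p x\<bar> \<le> M" by (rule LIMSEQ_le_const2[OF tendsto_rabs[OF limP[OF x]]]) (use box[OF x] in blast)
  qed
  have even: "u (- x) = u x" if x: "x \<in> {-1..1}" for x
  proof (rule LIMSEQ_unique)
    show "(\<lambda>n. U n x) \<longlonglongrightarrow> u x" by (rule limU[OF x])
    have "- x \<in> {-1..1}" using x by auto
    from limU[OF this] show "(\<lambda>n. U n x) \<longlonglongrightarrow> u (- x)" unfolding D(4)[OF x] .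
  qed
  have u1: "u 1 = \<alpha>" using even[of 1] um1 by simp
  have p1: "p 1 = 0" using limP[of 1] D(7) by (simp add: LIMSEQ_const_iff)
  define A where "A x = Ja (u x) (p x)" for x
  define b where "b x = Jb \<epsilon> (u x) (p x)" for x
  have cu: "continuous_on {-1..1} u" by (rule abs_cont_continuous[OF ac_u])
  have upos: "u x > 0" if "x \<in> {-1..1}" for x using up(1)[OF that] bd(2) by linarith
  have cA: "continuous_on {-1..1} A" unfolding A_def by (intro continuous_intros cu p)
  have cb: "continuous_on {-1..1} b" unfolding b_def by (intro continuous_intros cu p upos)
  have Apos: "A x > 0" if "x \<in> {-1..1}" for x
    unfolding A_def Ja_def using upos[OF that] Q_pos by simp
  obtain a0 where a0: "a0 > 0" "\<And>x. x \<in> {-1..1} \<Longrightarrow> a0 \<le> A x"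
  proof -
    obtain z where "z \<in> {-1..1}" "\<forall>y\<in>{-1..1}. A z \<le> A y"
      using continuous_attains_inf[OF compact_Icc _ cA] by auto
    then show ?thesis using Apos that by blast
  qed
  define \<beta> where "\<beta> = integral {-1..1} b"
  define a where "a h = integral {-1..1} (\<lambda>x. A x * (h x)\<^sup>2)" for h :: "real \<Rightarrow> real"
  have gB: "integral {-1..1} (\<lambda>x. (G n x)\<^sup>2) \<le> B" for n by (rule bd(4)[OF T(1,2)])
  \<comment> \<open>Freezing costs \<open>e * (B + 2)\<close>, and near-minimality adds one more
    \<open>e\<close> in the upper bound; the lower bound combines the same cost with the fact that
    the midpoint has energy at least \<open>I\<close>.\<close>
  have close: "\<exists>N. \<forall>k\<ge>N. \<forall>l\<ge>N. a (G k) \<le> I - \<beta> + e * (B + 3) \<and>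
      I - \<beta> - e * (B + 2) \<le> a (\<lambda>x. 1/2 * G k x + 1/2 * G l x)" if e: "e > 0" for e
  proof -
    obtain d where d: "d > 0" "\<And>u u' p p'. u \<in> {c..C} \<Longrightarrow> u' \<in> {c..C} \<Longrightarrow> p \<in> {-M..M} \<Longrightarrow> p' \<in> {-M..M} \<Longrightarrow>
       \<bar>u - u'\<bar> < d \<Longrightarrow> \<bar>p - p'\<bar> < d \<Longrightarrow> \<bar>Ja u p - Ja u' p'\<bar> \<le> e \<and> \<bar>Jb \<epsilon> u p - Jb \<epsilon> u' p'\<bar> \<le> e"
      by (rule density_uniformly_continuous[OF bd(2) e, of C M \<epsilon>]) (rule that)
    obtain N1 where N1: "\<And>n x. n \<ge> N1 \<Longrightarrow> x \<in> {-1..1} \<Longrightarrow> \<bar>P n x - p x\<bar> < d \<and> \<bar>U n x - u x\<bar> < d"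
      using unif[OF d(1)] by blast
    obtain N2 where N2: "1 / real (Suc N2) < e"
      using reals_Archimedean[OF e] by (auto simp: inverse_eq_divide)
    define N where "N = max N1 N2"
    have pert: "\<bar>energy \<epsilon> w q h - (a h + \<beta>)\<bar> \<le> e * (B + 2)"
      if "profile \<alpha> w q h" "integral {-1..1} (\<lambda>x. (h x)\<^sup>2) \<le> B"
        "\<And>x. x \<in> {-1..1} \<Longrightarrow> w x \<in> {c..C} \<and> q x \<in> {-M..M} \<and> \<bar>w x - u x\<bar> < d \<and> \<bar>q x - p x\<bar> < d" for w q h
      unfolding a_def \<beta>_def
    proof (rule energy_perturbation[OF that(1) cA cb _ that(2)])
      fix x :: real assume x: "x \<in> {-1..1}"
      have "u x \<in> {c..C}" "p x \<in> {-M..M}" using up[OF x] by auto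
      then show "\<bar>Ja (w x) (q x) - A x\<bar> \<le> e \<and> \<bar>Jb \<epsilon> (w x) (q x) - b x\<bar> \<le> e"
        unfolding A_def b_def using that(3)[OF x] by (intro d(2)) auto
    qed (use e in simp)
    have "a (G k) \<le> I - \<beta> + e * (B + 3) \<and> I - \<beta> - e * (B + 2) \<le> a (\<lambda>x. 1/2 * G k x + 1/2 * G l x)"
      if k: "k \<ge> N" and l: "l \<ge> N" for k l
    proof
      have kl: "k \<ge> N1" "l \<ge> N1" "k \<ge> N2" using k l by (auto simp: N_def)
      have bx: "U n x \<in> {c..C} \<and> P n x \<in> {-M..M}" if "x \<in> {-1..1}" for n x
        using box[OF that, of n] by (simp add: abs_le_iff)
      have "\<bar>energy \<epsilon> (U k) (P k) (G k) - (a (G k) + \<beta>)\<bar> \<le> e * (B + 2)"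
        by (rule pert[OF T(1) gB]) (use bx N1[OF kl(1)] in blast)
      moreover have "1 / real (Suc k) \<le> 1 / real (Suc N2)" using kl(3) by (intro divide_left_mono) auto
      then have "energy \<epsilon> (U k) (P k) (G k) < I + e" using T(3)[of k] N2 by linarith
      ultimately show "a (G k) \<le> I - \<beta> + e * (B + 3)" by (simp add: algebra_simps)
      have mid: "profile \<alpha> (\<lambda>x. 1/2 * U k x + 1/2 * U l x) (\<lambda>x. 1/2 * P k x + 1/2 * P l x) (\<lambda>x. 1/2 * G k x + 1/2 * G l x)"
        by (rule profile_midpoint[OF T(1) T(1)])
      have "integral {-1..1} (\<lambda>x. (1/2 * G k x + 1/2 * G l x)\<^sup>2) \<le> B"
      proof -
        have i: "((\<lambda>x. (G n x)\<^sup>2) has_integral integral {-1..1} (\<lambda>x. (G n x)\<^sup>2)) {-1..1}" for n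
          by (rule integrable_integral[OF integrable_on_Icc_sub(1)[OF D(15)]]) auto
        note H = has_integral_add[OF has_integral_mult_right[OF i[of k], of "1/2"] has_integral_mult_right[OF i[of l], of "1/2"]]
        have "integral {-1..1} (\<lambda>x. (1/2 * G k x + 1/2 * G l x)\<^sup>2) \<le> integral {-1..1} (\<lambda>x. 1/2 * (G k x)\<^sup>2 + 1/2 * (G l x)\<^sup>2)"
        proof (rule integral_le[OF _ has_integral_integrable[OF H]])
          show "(\<lambda>x. (1/2 * G k x + 1/2 * G l x)\<^sup>2) integrable_on {-1..1}"
            by (rule integrable_on_Icc_sub(1)[OF profileD(15)[OF mid]]) auto
          fix x :: real
          have "0 \<le> (G k x - G l x)\<^sup>2" by simp
          then show "(1/2 * G k x + 1/2 * G l x)\<^sup>2 \<le> 1/2 * (G k x)\<^sup>2 + 1/2 * (G l x)\<^sup>2"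
            by (simp add: power2_eq_square algebra_simps)
        qed
        also have "\<dots> \<le> B" unfolding integral_unique[OF H] using gB[of k] gB[of l] by linarith
        finally show ?thesis .
      qed
      then have "\<bar>energy \<epsilon> (\<lambda>x. 1/2 * U k x + 1/2 * U l x) (\<lambda>x. 1/2 * P k x + 1/2 * P l x) (\<lambda>x. 1/2 * G k x + 1/2 * G l x)
          - (a (\<lambda>x. 1/2 * G k x + 1/2 * G l x) + \<beta>)\<bar> \<le> e * (B + 2)"
      proof (rule pert[OF mid])
        fix x :: real assume x: "x \<in> {-1..1}"
        have "U k x \<in> {c..C}" "U l x \<in> {c..C}" "P k x \<in> {-M..M}" "P l x \<in> {-M..M}" using bx[OF x] by auto
        moreover have "\<bar>U k x - u x\<bar> < d" "\<bar>U l x - u x\<bar> < d" "\<bar>P k x - p x\<bar> < d" "\<bar>P l x - p x\<bar> < d"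
          using N1[OF kl(1) x] N1[OF kl(2) x] by auto
        ultimately show "1/2 * U k x + 1/2 * U l x \<in> {c..C} \<and> 1/2 * P k x + 1/2 * P l x \<in> {-M..M} \<and>
            \<bar>1/2 * U k x + 1/2 * U l x - u x\<bar> < d \<and> \<bar>1/2 * P k x + 1/2 * P l x - p x\<bar> < d"
          unfolding atLeastAtMost_iff by linarith
      qed
      then show "I - \<beta> - e * (B + 2) \<le> a (\<lambda>x. 1/2 * G k x + 1/2 * G l x)"
        using I_le[OF mid] by linarith
    qed
    then show ?thesis by blast
  qed
  have Cauchy: "\<exists>N. \<forall>k\<ge>N. \<forall>l\<ge>N. integral {-1..1} (\<lambda>x. (G k x - G l x)\<^sup>2) \<le> e" if e: "e > 0" for e
  proof -
    \<comment> \<open>In the parallelogram identity the two bounds add up to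
      \<open>4 * e' * (2 * B + 5)\<close>, which this choice turns into
      \<open>a0 * e\<close>.\<close>
    define e' where "e' = e * a0 / (4 * (2 * B + 5))"
    have e': "e' > 0" using e a0(1) B0 by (simp add: e'_def)
    obtain N where N: "\<And>k l. k \<ge> N \<Longrightarrow> l \<ge> N \<Longrightarrow> a (G k) \<le> I - \<beta> + e' * (B + 3) \<and>
      I - \<beta> - e' * (B + 2) \<le> a (\<lambda>x. 1/2 * G k x + 1/2 * G l x)" using close[OF e'] by blast
    have "integral {-1..1} (\<lambda>x. (G k x - G l x)\<^sup>2) \<le> e" if k: "k \<ge> N" and l: "l \<ge> N" for k l
    proof -
      have L2d: "L2_on (\<lambda>x. G k x - G l x)" using L2_on_lin[OF D(3)[of k] D(3)[of l], of 1 "-1"] by simp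
      note d2 = L2_on_sq_absolutely_integrable[OF L2d]
      have i1: "(\<lambda>x. (G k x - G l x)\<^sup>2) integrable_on {-1..1}" by (rule integrable_on_Icc_sub(1)[OF d2]) auto
      have i2: "(\<lambda>x. A x * (G k x - G l x)\<^sup>2) integrable_on {-1..1}"
        by (rule integrable_on_Icc_sub(1)[OF absolutely_integrable_continuous_mult[OF cA d2]]) auto
      have "a0 * integral {-1..1} (\<lambda>x. (G k x - G l x)\<^sup>2) = integral {-1..1} (\<lambda>x. a0 * (G k x - G l x)\<^sup>2)"
        by (rule integral_mult_right[symmetric])
      also have "\<dots> \<le> integral {-1..1} (\<lambda>x. A x * (G k x - G l x)\<^sup>2)"
      proof (rule integral_le[OF _ i2])
        show "(\<lambda>x. a0 * (G k x - G l x)\<^sup>2) integrable_on {-1..1}"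
          by (rule has_integral_integrable[OF has_integral_mult_right[OF integrable_integral[OF i1]]])
        show "a0 * (G k x - G l x)\<^sup>2 \<le> A x * (G k x - G l x)\<^sup>2" if "x \<in> {-1..1}" for x
          using a0(2)[OF that] by (intro mult_right_mono) auto
      qed
      also have "\<dots> = 2 * a (G k) + 2 * a (G l) - 4 * a (\<lambda>x. 1/2 * G k x + 1/2 * G l x)"
        unfolding a_def by (rule quadratic_midpoint_identity[OF cA D(3) D(3)])
      also have "\<dots> \<le> 4 * (e' * (B + 3)) + 4 * (e' * (B + 2))"
        using N[OF k l] N[OF l k] by linarith
      also have "\<dots> = e' * (4 * (2 * B + 5))" by (simp add: algebra_simps)
      also have "\<dots> = a0 * e" using B0 by (simp add: e'_def)
      finally show ?thesis using a0(1) by simp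
    qed
    then show ?thesis by blast
  qed
  obtain g s where s: "strict_mono (s :: nat \<Rightarrow> nat)" and sg: "set_integrable lborel I01 g"
    and ae: "AE x in lborel. x \<in> I01 \<longrightarrow> (\<lambda>k. G (s k) x) \<longlonglongrightarrow> g x"
    and lim: "\<And>a b. -1 \<le> a \<Longrightarrow> a \<le> b \<Longrightarrow> b \<le> 1 \<Longrightarrow> (\<lambda>k. integral {a..b} (G (s k))) \<longlonglongrightarrow> integral {a..b} g"
    by (rule L2_Cauchy_limit[of G, OF D(3) abs_contD(1)[OF D(2)] Cauchy]) (assumption | rule that)+
  note mg = set_integrable_imp_set_borel_measurable[OF sg]
  note aig = set_integrable_lborel_imp(1)[OF sg]
  \<comment> \<open>The limit of \<open>G (s k)\<close> is identified as the density of
    \<open>p\<close> by passing to the limit in the increments over every interval.\<close>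
  have ac: "abs_cont p g"
    unfolding abs_cont_def
  proof (intro conjI allI impI aig)
    fix x y :: real assume xy: "-1 \<le> x" "x \<le> y" "y \<le> 1"
    have "(\<lambda>k. P (s k) y - P (s k) x) \<longlonglongrightarrow> p y - p x"
      by (intro tendsto_diff LIMSEQ_subseq_LIMSEQ[OF limP s, unfolded o_def]) (use xy in auto)
    moreover have "integral {x..y} (G (s k)) = P (s k) y - P (s k) x" for k
      by (rule integral_unique[OF abs_contD(2)[OF D(2) xy]])
    ultimately have "integral {x..y} g = p y - p x"
      using lim[OF xy] by (simp add: LIMSEQ_unique)
    moreover have "(g has_integral integral {x..y} g) {x..y}"
      by (rule integrable_integral[OF integrable_on_Icc_sub(1)[OF aig]]) (use xy in auto)
    ultimately show "(g has_integral p y - p x) {x..y}" by (simp only:)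
  qed
  have "set_integrable lborel I01 (\<lambda>x. 1 * (g x)\<^sup>2)"
    by (rule Fatou_weighted(1)[of "\<lambda>x. 1" "\<lambda>k. G (s k)", OF _ _ D(3) mg ae, of B]) (use gB in auto)
  then have "L2_on g" using mg by (simp add: L2_on_def)
  then have prof: "profile \<alpha> u p g" unfolding profile_def using du ac even upos u1 p1 by blast
  have "a g \<le> I - \<beta>"
  proof (rule field_le_epsilon)
    fix e :: real assume e: "e > 0"
    define e' where "e' = e / (B + 3)"
    have e': "e' > 0" using e B0 by (simp add: e'_def)
    obtain N where N: "\<And>k l. k \<ge> N \<Longrightarrow> l \<ge> N \<Longrightarrow> a (G k) \<le> I - \<beta> + e' * (B + 3)" using close[OF e'] by blast
    have e'': "e' * (B + 3) = e" using B0 by (simp add: e'_def)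
    \<comment> \<open>Dropping the first \<open>N\<close> terms makes the energy bound valid for
      every index, as \<open>Fatou_weighted\<close> requires.\<close>
    have ae': "AE x in lborel. x \<in> I01 \<longrightarrow> (\<lambda>k. G (s (k + N)) x) \<longlonglongrightarrow> g x"
      using ae by eventually_elim (use LIMSEQ_ignore_initial_segment in blast)
    show "a g \<le> I - \<beta> + e"
      unfolding a_def
    proof (rule Fatou_weighted(2)[of A "\<lambda>k. G (s (k + N))", OF cA _ D(3) mg ae'])
      show "0 \<le> A x" if "x \<in> {-1..1}" for x using Apos[OF that] by simp
      fix k
      have "s (k + N) \<ge> N" using seq_suble[OF s, of "k + N"] by simp
      from N[OF this this] show "integral {-1..1} (\<lambda>x. A x * (G (s (k + N)) x)\<^sup>2) \<le> I - \<beta> + e"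
        unfolding e'' a_def .
    qed
  qed
  moreover have "energy \<epsilon> u p g = a g + \<beta>"
  proof -
    have h1: "((\<lambda>x. A x * (g x)\<^sup>2) has_integral a g) {-1..1}"
      unfolding a_def A_def
      by (rule integrable_integral[OF integrable_on_Icc_sub(1)[OF profile_integrable(1)[OF prof]]]) auto
    have h2: "(b has_integral \<beta>) {-1..1}"
      unfolding \<beta>_def by (rule integrable_integral[OF integrable_continuous_real[OF cb]])
    show ?thesis
      using integral_unique[OF has_integral_add[OF h1 h2]] unfolding energy_def A_def b_def .
  qed
  ultimately have "energy \<epsilon> u p g \<le> I" by simp
  then have "energy \<epsilon> u p g \<le> energy \<epsilon> w q h" if "profile \<alpha> w q h" for w q h using I_le[OF that] by linarith
  with prof show ?thesis by (rule that)
qed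

section \<open>First variation\<close>

text \<open>A Taylor expansion in \<open>t\<close> at 0 whose quadratic remainder is uniform in
  \<open>x\<close>. It takes the place of differentiation under the integral sign; the sum, product
  and power rules assemble the expansion of the coefficients of the energy density.\<close>

definition first_order :: "(real \<Rightarrow> real \<Rightarrow> real) \<Rightarrow> (real \<Rightarrow> real) \<Rightarrow> (real \<Rightarrow> real) \<Rightarrow> bool" where
  "first_order f f0 f1 \<longleftrightarrow> continuous_on {-1..1} f0 \<and> continuous_on {-1..1} f1 \<and>
     (\<exists>C\<ge>0. \<exists>t0>0. \<forall>t x. \<bar>t\<bar> \<le> t0 \<longrightarrow> x \<in> {-1..1} \<longrightarrow> \<bar>f t x - f0 x - t * f1 x\<bar> \<le> C * t\<^sup>2)"

lemma first_orderI:
  assumes "continuous_on {-1..1} f0" "continuous_on {-1..1} f1" "C \<ge> 0" "s > 0"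
    "\<And>t x. \<bar>t\<bar> \<le> s \<Longrightarrow> x \<in> {-1..1} \<Longrightarrow> \<bar>f t x - f0 x - t * f1 x\<bar> \<le> C * t\<^sup>2"
  shows "first_order f f0 f1"
  unfolding first_order_def using assms by blast

lemma first_order_continuous:
  assumes "first_order f f0 f1"
  shows "continuous_on {-1..1} f0" "continuous_on {-1..1} f1"
  using assms by (simp_all add: first_order_def)

text \<open>One constant serves all estimates: it is enlarged by bounds of \<open>f0\<close> and
  \<open>f1\<close>, and \<open>t\<close> is restricted to \<open>\<bar>t\<bar> \<le> 1\<close> so
  that \<open>t\<^sup>2 \<le> \<bar>t\<bar>\<close>.\<close>

lemma first_orderE:
  assumes "first_order f f0 f1"
  obtains C t0 where "C \<ge> 0" "t0 > 0" "t0 \<le> 1"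
    "\<And>t x. \<bar>t\<bar> \<le> t0 \<Longrightarrow> x \<in> {-1..1} \<Longrightarrow> \<bar>f t x - f0 x - t * f1 x\<bar> \<le> C * t\<^sup>2"
    "\<And>t x. \<bar>t\<bar> \<le> t0 \<Longrightarrow> x \<in> {-1..1} \<Longrightarrow> \<bar>f t x - f0 x\<bar> \<le> C * \<bar>t\<bar>"
    "\<And>x. x \<in> {-1..1} \<Longrightarrow> \<bar>f0 x\<bar> \<le> C" "\<And>x. x \<in> {-1..1} \<Longrightarrow> \<bar>f1 x\<bar> \<le> C"
    "\<And>t x. \<bar>t\<bar> \<le> t0 \<Longrightarrow> x \<in> {-1..1} \<Longrightarrow> \<bar>f t x\<bar> \<le> C"
proof -
  obtain C t0 where C: "C \<ge> 0" "t0 > 0" "\<And>t x. \<bar>t\<bar> \<le> t0 \<Longrightarrow> x \<in> {-1..1} \<Longrightarrow> \<bar>f t x - f0 x - t * f1 x\<bar> \<le> C * t\<^sup>2"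
    using assms unfolding first_order_def by blast
  have "bounded (f0 ` {-1..1})" "bounded (f1 ` {-1..1})"
    using assms unfolding first_order_def by (auto intro!: compact_imp_bounded compact_continuous_image)
  then obtain B0 B1 where B: "\<And>x. x \<in> {-1..1} \<Longrightarrow> \<bar>f0 x\<bar> \<le> B0" "\<And>x. x \<in> {-1..1} \<Longrightarrow> \<bar>f1 x\<bar> \<le> B1"
    unfolding bounded_iff by (auto simp del: atLeastAtMost_iff)
  have B0: "0 \<le> B0" "0 \<le> B1" using B[of 0] by auto
  have dif: "\<bar>f t x - f0 x\<bar> \<le> (C + B1) * \<bar>t\<bar>" if t: "\<bar>t\<bar> \<le> min t0 1" and x: "x \<in> {-1..1}" for t x
  proof -
    have "\<bar>f t x - f0 x - t * f1 x\<bar> \<le> C * t\<^sup>2" using C(3) t x by auto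
    moreover have "C * t\<^sup>2 \<le> C * \<bar>t\<bar>"
    proof (rule mult_left_mono[OF _ C(1)])
      have "\<bar>t\<bar> * \<bar>t\<bar> \<le> \<bar>t\<bar> * 1" using t by (intro mult_left_mono) auto
      then show "t\<^sup>2 \<le> \<bar>t\<bar>" by (simp add: power2_eq_square)
    qed
    moreover have "\<bar>t * f1 x\<bar> \<le> B1 * \<bar>t\<bar>" 
      unfolding abs_mult mult.commute[of "\<bar>t\<bar>"] using B(2)[OF x] by (intro mult_right_mono) auto
    ultimately have "\<bar>f t x - f0 x\<bar> \<le> C * \<bar>t\<bar> + B1 * \<bar>t\<bar>" by linarith
    then show ?thesis by (simp add: algebra_simps)
  qed
  show ?thesis
  proof (rule that[of "C + B0 + B1" "min t0 1"])
    fix t x :: real assume tx: "\<bar>t\<bar> \<le> min t0 1" "x \<in> {-1..1}"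
    have "\<bar>f t x - f0 x - t * f1 x\<bar> \<le> C * t\<^sup>2" using C(3) tx by auto
    also have "\<dots> \<le> (C + B0 + B1) * t\<^sup>2" using B0 by (intro mult_right_mono) auto
    finally show "\<bar>f t x - f0 x - t * f1 x\<bar> \<le> (C + B0 + B1) * t\<^sup>2" .
    have "\<bar>f t x - f0 x\<bar> \<le> (C + B1) * \<bar>t\<bar>" by (rule dif[OF tx])
    moreover have "(C + B1) * \<bar>t\<bar> \<le> (C + B0 + B1) * \<bar>t\<bar>" using B0 by (intro mult_right_mono) auto
    ultimately show "\<bar>f t x - f0 x\<bar> \<le> (C + B0 + B1) * \<bar>t\<bar>" by linarith
    have "(C + B1) * \<bar>t\<bar> \<le> (C + B1) * 1" using tx C(1) B0 by (intro mult_left_mono) auto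
    then have "\<bar>f t x - f0 x\<bar> \<le> C + B1" using order_trans[OF dif[OF tx]] by simp
    then show "\<bar>f t x\<bar> \<le> C + B0 + B1" using B(1)[OF tx(2)] by linarith
  next
    fix x :: real assume x: "x \<in> {-1..1}"
    show "\<bar>f0 x\<bar> \<le> C + B0 + B1" "\<bar>f1 x\<bar> \<le> C + B0 + B1" using B[OF x] B0 C(1) by auto
  qed (use C B0 in auto)
qed

lemma first_order_affine:
  assumes "continuous_on {-1..1} u" "continuous_on {-1..1} v"
  shows "first_order (\<lambda>t x. u x + t * v x) u v"
  unfolding first_order_def using assms by (auto intro!: exI[of _ 0] exI[of _ 1])

lemma first_order_const: "first_order (\<lambda>t x. c) (\<lambda>x. c) (\<lambda>x. 0)"
  unfolding first_order_def by (auto intro!: exI[of _ 0] exI[of _ 1] continuous_intros)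

lemma first_order_add:
  assumes "first_order f f0 f1" "first_order g g0 g1"
  shows "first_order (\<lambda>t x. f t x + g t x) (\<lambda>x. f0 x + g0 x) (\<lambda>x. f1 x + g1 x)"
proof -
  obtain C t0 where C: "C \<ge> 0" "t0 > 0" "\<And>t x. \<bar>t\<bar> \<le> t0 \<Longrightarrow> x \<in> {-1..1} \<Longrightarrow> \<bar>f t x - f0 x - t * f1 x\<bar> \<le> C * t\<^sup>2"
    using assms(1) unfolding first_order_def by blast
  obtain D s0 where D: "D \<ge> 0" "s0 > 0" "\<And>t x. \<bar>t\<bar> \<le> s0 \<Longrightarrow> x \<in> {-1..1} \<Longrightarrow> \<bar>g t x - g0 x - t * g1 x\<bar> \<le> D * t\<^sup>2"
    using assms(2) unfolding first_order_def by blast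
  have "\<bar>f t x + g t x - (f0 x + g0 x) - t * (f1 x + g1 x)\<bar> \<le> (C + D) * t\<^sup>2"
    if "\<bar>t\<bar> \<le> min t0 s0" "x \<in> {-1..1}" for t x
  proof -
    have "\<bar>f t x - f0 x - t * f1 x\<bar> \<le> C * t\<^sup>2" "\<bar>g t x - g0 x - t * g1 x\<bar> \<le> D * t\<^sup>2"
      using that by (auto intro!: C(3) D(3) simp del: atLeastAtMost_iff)
    then show ?thesis unfolding distrib_left distrib_right by linarith
  qed
  note est = this
  show ?thesis
    by (rule first_orderI[where C="C + D" and s="min t0 s0", OF _ _ _ _ est])
       (simp_all add: C(1,2) D(1,2) continuous_intros first_order_continuous[OF assms(1)] first_order_continuous[OF assms(2)])
qed

lemma first_order_mult:
  assumes "first_order f f0 f1" "first_order g g0 g1"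
  shows "first_order (\<lambda>t x. f t x * g t x) (\<lambda>x. f0 x * g0 x) (\<lambda>x. f0 x * g1 x + f1 x * g0 x)"
proof -
  obtain C t0 where C: "C \<ge> 0" "t0 > 0" "t0 \<le> 1"
    "\<And>t x. \<bar>t\<bar> \<le> t0 \<Longrightarrow> x \<in> {-1..1} \<Longrightarrow> \<bar>f t x - f0 x - t * f1 x\<bar> \<le> C * t\<^sup>2"
    "\<And>t x. \<bar>t\<bar> \<le> t0 \<Longrightarrow> x \<in> {-1..1} \<Longrightarrow> \<bar>f t x - f0 x\<bar> \<le> C * \<bar>t\<bar>"
    "\<And>x. x \<in> {-1..1} \<Longrightarrow> \<bar>f0 x\<bar> \<le> C" "\<And>x. x \<in> {-1..1} \<Longrightarrow> \<bar>f1 x\<bar> \<le> C"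
    "\<And>t x. \<bar>t\<bar> \<le> t0 \<Longrightarrow> x \<in> {-1..1} \<Longrightarrow> \<bar>f t x\<bar> \<le> C"
    by (rule first_orderE[OF assms(1)]) (rule that)
  obtain D s0 where D: "D \<ge> 0" "s0 > 0" "s0 \<le> 1"
    "\<And>t x. \<bar>t\<bar> \<le> s0 \<Longrightarrow> x \<in> {-1..1} \<Longrightarrow> \<bar>g t x - g0 x - t * g1 x\<bar> \<le> D * t\<^sup>2"
    "\<And>t x. \<bar>t\<bar> \<le> s0 \<Longrightarrow> x \<in> {-1..1} \<Longrightarrow> \<bar>g t x - g0 x\<bar> \<le> D * \<bar>t\<bar>"
    "\<And>x. x \<in> {-1..1} \<Longrightarrow> \<bar>g0 x\<bar> \<le> D" "\<And>x. x \<in> {-1..1} \<Longrightarrow> \<bar>g1 x\<bar> \<le> D"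
    "\<And>t x. \<bar>t\<bar> \<le> s0 \<Longrightarrow> x \<in> {-1..1} \<Longrightarrow> \<bar>g t x\<bar> \<le> D"
    by (rule first_orderE[OF assms(2)]) (rule that)
  have "\<bar>f t x * g t x - f0 x * g0 x - t * (f0 x * g1 x + f1 x * g0 x)\<bar> \<le> (3 * C * D) * t\<^sup>2"
    if t: "\<bar>t\<bar> \<le> min t0 s0" and x: "x \<in> {-1..1}" for t x
  proof -
    have t': "\<bar>t\<bar> \<le> t0" "\<bar>t\<bar> \<le> s0" using t by auto
    \<comment> \<open>Each of the three summands contains a factor of order \<open>t\<^sup>2\<close>
      or two factors of order \<open>t\<close>, which explains the constant
      \<open>3 * C * D\<close>.\<close>
    have eq: "f t x * g t x - f0 x * g0 x - t * (f0 x * g1 x + f1 x * g0 x) =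
        (f t x - f0 x - t * f1 x) * g t x + f0 x * (g t x - g0 x - t * g1 x) + (t * f1 x) * (g t x - g0 x)"
      by (simp add: algebra_simps)
    have "\<bar>(f t x - f0 x - t * f1 x) * g t x\<bar> \<le> (C * t\<^sup>2) * D"
      unfolding abs_mult using C(4)[OF t'(1) x] D(8)[OF t'(2) x] C(1) by (intro mult_mono) auto
    moreover have "\<bar>f0 x * (g t x - g0 x - t * g1 x)\<bar> \<le> C * (D * t\<^sup>2)"
      unfolding abs_mult using C(6)[OF x] D(4)[OF t'(2) x] C(1) by (intro mult_mono) auto
    moreover have "\<bar>(t * f1 x) * (g t x - g0 x)\<bar> \<le> (\<bar>t\<bar> * C) * (D * \<bar>t\<bar>)"
      unfolding abs_mult using C(7)[OF x] D(5)[OF t'(2) x] C(1) by (intro mult_mono) auto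
    moreover have "(\<bar>t\<bar> * C) * (D * \<bar>t\<bar>) = C * D * t\<^sup>2"
      by (simp add: power2_eq_square mult_ac)
    moreover have "(C * t\<^sup>2) * D = C * D * t\<^sup>2" "C * (D * t\<^sup>2) = C * D * t\<^sup>2" by simp_all
    ultimately show ?thesis unfolding eq by linarith
  qed
  note est = this
  show ?thesis
    by (rule first_orderI[where C="3 * C * D" and s="min t0 s0", OF _ _ _ _ est])
       (simp_all add: C(1,2) D(1,2) continuous_intros first_order_continuous[OF assms(1)] first_order_continuous[OF assms(2)])
qed

lemma powr_Taylor2:
  fixes e :: real
  assumes y: "0 < l" "l \<le> y" "y \<le> r" "l \<le> z" "z \<le> r"
    and D: "\<And>w. l \<le> w \<Longrightarrow> w \<le> r \<Longrightarrow> \<bar>e * (e - 1) * w powr (e - 2)\<bar> \<le> D"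
  shows "\<bar>y powr e - z powr e - e * z powr (e - 1) * (y - z)\<bar> \<le> D * (y - z)\<^sup>2"
proof (cases "y = z")
  case False
  define diff where "diff m w = (if m = 0 then w powr e else if m = 1 then e * w powr (e - 1) else e * (e - 1) * w powr (e - 2))"
    for m :: nat and w :: real
  have dd: "\<forall>m w. m < 2 \<and> l \<le> w \<and> w \<le> r \<longrightarrow> (diff m has_real_derivative diff (Suc m) w) (at w)"
  proof (intro allI impI)
    fix m :: nat and w assume mw: "m < 2 \<and> l \<le> w \<and> w \<le> r"
    then have w: "w > 0" using y(1) by linarith
    from mw consider "m = 0" | "m = 1" by linarith
    then show "(diff m has_real_derivative diff (Suc m) w) (at w)"
    proof cases
      case 1
      have "((\<lambda>w. w powr e) has_real_derivative e * w powr (e - 1)) (at w)" by (rule has_real_derivative_powr[OF w])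
      then show ?thesis unfolding diff_def 1 by simp
    next
      case 2
      have "((\<lambda>w. e * w powr (e - 1)) has_real_derivative e * ((e - 1) * w powr (e - 1 - 1))) (at w)"
        by (rule DERIV_cmult[OF has_real_derivative_powr[OF w]])
      then show ?thesis unfolding diff_def 2 by (simp add: mult.assoc)
    qed
  qed
  have "\<exists>t. (if y < z then y < t \<and> t < z else z < t \<and> t < y) \<and>
      y powr e = (\<Sum>m<2. (diff m z / fact m) * (y - z) ^ m) + (diff 2 t / fact 2) * (y - z) ^ 2"
    by (rule Taylor[of 2 diff "\<lambda>w. w powr e" l r z y]) (use dd y False in \<open>auto simp: diff_def\<close>)
  then obtain t where t: "if y < z then y < t \<and> t < z else z < t \<and> t < y"
    "y powr e = (\<Sum>m<2. (diff m z / fact m) * (y - z) ^ m) + (diff 2 t / fact 2) * (y - z) ^ 2" by blast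
  have lt: "l \<le> t" "t \<le> r" using t(1) y by (auto split: if_splits)
  have "y powr e - z powr e - e * z powr (e - 1) * (y - z) = e * (e - 1) * t powr (e - 2) / 2 * (y - z)\<^sup>2"
    unfolding t(2) by (simp add: diff_def eval_nat_numeral)
  also have "\<bar>\<dots>\<bar> = \<bar>e * (e - 1) * t powr (e - 2)\<bar> / 2 * (y - z)\<^sup>2"
    by (simp only: abs_mult abs_divide power2_abs) simp
  also have "\<dots> \<le> D * (y - z)\<^sup>2"
    using D[OF lt] by (intro mult_right_mono) auto
  finally show ?thesis .
qed simp

text \<open>With \<open>2 * l\<close> the minimum of \<open>f0\<close>, small \<open>t\<close> keeps
  \<open>f t\<close> in \<open>{l..C}\<close>, where the second derivative of the power is bounded.
  The Taylor remainder is then of order \<open>(f t x - f0 x)\<^sup>2\<close>, hence of order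
  \<open>t\<^sup>2\<close>.\<close>

lemma first_order_powr:
  assumes "first_order f f0 f1" and pos: "\<And>x. x \<in> {-1..1} \<Longrightarrow> f0 x > 0"
  shows "first_order (\<lambda>t x. f t x powr e) (\<lambda>x. f0 x powr e) (\<lambda>x. e * f0 x powr (e - 1) * f1 x)"
proof -
  obtain C t0 where C: "C \<ge> 0" "t0 > 0" "t0 \<le> 1"
    "\<And>t x. \<bar>t\<bar> \<le> t0 \<Longrightarrow> x \<in> {-1..1} \<Longrightarrow> \<bar>f t x - f0 x - t * f1 x\<bar> \<le> C * t\<^sup>2"
    "\<And>t x. \<bar>t\<bar> \<le> t0 \<Longrightarrow> x \<in> {-1..1} \<Longrightarrow> \<bar>f t x - f0 x\<bar> \<le> C * \<bar>t\<bar>"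
    "\<And>x. x \<in> {-1..1} \<Longrightarrow> \<bar>f0 x\<bar> \<le> C" "\<And>x. x \<in> {-1..1} \<Longrightarrow> \<bar>f1 x\<bar> \<le> C"
    "\<And>t x. \<bar>t\<bar> \<le> t0 \<Longrightarrow> x \<in> {-1..1} \<Longrightarrow> \<bar>f t x\<bar> \<le> C"
    by (rule first_orderE[OF assms(1)]) (rule that)
  have c0: "continuous_on {-1..1} f0" and c1: "continuous_on {-1..1} f1" using assms(1) by (auto simp: first_order_def)
  have c0': "continuous_on {-1..1} (\<lambda>x. f0 x powr e')" for e'
    by (intro continuous_intros c0) (use pos in \<open>auto simp: less_imp_neq[symmetric] simp del: atLeastAtMost_iff\<close>)
  obtain z where z: "z \<in> {-1..1}" "\<And>y. y \<in> {-1..1} \<Longrightarrow> f0 z \<le> f0 y"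
    using continuous_attains_inf[OF compact_Icc _ c0] by auto
  define l where "l = f0 z / 2"
  have l: "l > 0" using pos[OF z(1)] by (simp add: l_def)
  have "continuous_on {l..C} (\<lambda>w. e * (e - 1) * w powr (e - 2))"
    using l by (intro continuous_intros) auto
  then have "bounded ((\<lambda>w. e * (e - 1) * w powr (e - 2)) ` {l..C})"
    by (intro compact_imp_bounded compact_continuous_image compact_Icc)
  then obtain D where D: "D > 0" "\<And>w. l \<le> w \<Longrightarrow> w \<le> C \<Longrightarrow> \<bar>e * (e - 1) * w powr (e - 2)\<bar> \<le> D"
    unfolding bounded_pos by auto
  have "bounded ((\<lambda>x. e * f0 x powr (e - 1)) ` {-1..1})"
    by (intro compact_imp_bounded compact_continuous_image compact_Icc continuous_intros c0')
  then obtain D' where D': "D' > 0" "\<And>x. x \<in> {-1..1} \<Longrightarrow> \<bar>e * f0 x powr (e - 1)\<bar> \<le> D'"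
    unfolding bounded_pos by (auto simp del: atLeastAtMost_iff)
  define s0 where "s0 = min t0 (l / (C + 1))"
  have s0: "s0 > 0" using C l by (simp add: s0_def)
  have "\<bar>f t x powr e - f0 x powr e - t * (e * f0 x powr (e - 1) * f1 x)\<bar> \<le> (D * C\<^sup>2 + D' * C) * t\<^sup>2"
    if t: "\<bar>t\<bar> \<le> s0" and x: "x \<in> {-1..1}" for t x
  proof -
    have t': "\<bar>t\<bar> \<le> t0" "\<bar>t\<bar> \<le> l / (C + 1)" using t by (auto simp: s0_def)
    have "C * \<bar>t\<bar> \<le> (C + 1) * \<bar>t\<bar>" by (intro mult_right_mono) auto
    also have "\<dots> \<le> l" using t'(2) C(1) by (simp add: field_simps)
    finally have "\<bar>f t x - f0 x\<bar> \<le> l" using C(5)[OF t'(1) x] by linarith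
    moreover have f0: "2 * l \<le> f0 x" using z(2)[OF x] by (simp add: l_def)
    ultimately have ft: "l \<le> f t x" by linarith
    have "\<bar>f t x powr e - f0 x powr e - e * f0 x powr (e - 1) * (f t x - f0 x)\<bar> \<le> D * (f t x - f0 x)\<^sup>2"
      using C(6)[OF x] C(8)[OF t'(1) x] f0 ft l
      by (intro powr_Taylor2[OF l ft _ _ _ D(2)]) auto
    moreover have "D * (f t x - f0 x)\<^sup>2 \<le> D * (C * \<bar>t\<bar>)\<^sup>2"
      using C(5)[OF t'(1) x] D(1) by (intro mult_left_mono) (auto simp: abs_le_square_iff[symmetric] abs_mult C(1))
    moreover have "\<bar>e * f0 x powr (e - 1) * (f t x - f0 x - t * f1 x)\<bar> \<le> D' * (C * t\<^sup>2)"
      unfolding abs_mult[of "e * f0 x powr (e - 1)"] using D'(2)[OF x] C(4)[OF t'(1) x] D'(1) by (intro mult_mono) auto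
    moreover have "f t x powr e - f0 x powr e - t * (e * f0 x powr (e - 1) * f1 x) =
        (f t x powr e - f0 x powr e - e * f0 x powr (e - 1) * (f t x - f0 x)) + e * f0 x powr (e - 1) * (f t x - f0 x - t * f1 x)"
      by (simp add: algebra_simps)
    moreover have "D * (C * \<bar>t\<bar>)\<^sup>2 = D * C\<^sup>2 * t\<^sup>2" by (simp add: power_mult_distrib)
    moreover have "(D * C\<^sup>2 + D' * C) * t\<^sup>2 = D * C\<^sup>2 * t\<^sup>2 + D' * (C * t\<^sup>2)" by (simp add: algebra_simps)
    ultimately show ?thesis by linarith
  qed
  from first_orderI[OF _ _ _ s0 this] show ?thesis
    using C(1) D(1) D'(1) c0' c1 by (simp add: continuous_intros)
qed

lemma first_order_cong:
  assumes "first_order f f0 f1" "s > 0" "\<And>t x. \<bar>t\<bar> \<le> s \<Longrightarrow> x \<in> {-1..1} \<Longrightarrow> f t x = g t x"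
    "\<And>x. x \<in> {-1..1} \<Longrightarrow> f0 x = g0 x" "\<And>x. x \<in> {-1..1} \<Longrightarrow> f1 x = g1 x"
  shows "first_order g g0 g1"
proof -
  obtain C t0 where C: "C \<ge> 0" "t0 > 0" "\<And>t x. \<bar>t\<bar> \<le> t0 \<Longrightarrow> x \<in> {-1..1} \<Longrightarrow> \<bar>f t x - f0 x - t * f1 x\<bar> \<le> C * t\<^sup>2"
    using assms(1) unfolding first_order_def by blast
  show ?thesis
  proof (rule first_orderI[of _ _ C "min t0 s"])
    show "continuous_on {-1..1} g0" by (rule continuous_on_eq[OF first_order_continuous(1)[OF assms(1)] assms(4)])
    show "continuous_on {-1..1} g1" by (rule continuous_on_eq[OF first_order_continuous(2)[OF assms(1)] assms(5)])
    fix t x :: real assume t: "\<bar>t\<bar> \<le> min t0 s" and x: "x \<in> {-1..1}"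
    have t': "\<bar>t\<bar> \<le> t0" "\<bar>t\<bar> \<le> s" using t by auto
    show "\<bar>g t x - g0 x - t * g1 x\<bar> \<le> C * t\<^sup>2"
      using C(3)[OF t'(1) x] unfolding assms(3)[OF t'(2) x] assms(4)[OF x] assms(5)[OF x] .
  qed (use C assms(2) in auto)
qed

text \<open>\<open>EL1\<close> and \<open>EL0\<close> are the partial derivatives of the energy
  density in \<open>p\<close> and in \<open>u\<close>. Quotients by \<open>u\<close> are written
  with \<open>powr\<close>, so that the rules for powers apply to them.\<close>

definition EL1 :: "real \<Rightarrow> real \<Rightarrow> real \<Rightarrow> real \<Rightarrow> real" where
  "EL1 \<epsilon> u p g = (-5) * u * p * Q (-7/2) p * g\<^sup>2 + ((-1) * (p * Q (-3/2) p * u powr (-1)) + 4 * \<epsilon> * u * p * Q (-1/2) p)"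

definition EL0 :: "real \<Rightarrow> real \<Rightarrow> real \<Rightarrow> real \<Rightarrow> real" where
  "EL0 \<epsilon> u p g = Q (-5/2) p * g\<^sup>2 + ((-1) * (Q (-1/2) p * u powr (-2)) + 4 * \<epsilon> * Q (1/2) p)"

lemma first_order_density:
  assumes c: "continuous_on {-1..1} u" "continuous_on {-1..1} p" "continuous_on {-1..1} \<phi>" "continuous_on {-1..1} \<zeta>"
    and pos: "\<And>x. x \<in> {-1..1} \<Longrightarrow> u x > 0"
    and s: "s > 0" "\<And>t x. \<bar>t\<bar> \<le> s \<Longrightarrow> x \<in> {-1..1} \<Longrightarrow> u x + t * \<phi> x > 0"
  shows "first_order (\<lambda>t x. Ja (u x + t * \<phi> x) (p x + t * \<zeta> x)) (\<lambda>x. Ja (u x) (p x))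
      (\<lambda>x. Q (-5/2) (p x) * \<phi> x + (-5) * u x * p x * Q (-7/2) (p x) * \<zeta> x)"
    and "first_order (\<lambda>t x. Jb \<epsilon> (u x + t * \<phi> x) (p x + t * \<zeta> x)) (\<lambda>x. Jb \<epsilon> (u x) (p x))
      (\<lambda>x. ((-1) * (p x * Q (-3/2) (p x) * u x powr (-1)) + 4 * \<epsilon> * u x * p x * Q (-1/2) (p x)) * \<zeta> x
        + ((-1) * (Q (-1/2) (p x) * u x powr (-2)) + 4 * \<epsilon> * Q (1/2) (p x)) * \<phi> x)"
proof -
  note U = first_order_affine[OF c(1,3)] and P = first_order_affine[OF c(2,4)]
  have q: "first_order (\<lambda>t x. 1 + (p x + t * \<zeta> x)\<^sup>2) (\<lambda>x. 1 + (p x)\<^sup>2) (\<lambda>x. 2 * p x * \<zeta> x)"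
    by (rule first_order_cong[OF first_order_add[OF first_order_const[of 1] first_order_mult[OF P P]], of 1])
       (auto simp: power2_eq_square)
  have Qe: "first_order (\<lambda>t x. Q e (p x + t * \<zeta> x)) (\<lambda>x. Q e (p x)) (\<lambda>x. e * Q (e - 1) (p x) * (2 * p x * \<zeta> x))" for e
    unfolding Q_def by (rule first_order_powr[OF q one_plus_sq_pos])
  show "first_order (\<lambda>t x. Ja (u x + t * \<phi> x) (p x + t * \<zeta> x)) (\<lambda>x. Ja (u x) (p x))
      (\<lambda>x. Q (-5/2) (p x) * \<phi> x + (-5) * u x * p x * Q (-7/2) (p x) * \<zeta> x)"
    unfolding Ja_def
    by (rule first_order_cong[OF first_order_mult[OF U Qe[of "-5/2"]], of 1]) (simp_all add: algebra_simps)
  note V = first_order_powr[OF U pos, of "-1"]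
  show "first_order (\<lambda>t x. Jb \<epsilon> (u x + t * \<phi> x) (p x + t * \<zeta> x)) (\<lambda>x. Jb \<epsilon> (u x) (p x))
      (\<lambda>x. ((-1) * (p x * Q (-3/2) (p x) * u x powr (-1)) + 4 * \<epsilon> * u x * p x * Q (-1/2) (p x)) * \<zeta> x
        + ((-1) * (Q (-1/2) (p x) * u x powr (-2)) + 4 * \<epsilon> * Q (1/2) (p x)) * \<phi> x)"
    unfolding Jb_def
  proof (rule first_order_cong[OF first_order_add[OF first_order_mult[OF Qe[of "-1/2"] V]
        first_order_mult[OF first_order_const[of "4 * \<epsilon>"] first_order_mult[OF U Qe[of "1/2"]]]] s(1)])
    fix t x :: real assume t: "\<bar>t\<bar> \<le> s" and x: "x \<in> {-1..1}"
    show "Q (-1/2) (p x + t * \<zeta> x) * (u x + t * \<phi> x) powr (-1) + 4 * \<epsilon> * ((u x + t * \<phi> x) * Q (1/2) (p x + t * \<zeta> x)) =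
       Q (-1/2) (p x + t * \<zeta> x) / (u x + t * \<phi> x) + 4 * \<epsilon> * (u x + t * \<phi> x) * Q (1/2) (p x + t * \<zeta> x)"
      using s(2)[OF t x] by (simp add: powr_minus_divide)
  next
    fix x :: real assume x: "x \<in> {-1..1}"
    show "Q (-1/2) (p x) * u x powr (-1) + 4 * \<epsilon> * (u x * Q (1/2) (p x)) = Q (-1/2) (p x) / u x + 4 * \<epsilon> * u x * Q (1/2) (p x)"
      using pos[OF x] by (simp add: powr_minus_divide)
    show "Q (-1/2) (p x) * ((-1) * u x powr ((-1) - 1) * \<phi> x) + (-1/2) * Q (-1/2 - 1) (p x) * (2 * p x * \<zeta> x) * u x powr (-1) +
       (4 * \<epsilon> * (u x * (1/2 * Q (1/2 - 1) (p x) * (2 * p x * \<zeta> x)) + \<phi> x * Q (1/2) (p x)) + 0 * (u x * Q (1/2) (p x))) =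
      ((-1) * (p x * Q (-3/2) (p x) * u x powr (-1)) + 4 * \<epsilon> * u x * p x * Q (-1/2) (p x)) * \<zeta> x
        + ((-1) * (Q (-1/2) (p x) * u x powr (-2)) + 4 * \<epsilon> * Q (1/2) (p x)) * \<phi> x"
      by (simp add: algebra_simps)
  qed
qed

section \<open>First variation of the energy\<close>

lemma L2_on_mult_absolutely_integrable:
  assumes "L2_on f" "L2_on g"
  shows "(\<lambda>x. f x * g x) absolutely_integrable_on {-1..1}"
proof -
  have "(\<lambda>x. 1/2 * (1 * f x + 1 * g x)\<^sup>2 + (-1/2) * (f x)\<^sup>2 + (-1/2) * (g x)\<^sup>2) absolutely_integrable_on {-1..1}"
    by (intro set_integral_add(1) absolutely_integrable_continuous_mult continuous_on_const
        L2_on_sq_absolutely_integrable L2_on_lin assms)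
  moreover have "1/2 * (1 * f x + 1 * g x)\<^sup>2 + (-1/2) * (f x)\<^sup>2 + (-1/2) * (g x)\<^sup>2 = f x * g x" for x
    by (simp add: power2_eq_square algebra_simps)
  ultimately show ?thesis by (simp only:)
qed

text \<open>The second derivatives \<open>g\<close> and \<open>h\<close> are only square integrable,
  so the remainder cannot be uniform in \<open>x\<close>; it is \<open>t\<^sup>2\<close> times a
  multiple of the weight \<open>1 + g\<^sup>2 + h\<^sup>2\<close>. An upper bound is enough for
  comparison with a minimiser. The 5 is the total coefficient of
  \<open>C * h\<^sup>2\<close>.\<close>

lemma density_expansion_bound:
  fixes a0 a1 b0 b1 A B g h t C :: real
  assumes C: "C \<ge> 0" and t: "\<bar>t\<bar> \<le> 1" and A: "\<bar>A - a0 - t * a1\<bar> \<le> C * t\<^sup>2" and B: "\<bar>B - b0 - t * b1\<bar> \<le> C * t\<^sup>2"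
    and a: "\<bar>a0\<bar> \<le> C" "\<bar>a1\<bar> \<le> C"
  shows "A * (g + t * h)\<^sup>2 + B \<le> a0 * g\<^sup>2 + b0 + t * (a1 * g\<^sup>2 + 2 * a0 * (g * h) + b1) + t\<^sup>2 * (5 * C * (1 + g\<^sup>2 + h\<^sup>2))"
proof -
  have t2: "t\<^sup>2 \<le> 1" using t by (simp add: abs_square_le_1)
  have gh: "2 * \<bar>g * h\<bar> \<le> g\<^sup>2 + h\<^sup>2"
    using sum_squares_bound[of "\<bar>g\<bar>" "\<bar>h\<bar>"] by (simp add: abs_mult)
  have sq: "(g + t * h)\<^sup>2 \<le> 2 * g\<^sup>2 + 2 * h\<^sup>2"
  proof -
    have "(g + t * h)\<^sup>2 \<le> 2 * g\<^sup>2 + 2 * (t * h)\<^sup>2" using sum_squares_bound[of g "t * h"] by (simp add: power2_sum)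
    moreover have "(t * h)\<^sup>2 \<le> 1 * h\<^sup>2" unfolding power_mult_distrib using t2 by (intro mult_right_mono) auto
    ultimately show ?thesis by linarith
  qed
  have 1: "(A - a0 - t * a1) * (g + t * h)\<^sup>2 \<le> (C * t\<^sup>2) * (2 * g\<^sup>2 + 2 * h\<^sup>2)"
  proof (rule order_trans)
    show "(A - a0 - t * a1) * (g + t * h)\<^sup>2 \<le> (C * t\<^sup>2) * (g + t * h)\<^sup>2"
      by (rule mult_right_mono[OF abs_le_D1[OF A]]) simp
    show "(C * t\<^sup>2) * (g + t * h)\<^sup>2 \<le> (C * t\<^sup>2) * (2 * g\<^sup>2 + 2 * h\<^sup>2)"
      by (rule mult_left_mono[OF sq]) (use C in simp)
  qed
  have 2: "a0 * h\<^sup>2 \<le> C * h\<^sup>2" using a(1) by (intro mult_right_mono) auto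
  have 3: "2 * a1 * (g * h) \<le> C * (g\<^sup>2 + h\<^sup>2)"
  proof -
    have "2 * a1 * (g * h) \<le> \<bar>a1\<bar> * (2 * \<bar>g * h\<bar>)" using abs_ge_self[of "2 * a1 * (g * h)"] by (simp add: abs_mult)
    also have "\<dots> \<le> C * (g\<^sup>2 + h\<^sup>2)" using a(2) gh C by (intro mult_mono) auto
    finally show ?thesis .
  qed
  have 4: "t * a1 * h\<^sup>2 \<le> C * h\<^sup>2"
  proof (rule mult_right_mono)
    have "\<bar>t\<bar> * \<bar>a1\<bar> \<le> 1 * C" using t a(2) by (intro mult_mono) auto
    then show "t * a1 \<le> C" using abs_ge_self[of "t * a1"] by (simp add: abs_mult)
  qed simp
  have "t\<^sup>2 * (a0 * h\<^sup>2 + 2 * a1 * (g * h) + t * a1 * h\<^sup>2) \<le> t\<^sup>2 * (C * h\<^sup>2 + C * (g\<^sup>2 + h\<^sup>2) + C * h\<^sup>2)"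
    using 2 3 4 by (intro mult_left_mono) auto
  moreover have "A * (g + t * h)\<^sup>2 + B = a0 * g\<^sup>2 + b0 + t * (a1 * g\<^sup>2 + 2 * a0 * (g * h) + b1)
     + (A - a0 - t * a1) * (g + t * h)\<^sup>2 + t\<^sup>2 * (a0 * h\<^sup>2 + 2 * a1 * (g * h) + t * a1 * h\<^sup>2) + (B - b0 - t * b1)"
    by (simp add: power2_eq_square algebra_simps)
  moreover have "(C * t\<^sup>2) * (2 * g\<^sup>2 + 2 * h\<^sup>2) + t\<^sup>2 * (C * h\<^sup>2 + C * (g\<^sup>2 + h\<^sup>2) + C * h\<^sup>2) + C * t\<^sup>2
     \<le> t\<^sup>2 * (5 * C * (1 + g\<^sup>2 + h\<^sup>2))"
  proof -
    have "t\<^sup>2 * (5 * C * (1 + g\<^sup>2 + h\<^sup>2)) - ((C * t\<^sup>2) * (2 * g\<^sup>2 + 2 * h\<^sup>2) + t\<^sup>2 * (C * h\<^sup>2 + C * (g\<^sup>2 + h\<^sup>2) + C * h\<^sup>2) + C * t\<^sup>2)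
      = C * t\<^sup>2 * (4 + 2 * g\<^sup>2)" by (simp add: algebra_simps)
    moreover have "0 \<le> C * t\<^sup>2 * (4 + 2 * g\<^sup>2)" using C by simp
    ultimately show ?thesis by linarith
  qed
  ultimately show ?thesis using 1 B by linarith
qed

text \<open>Comparison with \<open>u + t * \<phi>\<close> gives
  \<open>0 \<le> t * L + t\<^sup>2 * R\<close> for all small \<open>t\<close> of either sign, where
  \<open>L\<close> and \<open>R\<close> stand for their integrals, and this forces the integral of
  \<open>L\<close> to vanish.\<close>

lemma energy_first_variation:
  assumes P: "profile \<alpha> u p g"
    and min: "\<And>w q h. profile \<alpha> w q h \<Longrightarrow> energy \<epsilon> u p g \<le> energy \<epsilon> w q h"
    and d\<phi>: "\<And>x. x \<in> {-1..1} \<Longrightarrow> (\<phi> has_real_derivative \<zeta> x) (at x within {-1..1})"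
    and ac: "abs_cont \<zeta> \<eta>" and L2: "L2_on \<eta>"
    and bc: "\<And>x. x \<in> {-1..1} \<Longrightarrow> \<phi> (- x) = \<phi> x" "\<phi> 1 = 0" "\<zeta> 1 = 0"
  shows "((\<lambda>x. EL1 \<epsilon> (u x) (p x) (g x) * \<zeta> x + EL0 \<epsilon> (u x) (p x) (g x) * \<phi> x + 2 * Ja (u x) (p x) * (g x * \<eta> x))
      has_integral 0) {-1..1}"
proof -
  note D = profileD[OF P]
  have c\<phi>: "continuous_on {-1..1} \<phi>" by (rule DERIV_continuous_on[OF d\<phi>])
  have c\<zeta>: "continuous_on {-1..1} \<zeta>" by (rule abs_cont_continuous[OF ac])
  obtain z where z: "z \<in> {-1..1}" "\<And>y. y \<in> {-1..1} \<Longrightarrow> u z \<le> u y"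
    using continuous_attains_inf[OF compact_Icc _ D(8)] by auto
  have "bounded (\<phi> ` {-1..1})" by (intro compact_imp_bounded compact_continuous_image compact_Icc c\<phi>)
  then obtain F where F: "F > 0" "\<And>x. x \<in> {-1..1} \<Longrightarrow> \<bar>\<phi> x\<bar> \<le> F"
    unfolding bounded_pos by (auto simp del: atLeastAtMost_iff)
  \<comment> \<open>For \<open>\<bar>t\<bar> \<le> s\<close> the perturbation is at most half the
    minimum of \<open>u\<close>, so the competitor stays positive.\<close>
  define s where "s = u z / (2 * F)"
  have s: "s > 0" using D(5)[OF z(1)] F by (simp add: s_def)
  have pos: "u x + t * \<phi> x > 0" if t: "\<bar>t\<bar> \<le> s" and x: "x \<in> {-1..1}" for t x
  proof -
    have "\<bar>t * \<phi> x\<bar> \<le> s * F" unfolding abs_mult using t F(2)[OF x] s by (intro mult_mono) auto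
    also have "\<dots> = u z / 2" using F by (simp add: s_def)
    finally show ?thesis using z(2)[OF x] D(5)[OF z(1)] by linarith
  qed
  define a1 where "a1 x = Q (-5/2) (p x) * \<phi> x + (-5) * u x * p x * Q (-7/2) (p x) * \<zeta> x" for x
  define b1 where "b1 x = ((-1) * (p x * Q (-3/2) (p x) * u x powr (-1)) + 4 * \<epsilon> * u x * p x * Q (-1/2) (p x)) * \<zeta> x
        + ((-1) * (Q (-1/2) (p x) * u x powr (-2)) + 4 * \<epsilon> * Q (1/2) (p x)) * \<phi> x" for x
  have FD1: "first_order (\<lambda>t x. Ja (u x + t * \<phi> x) (p x + t * \<zeta> x)) (\<lambda>x. Ja (u x) (p x)) a1"
    unfolding a1_def by (rule first_order_density(1)[OF D(8,9) c\<phi> c\<zeta> D(5) s pos])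
  have FD2: "first_order (\<lambda>t x. Jb \<epsilon> (u x + t * \<phi> x) (p x + t * \<zeta> x)) (\<lambda>x. Jb \<epsilon> (u x) (p x)) b1"
    unfolding b1_def by (rule first_order_density(2)[OF D(8,9) c\<phi> c\<zeta> D(5) s pos])
  obtain C1 t1 where C1: "C1 \<ge> 0" "t1 > 0" "t1 \<le> 1"
    "\<And>t x. \<bar>t\<bar> \<le> t1 \<Longrightarrow> x \<in> {-1..1} \<Longrightarrow> \<bar>Ja (u x + t * \<phi> x) (p x + t * \<zeta> x) - Ja (u x) (p x) - t * a1 x\<bar> \<le> C1 * t\<^sup>2"
    "\<And>x. x \<in> {-1..1} \<Longrightarrow> \<bar>Ja (u x) (p x)\<bar> \<le> C1" "\<And>x. x \<in> {-1..1} \<Longrightarrow> \<bar>a1 x\<bar> \<le> C1"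
    by (rule first_orderE[OF FD1]) (rule that)
  obtain C2 t2 where C2: "C2 \<ge> 0" "t2 > 0"
    "\<And>t x. \<bar>t\<bar> \<le> t2 \<Longrightarrow> x \<in> {-1..1} \<Longrightarrow> \<bar>Jb \<epsilon> (u x + t * \<phi> x) (p x + t * \<zeta> x) - Jb \<epsilon> (u x) (p x) - t * b1 x\<bar> \<le> C2 * t\<^sup>2"
    by (rule first_orderE[OF FD2]) (rule that)
  define C where "C = C1 + C2"
  define \<tau> where "\<tau> = min s (min t1 t2)"
  have \<tau>: "\<tau> > 0" using s C1 C2 by (simp add: \<tau>_def)
  define L where "L x = a1 x * (g x)\<^sup>2 + 2 * Ja (u x) (p x) * (g x * \<eta> x) + b1 x" for x
  define R where "R x = 5 * C * (1 + (g x)\<^sup>2 + (\<eta> x)\<^sup>2)" for x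
  note ca = first_order_continuous(2)[OF FD1] and cb = first_order_continuous(2)[OF FD2]
  have "L absolutely_integrable_on {-1..1}"
    unfolding L_def
    by (intro set_integral_add(1) absolutely_integrable_continuous_mult ca D(15) absolutely_integrable_continuous_real cb
        L2_on_mult_absolutely_integrable D(3) L2 continuous_intros D(8,9))
  then have iL: "(L has_integral integral {-1..1} L) {-1..1}"
    by (intro integrable_integral integrable_on_Icc_sub(1)) auto
  have "R absolutely_integrable_on {-1..1}"
    unfolding R_def
    by (intro set_integral_add(1) absolutely_integrable_continuous_mult D(15) absolutely_integrable_continuous_real
        L2_on_sq_absolutely_integrable L2 continuous_on_const)
  then have iR: "(R has_integral integral {-1..1} R) {-1..1}"
    by (intro integrable_integral integrable_on_Icc_sub(1)) auto
  have iJ: "((\<lambda>x. Ja (u x) (p x) * (g x)\<^sup>2 + Jb \<epsilon> (u x) (p x)) has_integral energy \<epsilon> u p g) {-1..1}"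
    unfolding energy_def
    by (rule integrable_integral[OF integrable_on_Icc_sub(1)[OF profile_integrable(3)[OF P]]]) auto
  have key: "0 \<le> t * integral {-1..1} L + t\<^sup>2 * integral {-1..1} R" if t: "\<bar>t\<bar> \<le> \<tau>" for t
  proof -
    have t': "\<bar>t\<bar> \<le> s" "\<bar>t\<bar> \<le> t1" "\<bar>t\<bar> \<le> t2" using t by (auto simp: \<tau>_def)
    have V: "profile \<alpha> (\<lambda>x. u x + t * \<phi> x) (\<lambda>x. p x + t * \<zeta> x) (\<lambda>x. g x + t * \<eta> x)"
      unfolding profile_def
    proof (intro conjI ballI)
      show "abs_cont (\<lambda>x. p x + t * \<zeta> x) (\<lambda>x. g x + t * \<eta> x)" by (rule abs_cont_lin[OF D(2) ac])
      show "L2_on (\<lambda>x. g x + t * \<eta> x)" using L2_on_lin[OF D(3) L2, of 1 t] by simp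
      show "u 1 + t * \<phi> 1 = \<alpha>" "p 1 + t * \<zeta> 1 = 0" using D(6,7) bc by auto
      fix x :: real assume x: "x \<in> {-1..1}"
      show "((\<lambda>x. u x + t * \<phi> x) has_real_derivative p x + t * \<zeta> x) (at x within {-1..1})"
        by (intro DERIV_add DERIV_cmult D(1) d\<phi> x)
      show "u (- x) + t * \<phi> (- x) = u x + t * \<phi> x" using D(4)[OF x] bc(1)[OF x] by simp
      show "0 < u x + t * \<phi> x" by (rule pos[OF t'(1) x])
    qed
    have iV: "((\<lambda>x. Ja (u x + t * \<phi> x) (p x + t * \<zeta> x) * (g x + t * \<eta> x)\<^sup>2 + Jb \<epsilon> (u x + t * \<phi> x) (p x + t * \<zeta> x)) has_integral
        energy \<epsilon> (\<lambda>x. u x + t * \<phi> x) (\<lambda>x. p x + t * \<zeta> x) (\<lambda>x. g x + t * \<eta> x)) {-1..1}"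
      unfolding energy_def
      by (rule integrable_integral[OF integrable_on_Icc_sub(1)[OF profile_integrable(3)[OF V]]]) auto
    have "energy \<epsilon> (\<lambda>x. u x + t * \<phi> x) (\<lambda>x. p x + t * \<zeta> x) (\<lambda>x. g x + t * \<eta> x)
       \<le> energy \<epsilon> u p g + t * integral {-1..1} L + t\<^sup>2 * integral {-1..1} R"
    proof (rule has_integral_le[OF iV has_integral_add[OF has_integral_add[OF iJ has_integral_mult_right[OF iL]] has_integral_mult_right[OF iR]]])
      fix x :: real assume x: "x \<in> {-1..1}"
      have "C1 * t\<^sup>2 \<le> C * t\<^sup>2" "C2 * t\<^sup>2 \<le> C * t\<^sup>2" using C1(1) C2(1) by (auto simp: C_def intro!: mult_right_mono)
      moreover have "\<bar>t\<bar> \<le> 1" using t'(2) C1(3) by linarith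
      moreover have "0 \<le> C" "\<bar>Ja (u x) (p x)\<bar> \<le> C" "\<bar>a1 x\<bar> \<le> C"
        using C1(1) C2(1) C1(5)[OF x] C1(6)[OF x] by (auto simp: C_def)
      ultimately show "Ja (u x + t * \<phi> x) (p x + t * \<zeta> x) * (g x + t * \<eta> x)\<^sup>2 + Jb \<epsilon> (u x + t * \<phi> x) (p x + t * \<zeta> x)
         \<le> Ja (u x) (p x) * (g x)\<^sup>2 + Jb \<epsilon> (u x) (p x) + t * L x + t\<^sup>2 * R x"
        unfolding L_def R_def using order_trans[OF C1(4)[OF t'(2) x]] order_trans[OF C2(3)[OF t'(3) x]]
        by (intro density_expansion_bound) auto
    qed
    then show ?thesis using min[OF V] by linarith
  qed
  \<comment> \<open>Both signs of the parameter are treated at once through \<open>sg\<close>; after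
    division by \<open>t\<close> the term with \<open>R\<close> is at most \<open>e\<close>.\<close>
  have half: "0 \<le> sg * integral {-1..1} L" if sg: "\<bar>sg\<bar> = 1" for sg
  proof (rule field_le_epsilon)
    fix e :: real assume e: "e > 0"
    define r where "r = \<bar>integral {-1..1} R\<bar> + 1"
    define t where "t = min \<tau> (e / r)"
    have r: "r > 0" by (simp add: r_def)
    have t: "t > 0" "t \<le> \<tau>" "t \<le> e / r" using \<tau> e r by (auto simp: t_def)
    have tr: "t * r \<le> e" using t(3) r by (simp add: pos_le_divide_eq)
    have k: "0 \<le> (sg * t) * integral {-1..1} L + (sg * t)\<^sup>2 * integral {-1..1} R"
      by (rule key) (use t sg in \<open>simp add: abs_mult\<close>)
    have "sg\<^sup>2 = 1" using sg by (metis one_power2 power2_abs)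
    then have "(sg * t)\<^sup>2 = t * t" by (simp add: power_mult_distrib power2_eq_square[of t])
    from k[unfolded this] have "0 \<le> t * (sg * integral {-1..1} L + t * integral {-1..1} R)" by (simp add: algebra_simps)
    then have "0 \<le> sg * integral {-1..1} L + t * integral {-1..1} R" using t(1) by (simp add: zero_le_mult_iff)
    moreover have "t * integral {-1..1} R \<le> t * r" using t(1) by (intro mult_left_mono) (auto simp: r_def)
    ultimately show "0 \<le> sg * integral {-1..1} L + e" using tr by linarith
  qed
  have "integral {-1..1} L = 0" using half[of 1] half[of "-1"] by simp
  then have "(L has_integral 0) {-1..1}" using iL by simp
  moreover have "L = (\<lambda>x. EL1 \<epsilon> (u x) (p x) (g x) * \<zeta> x + EL0 \<epsilon> (u x) (p x) (g x) * \<phi> x + 2 * Ja (u x) (p x) * (g x * \<eta> x))"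
    unfolding L_def a1_def b1_def EL1_def EL0_def by (rule ext) (simp add: algebra_simps)
  ultimately show ?thesis by simp
qed

section \<open>Regularity\<close>

text \<open>The density \<open>g\<close> is known to be even only almost everywhere. Its average
  with the reflection is a density of \<open>(p x - p (- x)) / 2\<close>, which is \<open>p\<close>
  because \<open>p\<close> is odd. Pointwise evenness is what the parity rules for primitives ask
  for.\<close>

lemma profile_symmetrize:
  assumes P: "profile \<alpha> u p g"
  obtains h where "profile \<alpha> u p h" "\<And>x. h (- x) = h x"
proof -
  note D = profileD[OF P]
  have L2: "L2_on (\<lambda>x. g (- x))"
  proof -
    have "(\<lambda>x. indicator I01 x *\<^sub>R g x) \<in> borel_measurable borel"
      using D(14) by (simp add: set_borel_measurable_def)
    from measurable_compose[OF _ this, of uminus borel]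
    have "(\<lambda>x. indicator I01 (- x) *\<^sub>R g (- x)) \<in> borel_measurable lborel" by simp
    moreover have "(\<lambda>x. indicator I01 (- x) *\<^sub>R g (- x)) = (\<lambda>x. indicator I01 x *\<^sub>R g (- x))"
      by (auto simp: indicator_def)
    ultimately have m: "set_borel_measurable lborel I01 (\<lambda>x. g (- x))" unfolding set_borel_measurable_def by simp
    have "(\<lambda>x. (g (- x))\<^sup>2) absolutely_integrable_on {-1..- (-1)}"
      using D(15) by (rule absolutely_integrable_reflect_real[THEN iffD2])
    then have ai: "(\<lambda>x. (g (- x))\<^sup>2) absolutely_integrable_on {-1..1}" unfolding minus_minus .
    have m2: "set_borel_measurable lborel I01 (\<lambda>x. (g (- x))\<^sup>2)"
      unfolding power2_eq_square by (rule set_borel_measurable_mult_I01[OF m m])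
    show ?thesis unfolding L2_on_def using m set_integrable_lborelI[OF m2 ai] by (rule conjI)
  qed
  define h where "h x = 1/2 * g x + (1/2) * g (- x)" for x
  have "abs_cont (\<lambda>x. 1/2 * p x + (-1/2) * p (- x)) (\<lambda>x. 1/2 * g x + (-1/2) * (- g (- x)))"
    by (rule abs_cont_lin2[OF D(2) abs_cont_reflect[OF D(2)]])
  then have "abs_cont p h"
    by (rule abs_cont_cong[OF _ _ negligible_empty]) (simp_all add: D(11) h_def del: atLeastAtMost_iff)
  moreover have "L2_on h" unfolding h_def by (rule L2_on_lin[OF D(3) L2])
  ultimately have "profile \<alpha> u p h" using P unfolding profile_def by blast
  moreover have "h (- x) = h x" for x by (simp add: h_def)
  ultimately show ?thesis by (rule that)
qed

lemma L2_on_continuous_mult: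
  assumes "continuous_on {-1..1} c" "L2_on g"
  shows "L2_on (\<lambda>x. c x * g x)"
proof -
  have "set_integrable lborel I01 (\<lambda>x. (c x)\<^sup>2 * (g x)\<^sup>2)"
    using assms(2) by (intro set_integrable_continuous_mult_I01 continuous_intros assms(1)) (simp add: L2_on_def)
  moreover have "set_borel_measurable lborel I01 (\<lambda>x. c x * g x)"
    by (rule set_borel_measurable_mult_I01[OF set_borel_measurable_continuous_I01[OF assms(1)]])
       (use assms(2) in \<open>simp add: L2_on_def\<close>)
  ultimately show ?thesis by (simp add: L2_on_def power_mult_distrib)
qed

lemma L2_on_zero_negligible:
  assumes "L2_on f" "((\<lambda>x. (f x)\<^sup>2) has_integral 0) {-1..1}"
  obtains N where "negligible N" "\<And>x. x \<in> {-1..1} - N \<Longrightarrow> f x = 0"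
proof -
  have s: "set_integrable lborel I01 (\<lambda>x. (f x)\<^sup>2)" using assms(1) by (simp add: L2_on_def)
  have "(\<integral>x. indicator I01 x *\<^sub>R (f x)\<^sup>2 \<partial>lborel) = 0"
    using set_integrable_lborel_imp(2)[OF s] integral_unique[OF assms(2)] unfolding set_lebesgue_integral_def by simp
  then have "AE x in lborel. indicator I01 x *\<^sub>R (f x)\<^sup>2 = 0"
    using integral_nonneg_eq_0_iff_AE[OF s[unfolded set_integrable_def]] by simp
  then have "AE x in lborel. x \<in> I01 \<longrightarrow> f x = 0" by eventually_elim (auto simp: indicator_def)
  from AE_I01_negligible[OF this] show ?thesis using that by blast
qed

lemma Ck_Q: "Ck S n p \<Longrightarrow> Ck S n (\<lambda>x. Q e (p x))"
  unfolding Q_def power2_eq_square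
  by (intro Ck_powr Ck_add Ck_const Ck_mult) (use one_plus_sq_pos in \<open>simp_all add: power2_eq_square\<close>)

text \<open>The equation obtained for \<open>g\<close> has no derivative of \<open>g\<close> on its
  other side, only primitives of expressions in \<open>u\<close>, \<open>p\<close> and
  \<open>g\<close>, divided by a positive function of \<open>u\<close> and \<open>p\<close>. This
  gain of one order drives the bootstrap.\<close>

lemma minimizer_smooth:
  assumes P0: "profile \<alpha> u p g0"
    and min0: "\<And>w q h. profile \<alpha> w q h \<Longrightarrow> energy \<epsilon> u p g0 \<le> energy \<epsilon> w q h"
  shows "smooth_on {-1..1} u"
proof -
  obtain g where P: "profile \<alpha> u p g" and g_even: "\<And>x. g (- x) = g x"
    using profile_symmetrize[OF P0] by blast
  have "energy \<epsilon> u p g = energy \<epsilon> u p g0"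
    using Helfrich_eq_energy[OF P, of \<epsilon>] Helfrich_eq_energy[OF P0, of \<epsilon>] by simp
  then have min: "energy \<epsilon> u p g \<le> energy \<epsilon> w q h" if "profile \<alpha> w q h" for w q h using min0[OF that] by simp
  note D = profileD[OF P]
  have cpw: "continuous_on {-1..1} (\<lambda>x. u x powr e)" for e
    by (intro continuous_intros D(8)) (metis D(5) less_irrefl)
  define f1 where "f1 x = EL1 \<epsilon> (u x) (p x) (g x)" for x
  define f0 where "f0 x = EL0 \<epsilon> (u x) (p x) (g x)" for x
  have f1: "f1 absolutely_integrable_on {-1..1}"
    unfolding f1_def EL1_def
    by (intro set_integral_add(1) absolutely_integrable_continuous_mult[OF _ D(15)] absolutely_integrable_continuous_real
        continuous_intros D(8,9) cpw)
  have f0: "f0 absolutely_integrable_on {-1..1}"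
    unfolding f0_def EL0_def
    by (intro set_integral_add(1) absolutely_integrable_continuous_mult[OF _ D(15)] absolutely_integrable_continuous_real
        continuous_intros D(8,9) cpw)
  have Qm: "Q e (- y) = Q e y" for e y by (simp add: Q_def)
  have f1_odd: "f1 (- x) = - f1 x" and f0_even: "f0 (- x) = f0 x" if "x \<in> {-1..1}" for x
    unfolding f1_def f0_def EL1_def EL0_def D(4)[OF that] D(11)[OF that] g_even Qm by simp_all
  define F1 where "F1 x = 0 + integral {-1..x} f1" for x
  \<comment> \<open>The constant makes the values at -1 and 1 opposite, so that \<open>F0\<close> is
    odd and its primitive \<open>F\<close> even.\<close>
  define F0 where "F0 x = - (integral {-1..1} f0 / 2) + integral {-1..x} f0" for x
  have F1: "abs_cont F1 f1" unfolding F1_def by (rule abs_cont_indefinite_integral[OF f1])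
  have F0: "abs_cont F0 f0" unfolding F0_def by (rule abs_cont_indefinite_integral[OF f0])
  note cF1 = abs_cont_continuous[OF F1] and cF0 = abs_cont_continuous[OF F0]
  define F where "F x = 0 + integral {-1..x} F0" for x
  have F: "abs_cont F F0" unfolding F_def
    by (rule abs_cont_indefinite_integral[OF absolutely_integrable_continuous_real[OF cF0]])
  note cF = abs_cont_continuous[OF F]
  have F1_even: "F1 (- x) = F1 x" if "x \<in> {-1..1}" for x by (rule abs_cont_odd_imp_even[OF F1 f1_odd that])
  have F0_sym: "F0 (- x) + F0 x = 2 * F0 0" if "x \<in> {-1..1}" for x by (rule abs_cont_even_imp_odd[OF F0 f0_even that])
  have "F0 (-1) + F0 1 = 0" by (simp add: F0_def)
  then have F0_odd: "F0 (- x) = - F0 x" if "x \<in> {-1..1}" for x using F0_sym[OF that] F0_sym[of 1] by simp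
  have F_even: "F (- x) = F x" if "x \<in> {-1..1}" for x by (rule abs_cont_odd_imp_even[OF F F0_odd that])
  define a where "a x = 2 * Ja (u x) (p x)" for x
  have ca: "continuous_on {-1..1} a" unfolding a_def by (intro continuous_intros D(8,9))
  have apos: "a x > 0" if "x \<in> {-1..1}" for x unfolding a_def Ja_def using D(5)[OF that] Q_pos by simp
  have a_even: "a (- x) = a x" if "x \<in> {-1..1}" for x unfolding a_def Ja_def D(4)[OF that] D(11)[OF that] Qm ..
  define K where "K x = a x * g x + (F x + (-1) * F1 x)" for x
  have cFF: "continuous_on {-1..1} (\<lambda>x. F x + (-1) * F1 x)" by (intro continuous_intros cF cF1)
  have K_L2: "L2_on K"
    using L2_on_lin[OF L2_on_continuous_mult[OF ca D(3)] L2_on_continuous[OF cFF], of 1 1]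
    unfolding K_def by simp
  have K_ai: "K absolutely_integrable_on {-1..1}"
    unfolding K_def by (intro set_integral_add(1) absolutely_integrable_continuous_mult[OF ca abs_contD(1)[OF D(2)]]
        absolutely_integrable_continuous_real[OF cFF])
  \<comment> \<open>This is the mean of \<open>K\<close>, the interval having length 2.\<close>
  define \<kappa> where "\<kappa> = integral {-1..1} K / 2"
  define \<eta> where "\<eta> x = K x + (- \<kappa>)" for x
  have \<eta>_L2: "L2_on \<eta>"
    using L2_on_lin[OF K_L2 L2_on_continuous[OF continuous_on_const[of _ 1]], of 1 "- \<kappa>"] unfolding \<eta>_def by simp
  have \<eta>_ai: "\<eta> absolutely_integrable_on {-1..1}"
    unfolding \<eta>_def by (intro set_integral_add(1) K_ai absolutely_integrable_continuous_real continuous_on_const)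
  have \<eta>_even: "\<eta> (- x) = \<eta> x" if "x \<in> {-1..1}" for x
    unfolding \<eta>_def K_def a_even[OF that] g_even F_even[OF that] F1_even[OF that] ..
  have \<eta>0: "(\<eta> has_integral 0) {-1..1}"
  proof -
    have h1: "(K has_integral integral {-1..1} K) {-1..1}"
      by (rule integrable_integral[OF integrable_on_Icc_sub(1)[OF K_ai]]) auto
    have h2: "((\<lambda>x::real. - \<kappa>) has_integral (1 - (-1)) * (- \<kappa>)) {-1..1}"
      using has_integral_const_real[of "- \<kappa>" "-1" 1] by simp
    have "integral {-1..1} K + (1 - (-1)) * (- \<kappa>) = 0" by (simp add: \<kappa>_def)
    then show ?thesis using has_integral_add[OF h1 h2] unfolding \<eta>_def by (simp only:)
  qed
  define \<zeta> where "\<zeta> x = 0 + integral {-1..x} \<eta>" for x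
  have \<zeta>: "abs_cont \<zeta> \<eta>" unfolding \<zeta>_def by (rule abs_cont_indefinite_integral[OF \<eta>_ai])
  note c\<zeta> = abs_cont_continuous[OF \<zeta>]
  \<comment> \<open>Mean zero of \<open>\<eta>\<close> gives \<open>\<zeta> 1 = 0\<close>; then
    \<open>\<zeta> 0 = 0\<close> and \<open>\<zeta>\<close> is odd, so \<open>\<phi>\<close> is even
    and its value at 1 equals the one at -1.\<close>
  have \<zeta>m1: "\<zeta> (-1) = 0" and \<zeta>1: "\<zeta> 1 = 0" using integral_unique[OF \<eta>0] by (simp_all add: \<zeta>_def)
  have \<zeta>_sym: "\<zeta> (- x) + \<zeta> x = 2 * \<zeta> 0" if "x \<in> {-1..1}" for x by (rule abs_cont_even_imp_odd[OF \<zeta> \<eta>_even that])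
  have \<zeta>_odd: "\<zeta> (- x) = - \<zeta> x" if "x \<in> {-1..1}" for x using \<zeta>_sym[OF that] \<zeta>_sym[of 1] \<zeta>m1 \<zeta>1 by simp
  define \<phi> where "\<phi> x = 0 + integral {-1..x} \<zeta>" for x
  have \<phi>: "abs_cont \<phi> \<zeta>" unfolding \<phi>_def
    by (rule abs_cont_indefinite_integral[OF absolutely_integrable_continuous_real[OF c\<zeta>]])
  have \<phi>_even: "\<phi> (- x) = \<phi> x" if "x \<in> {-1..1}" for x by (rule abs_cont_odd_imp_even[OF \<phi> \<zeta>_odd that])
  have \<phi>m1: "\<phi> (-1) = 0" by (simp add: \<phi>_def)
  then have \<phi>1: "\<phi> 1 = 0" using \<phi>_even[of 1] by simp
  have EL: "((\<lambda>x. f1 x * \<zeta> x + f0 x * \<phi> x + a x * (g x * \<eta> x)) has_integral 0) {-1..1}"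
    using energy_first_variation[OF P min abs_cont_continuous_imp_C1[OF \<phi> c\<zeta>] \<zeta> \<eta>_L2 \<phi>_even \<phi>1 \<zeta>1]
    unfolding f1_def f0_def a_def .
  have h1: "((\<lambda>x. F1 x * \<eta> x + \<zeta> x * f1 x) has_integral 0) {-1..1}"
    using abs_contD(3)[OF abs_cont_mult[OF F1 \<zeta>]] unfolding \<zeta>1 \<zeta>m1 by simp
  have h2: "((\<lambda>x. F0 x * \<zeta> x + \<phi> x * f0 x) has_integral 0) {-1..1}"
    using abs_contD(3)[OF abs_cont_mult[OF F0 \<phi>]] unfolding \<phi>1 \<phi>m1 by simp
  have h3: "((\<lambda>x. F x * \<eta> x + \<zeta> x * F0 x) has_integral 0) {-1..1}"
    using abs_contD(3)[OF abs_cont_mult[OF F \<zeta>]] unfolding \<zeta>1 \<zeta>m1 by simp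
  \<comment> \<open>The derivatives of \<open>F1 * \<zeta>\<close>, \<open>F0 * \<phi>\<close> and
    \<open>F * \<zeta>\<close> have integral 0, and so does \<open>\<kappa> * \<eta>\<close>. In
    this combination every term containing \<open>\<zeta>\<close> or \<open>\<phi>\<close> cancels
    and \<open>(K - \<kappa>) * \<eta>\<close> remains.\<close>
  note H = has_integral_add[OF has_integral_add[OF has_integral_diff[OF has_integral_diff[OF EL h1] h2] h3] has_integral_mult_right[OF \<eta>0, of "- \<kappa>"]]
  have "(\<lambda>x. f1 x * \<zeta> x + f0 x * \<phi> x + a x * (g x * \<eta> x) - (F1 x * \<eta> x + \<zeta> x * f1 x) - (F0 x * \<zeta> x + \<phi> x * f0 x)
       + (F x * \<eta> x + \<zeta> x * F0 x) + (- \<kappa>) * \<eta> x) = (\<lambda>x. (\<eta> x)\<^sup>2)"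
    by (rule ext) (simp add: \<eta>_def K_def power2_eq_square algebra_simps)
  then have "((\<lambda>x. (\<eta> x)\<^sup>2) has_integral 0 - 0 - 0 + 0 + (- \<kappa>) * 0) {-1..1}" using H by (simp only:)
  then have "((\<lambda>x. (\<eta> x)\<^sup>2) has_integral 0) {-1..1}" by (simp only: diff_0_right add_0_right mult_zero_right)
  then obtain N where N: "negligible N" "\<And>x. x \<in> {-1..1} - N \<Longrightarrow> \<eta> x = 0"
    using L2_on_zero_negligible[OF \<eta>_L2] by blast
  \<comment> \<open>\<open>r\<close> is the continuous representative of \<open>u''\<close>, read
    off from \<open>K = \<kappa>\<close>, which holds almost everywhere.\<close>
  define r where "r x = (\<kappa> + (F1 x + (-1) * F x)) * a x powr (-1)" for x
  have gr: "g x = r x" if x: "x \<in> {-1..1} - N" for x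
  proof -
    have "a x * g x = \<kappa> + (F1 x + (-1) * F x)" using N(2)[OF x] by (simp add: \<eta>_def K_def)
    moreover have "a x > 0" using apos x by blast
    ultimately show ?thesis by (simp add: r_def powr_minus_divide field_simps)
  qed
  have cr: "continuous_on {-1..1} r"
    unfolding r_def by (intro continuous_intros cF cF1 ca) (metis apos less_irrefl)
  have pr: "abs_cont p r" by (rule abs_cont_cong[OF D(2) refl N(1) gr])
  have dp: "(p has_real_derivative r x) (at x within {-1..1})" if "x \<in> {-1..1}" for x
    by (rule abs_cont_continuous_imp_C1[OF pr cr that])
  \<comment> \<open>Replacing \<open>g\<close> by \<open>r\<close> changes the Euler-Lagrange terms
    only on a negligible set, so \<open>F1\<close> and \<open>F0\<close> remain primitives of them,
    now with continuous densities.\<close>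
  define e1 where "e1 x = EL1 \<epsilon> (u x) (p x) (r x)" for x
  define e0 where "e0 x = EL0 \<epsilon> (u x) (p x) (r x)" for x
  have ce: "continuous_on {-1..1} e1" "continuous_on {-1..1} e0"
    unfolding e1_def e0_def EL1_def EL0_def by (intro continuous_intros D(8,9) cpw cr)+
  have F1e: "abs_cont F1 e1" by (rule abs_cont_cong[OF F1 refl N(1)]) (simp add: f1_def e1_def gr del: atLeastAtMost_iff)
  have F0e: "abs_cont F0 e0" by (rule abs_cont_cong[OF F0 refl N(1)]) (simp add: f0_def e0_def gr del: atLeastAtMost_iff)
  have dF1: "(F1 has_real_derivative e1 x) (at x within {-1..1})" if "x \<in> {-1..1}" for x
    by (rule abs_cont_continuous_imp_C1[OF F1e ce(1) that])
  have dF0: "(F0 has_real_derivative e0 x) (at x within {-1..1})" if "x \<in> {-1..1}" for x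
    by (rule abs_cont_continuous_imp_C1[OF F0e ce(2) that])
  have dF: "(F has_real_derivative F0 x) (at x within {-1..1})" if "x \<in> {-1..1}" for x
    by (rule abs_cont_continuous_imp_C1[OF F cF0 that])
  have up: "Ck {-1..1} (Suc n) h" if "Ck {-1..1} n h'" "\<And>x. x \<in> {-1..1} \<Longrightarrow> (h has_real_derivative h' x) (at x within {-1..1})" for n h h'
    unfolding Ck.simps using that by blast
  \<comment> \<open>If \<open>r\<close> has order \<open>n\<close>, then \<open>p\<close> and
    \<open>u\<close> have order \<open>n + 1\<close>; the integrands of \<open>F1\<close> and
    \<open>F0\<close> have order \<open>n\<close>, these primitives and \<open>F\<close> have order
    \<open>n + 1\<close>, and so does \<open>r\<close>.\<close>
  have Ck_r: "Ck {-1..1} n r" for n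
  proof (induction n)
    case 0
    then show ?case using cr by simp
  next
    case (Suc n)
    have p: "Ck {-1..1} (Suc n) p" by (rule up[OF Suc.IH dp])
    have p': "Ck {-1..1} n p" by (rule Ck_SucD[OF p])
    have u: "Ck {-1..1} (Suc n) u" by (rule up[OF p' D(1)])
    have u': "Ck {-1..1} n u" by (rule Ck_SucD[OF u])
    have "Ck {-1..1} n e1"
      unfolding e1_def EL1_def power2_eq_square
      by (intro Ck_add Ck_mult Ck_const Ck_Q Ck_powr u' p' Suc.IH D(5))
    then have F1': "Ck {-1..1} (Suc n) F1" by (rule up[OF _ dF1])
    have "Ck {-1..1} n e0"
      unfolding e0_def EL0_def power2_eq_square
      by (intro Ck_add Ck_mult Ck_const Ck_Q Ck_powr u' p' Suc.IH D(5))
    then have "Ck {-1..1} (Suc n) F0" by (rule up[OF _ dF0])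
    then have F': "Ck {-1..1} (Suc n) F" by (rule up[OF Ck_SucD dF])
    have a': "Ck {-1..1} (Suc n) a"
      unfolding a_def Ja_def by (intro Ck_mult Ck_const Ck_Q u p)
    show ?case
      unfolding r_def by (intro Ck_mult Ck_add Ck_const Ck_powr F1' F' a' apos)
  qed
  have "Ck {-1..1} n u" for n
    by (rule Ck_SucD[OF up[OF Ck_SucD[OF up[OF Ck_r dp]] D(1)]])
  note Ck_u = this
  show ?thesis by (rule smooth_on_Ck[OF at_within_Icc_ne_bot Ck_u])
qed

theorem theorem3p3:
  fixes \<alpha> \<epsilon> :: real and v :: "real \<Rightarrow> real"
  assumes "\<alpha> > 0" and "0 \<le> \<epsilon>" and "\<epsilon> \<le> 4"
    and "v \<in> N_set \<alpha>" and "Helfrich \<epsilon> v < pi * (4 + \<epsilon>)"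
  shows "\<exists>u\<in>N_set \<alpha>. (\<forall>w\<in>N_set \<alpha>. Helfrich \<epsilon> u \<le> Helfrich \<epsilon> w) \<and> smooth_on {-1..1} u"
proof -
  note v = N_set_profile[OF assms(4)]
  have "energy \<epsilon> v (d1 v) (d2 v) < 2 * (4 + \<epsilon>)"
  proof -
    have "pi * energy \<epsilon> v (d1 v) (d2 v) < pi * (2 * (4 + \<epsilon>))"
      using assms(5) unfolding Helfrich_eq_energy[OF v] by simp
    then show ?thesis by (rule mult_less_cancel_left_pos[OF pi_gt_zero, THEN iffD1])
  qed
  then obtain u p g where P: "profile \<alpha> u p g"
    and min: "\<And>w q h. profile \<alpha> w q h \<Longrightarrow> energy \<epsilon> u p g \<le> energy \<epsilon> w q h"
    using energy_minimizer_exists[OF assms(1-3) v] by blast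
  have "Helfrich \<epsilon> u \<le> Helfrich \<epsilon> w" if "w \<in> N_set \<alpha>" for w
    using min[OF N_set_profile[OF that]]
    unfolding Helfrich_eq_energy[OF P] Helfrich_eq_energy[OF N_set_profile[OF that]] by simp
  then show ?thesis
    using profile_N_set[OF P] minimizer_smooth[OF P min] by blast
qed

end
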